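(* Let $m\in\mathbb Z^+$ and $\mathcal D_{2m}=\{(z,w)\in\mathbb C^2:|z|^2+|w|^{2m}<1\}$. Let $g_{\mathrm{FS}}^{\mathcal D_{2m}}$ be the Fefferman--Szegő metric, $g_{\mathrm B}^{\mathcal D_{2m}}$ the Bergman metric, and $g_m^{\mathcal D_{2m}}$ the complete Kähler metric with components $-\partial_i\partial_{\bar j}\log\rho_m$, where $\rho_m(z,w)=(1-|z|^2)^{1/m}-|w|^2$. The following statements are equivalent: (i) $g_{\mathrm{FS}}^{\mathcal D_{2m}}$ is Kähler--Einstein; (ii) $g_{\mathrm{FS}}^{\mathcal D_{2m}}=\lambda g_{\mathrm B}^{\mathcal D_{2m}}$ for some $\lambda>0$; (iii) $g_{\mathrm{FS}}^{\mathcal D_{2m}}=\lambda g_m^{\mathcal D_{2m}}$ for some $\lambda>0$; (iv) $m=1$.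
   Context: Put $\rho(z,w)=|z|^2+|w|^{2m}-1$ and let $\sigma_{\mathrm E}$ be the Euclidean surface measure on $\partial\mathcal D_{2m}$. The Fefferman surface area measure is $d\sigma_{\mathrm F}=\varpi_{\mathrm F}\,d\sigma_{\mathrm E}$ with $$\varpi_{\mathrm F}=\frac1{|d\rho|}\left|\det\begin{pmatrix}\rho&\partial_{\bar j}\rho\\ \partial_i\rho&\partial_i\partial_{\bar j}\rho\end{pmatrix}_{1\le i,j\le 2}\right|^{\frac13},\qquad |d\rho|=\big(|\partial_z\rho|^2+|\partial_w\rho|^2\big)^{1/2},$$ i.e. $\varpi_{\mathrm F}(z,w)=\dfrac{(m^2|w|^{2m-2})^{1/3}}{\sqrt{|z|^2+m^2|w|^{4m-2}}}$ on $\partial\mathcal D_{2m}$. For $\xi\in\partial\mathcal D_{2m}$ let $\nu_\xi$ be the outward unit normal and let $\delta_\xi(z)$ be the minimum of the Euclidean distances from $z$ to $\partial\mathcal D_{2m}$ and to the tangent plane of $\partial\mathcal D_{2m}$ at $\xi$. For $\alpha>0$ let $\Gamma_\alpha(\xi)=\{z\in\mathcal D_{2m}:|(\xi-z)\cdot\overline{\nu_\xi}|<(1+\alpha)\delta_\xi(z),\ |\xi-z|^2<\alpha\delta_\xi(z)\}$, where $\cdot$ is the complex bilinear dot product, and let $\mathcal N(f)(\xi)=\sup_{z\in\Gamma_\alpha(\xi)}|f(z)|$. The Fefferman--Hardy space $\mathrm H^2_{\mathrm F}(\partial\mathcal D_{2m})$ is the set of holomorphic $f$ on $\mathcal D_{2m}$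 with $\mathcal N(f)\in L^2(\partial\mathcal D_{2m},\sigma_{\mathrm F})$. Each such $f$ has a non-tangential boundary value $f^*$ $\sigma_{\mathrm F}$-a.e., and with the norm $\big(\int|f^*|^2d\sigma_{\mathrm F}\big)^{1/2}$ the space is a reproducing kernel Hilbert space. Its reproducing kernel $S_{\mathcal D_{2m}}(\zeta,\eta)$, satisfying $f(\zeta)=\int_{\partial\mathcal D_{2m}}S_{\mathcal D_{2m}}(\zeta,\xi)f^*(\xi)\,d\sigma_{\mathrm F}(\xi)$, is the Fefferman--Szegő kernel; write $S_{\mathcal D_{2m}}(\zeta)=S_{\mathcal D_{2m}}(\zeta,\zeta)$. The Fefferman--Szegő metric is the Kähler metric with components $g_{i\bar j}=\partial_i\partial_{\bar j}\log S_{\mathcal D_{2m}}$ in the coordinates $(z_1,z_2)=(z,w)$. The Bergman metric has components $\partial_i\partial_{\bar j}\log K_{\mathcal D_{2m}}$, with $K_{\mathcal D_{2m}}$ the Bergman kernel on the diagonal. The Ricci curvature has components $\mathrm{Ric}_{i\bar j}=-\partial_i\partial_{\bar j}\log\det(g_{k\bar l})$, and the metric is Kähler--Einstein if there is a real constant $\lambda$ with $\mathrm{Ric}_{i\bar j}=\lambda g_{i\bar j}$ on $\mathcal D_{2m}$. *)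

theory Defs
  imports "HOL-Analysis.Analysis"
begin

text \<open>
  \<open>\<complex>\<^sup>2\<close> is rendered as \<^typ>\<open>complex \<times> complex\<close>: its norm and real inner product are the Euclidean
  ones of \<open>\<real>\<^sup>4\<close>, and \<open>lborel\<close> is Lebesgue measure. Coordinates are indexed by the two-element
  type \<open>2\<close>, whose elements are \<open>1\<close> and \<open>2\<close> (the latter equal to \<open>0\<close>).
\<close>

type_synonym C2 = "complex \<times> complex"


subsection \<open>Wirtinger derivatives and holomorphic functions\<close>

definition cvec :: "2 \<Rightarrow> complex \<Rightarrow> C2" where
  "cvec j c = (if j = 1 then (c, 0) else (0, c))"

definition partial_dir :: "C2 \<Rightarrow> (C2 \<Rightarrow> complex) \<Rightarrow> C2 \<Rightarrow> complex" where
  "partial_dir v f p = vector_derivative (\<lambda>t::real. f (p + t *\<^sub>R v)) (at 0)"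

definition wirt :: "2 \<Rightarrow> (C2 \<Rightarrow> complex) \<Rightarrow> C2 \<Rightarrow> complex" where
  "wirt j f p = (partial_dir (cvec j 1) f p - \<i> * partial_dir (cvec j \<i>) f p) / 2"

definition wirt_bar :: "2 \<Rightarrow> (C2 \<Rightarrow> complex) \<Rightarrow> C2 \<Rightarrow> complex" where
  "wirt_bar j f p = (partial_dir (cvec j 1) f p + \<i> * partial_dir (cvec j \<i>) f p) / 2"

definition holomorphic2_on :: "(C2 \<Rightarrow> complex) \<Rightarrow> C2 set \<Rightarrow> bool" where
  "holomorphic2_on f D \<longleftrightarrow>
     (\<forall>p\<in>D. \<exists>a b. (f has_derivative (\<lambda>h. a * fst h + b * snd h)) (at p))"


subsection \<open>Metrics on domains\<close>

text \<open>A metric is given by the matrix \<open>g p $ i $ j\<close> of its components with respect to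
  \<open>dz\<^sub>i\<close> and the conjugate of \<open>dz\<^sub>j\<close>.\<close>

definition complex_hessian :: "(C2 \<Rightarrow> complex) \<Rightarrow> C2 \<Rightarrow> complex^2^2" where
  "complex_hessian f p = (\<chi> i j. wirt i (wirt_bar j f) p)"

definition ricci :: "(C2 \<Rightarrow> complex^2^2) \<Rightarrow> C2 \<Rightarrow> complex^2^2" where
  "ricci g p = - complex_hessian (\<lambda>q. ln (det (g q))) p"

definition kahler_einstein_on :: "C2 set \<Rightarrow> (C2 \<Rightarrow> complex^2^2) \<Rightarrow> bool" where
  "kahler_einstein_on D g \<longleftrightarrow> (\<exists>c::real. \<forall>p\<in>D. ricci g p = c *\<^sub>R g p)"

definition positive_multiple_on ::
    "C2 set \<Rightarrow> (C2 \<Rightarrow> complex^2^2) \<Rightarrow> (C2 \<Rightarrow> complex^2^2) \<Rightarrow> bool" where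
  "positive_multiple_on D g h \<longleftrightarrow> (\<exists>c::real. c > 0 \<and> (\<forall>p\<in>D. g p = c *\<^sub>R h p))"


subsection \<open>The domain\<close>

definition egg :: "nat \<Rightarrow> C2 set" where
  "egg m = {p. cmod (fst p) ^ 2 + cmod (snd p) ^ (2 * m) < 1}"

definition rho :: "nat \<Rightarrow> C2 \<Rightarrow> real" where
  "rho m p = cmod (fst p) ^ 2 + cmod (snd p) ^ (2 * m) - 1"


subsection \<open>Surface measure\<close>

text \<open>Gram determinant of the derivative of \<open>\<Phi>\<close> at \<open>u\<close>: the determinant, by the Leibniz formula, of
  the matrix of real inner products of the partial derivatives of \<open>\<Phi>\<close>, indexed by the orthonormal
  basis of the parameter space.\<close>

definition gram_det :: "('a::euclidean_space \<Rightarrow> 'b::euclidean_space) \<Rightarrow> 'a \<Rightarrow> real" where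
  "gram_det \<Phi> u =
     (\<Sum>\<pi> | \<pi> permutes (Basis :: 'a set). of_int (sign \<pi>) *
        (\<Prod>b\<in>Basis. frechet_derivative \<Phi> (at u) b \<bullet> frechet_derivative \<Phi> (at u) (\<pi> b)))"

definition surface_measure ::
    "('a::euclidean_space \<Rightarrow> 'b::euclidean_space) \<Rightarrow> 'a set \<Rightarrow> 'b set \<Rightarrow> 'b measure" where
  "surface_measure \<Phi> U M =
     distr (density (restrict_space lborel U) (\<lambda>u. ennreal (sqrt (gram_det \<Phi> u))))
       (restrict_space borel M) \<Phi>"

definition egg_param :: "nat \<Rightarrow> complex \<times> real \<Rightarrow> C2" where
  "egg_param m u =
     (of_real (sqrt (1 - cmod (fst u) ^ (2 * m))) * cis (snd u), fst u)"

definition egg_param_dom :: "(complex \<times> real) set" where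
  "egg_param_dom = ball 0 1 \<times> {0..<2 * pi}"

text \<open>The chart \<open>egg_param\<close> is injective on \<open>egg_param_dom\<close> and misses only the circle
  \<open>z = 0\<close> of the three-dimensional boundary, a null set.\<close>

lemma bij_betw_egg_param:
  assumes "m \<ge> 1"
  shows "bij_betw (egg_param m) egg_param_dom {p. rho m p = 0 \<and> fst p \<noteq> 0}"
proof -
  have lt: "x ^ (2 * m) < 1 \<longleftrightarrow> x < 1" if "x \<ge> 0" for x :: real
    using that assms by (simp add: power_less_one_iff)
  show ?thesis
    unfolding bij_betw_def
  proof (intro conjI inj_onI equalityI subsetI)
    fix u v assume u: "u \<in> egg_param_dom" and v: "v \<in> egg_param_dom"
      and eq: "egg_param m u = egg_param m v"
    have f: "fst u = fst v" using eq by (simp add: egg_param_def)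
    have "sqrt (1 - cmod (fst v) ^ (2 * m)) > 0"
      using v lt[of "cmod (fst v)"] by (auto simp: egg_param_dom_def)
    then have "cis (snd u) = cis (snd v)" using eq f by (simp add: egg_param_def)
    then have "sin (snd u) = sin (snd v)" "cos (snd u) = cos (snd v)"
      by (auto simp: complex_eq_iff)
    then obtain n :: int where n: "snd u = snd v + 2 * pi * n"
      by (metis sin_cos_eq_iff)
    have "\<bar>snd u - snd v\<bar> < 2 * pi" using u v by (auto simp: egg_param_dom_def)
    then have "\<bar>real_of_int n\<bar> < 1" using n by (simp add: abs_mult)
    then have "n = 0" by linarith
    then show "u = v" using n f by (simp add: prod_eq_iff)
  next
    fix p assume "p \<in> egg_param m ` egg_param_dom"
    then obtain u where u: "u \<in> egg_param_dom" "p = egg_param m u" by auto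
    have "cmod (fst u) ^ (2 * m) < 1"
      using u lt[of "cmod (fst u)"] by (auto simp: egg_param_dom_def)
    then show "p \<in> {p. rho m p = 0 \<and> fst p \<noteq> 0}"
      using u by (auto simp: rho_def egg_param_def norm_mult)
  next
    fix p assume p: "p \<in> {p. rho m p = 0 \<and> fst p \<noteq> 0}"
    define u where "u = (snd p, Arg2pi (fst p))"
    have c: "cmod (fst p) ^ 2 = 1 - cmod (snd p) ^ (2 * m)" "cmod (fst p) > 0"
      using p by (auto simp: rho_def)
    then have "cmod (snd p) ^ (2 * m) < 1"
      by (smt (verit) zero_less_power)
    then have "u \<in> egg_param_dom"
      using lt[of "cmod (snd p)"] Arg2pi[of "fst p"] by (auto simp: u_def egg_param_dom_def)
    moreover have "egg_param m u = p"
      using c Arg2pi_eq[of "fst p"] 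
      by (simp add: u_def egg_param_def prod_eq_iff cis_conv_exp flip: c(1))
    ultimately show "p \<in> egg_param m ` egg_param_dom" by force
  qed
qed

definition euclid_measure :: "nat \<Rightarrow> C2 measure" where
  "euclid_measure m = surface_measure (egg_param m) egg_param_dom (frontier (egg m))"

definition fefferman_weight :: "nat \<Rightarrow> C2 \<Rightarrow> real" where
  "fefferman_weight m p =
     (let r = (\<lambda>q. complex_of_real (rho m q)) in
       root 3 (cmod (det (vector
         [vector [r p, wirt_bar 1 r p, wirt_bar 2 r p],
          vector [wirt 1 r p, wirt 1 (wirt_bar 1 r) p, wirt 1 (wirt_bar 2 r) p],
          vector [wirt 2 r p, wirt 2 (wirt_bar 1 r) p, wirt 2 (wirt_bar 2 r) p]]
          :: complex^3^3)))
       / sqrt (cmod (wirt 1 r p) ^ 2 + cmod (wirt 2 r p) ^ 2))"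

definition fefferman_measure :: "nat \<Rightarrow> C2 measure" where
  "fefferman_measure m = density (euclid_measure m) (\<lambda>p. ennreal (fefferman_weight m p))"


subsection \<open>The Fefferman--Hardy space and its reproducing kernel\<close>

text \<open>Normalised real gradient of the defining function.\<close>

definition outward_normal :: "nat \<Rightarrow> C2 \<Rightarrow> C2" where
  "outward_normal m \<xi> = sgn (\<Sum>b\<in>Basis. frechet_derivative (rho m) (at \<xi>) b *\<^sub>R b)"

definition tangent_plane :: "nat \<Rightarrow> C2 \<Rightarrow> C2 set" where
  "tangent_plane m \<xi> = {p. (p - \<xi>) \<bullet> outward_normal m \<xi> = 0}"

definition stein_delta :: "nat \<Rightarrow> C2 \<Rightarrow> C2 \<Rightarrow> real" where
  "stein_delta m \<xi> p = min (infdist p (frontier (egg m))) (infdist p (tangent_plane m \<xi>))"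

definition approach_region :: "nat \<Rightarrow> real \<Rightarrow> C2 \<Rightarrow> C2 set" where
  "approach_region m \<alpha> \<xi> =
     {p \<in> egg m.
        cmod ((fst \<xi> - fst p) * cnj (fst (outward_normal m \<xi>))
            + (snd \<xi> - snd p) * cnj (snd (outward_normal m \<xi>))) < (1 + \<alpha>) * stein_delta m \<xi> p
        \<and> norm (\<xi> - p) ^ 2 < \<alpha> * stein_delta m \<xi> p}"

definition nt_maximal :: "nat \<Rightarrow> real \<Rightarrow> (C2 \<Rightarrow> complex) \<Rightarrow> C2 \<Rightarrow> ennreal" where
  "nt_maximal m \<alpha> f \<xi> = (SUP p\<in>approach_region m \<alpha> \<xi>. ennreal (cmod (f p)))"

definition fefferman_hardy :: "nat \<Rightarrow> real \<Rightarrow> (C2 \<Rightarrow> complex) set" where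
  "fefferman_hardy m \<alpha> =
     {f. holomorphic2_on f (egg m)
         \<and> nt_maximal m \<alpha> f \<in> borel_measurable (fefferman_measure m)
         \<and> (\<integral>\<^sup>+ \<xi>. nt_maximal m \<alpha> f \<xi> ^ 2 \<partial>fefferman_measure m) < \<infinity>}"

text \<open>Boundary values are determined, and by Fatou's theorem exist, only almost everywhere. They are
  therefore rendered as a relation between \<open>f\<close> and its boundary functions.\<close>

definition has_boundary_value ::
    "nat \<Rightarrow> real \<Rightarrow> (C2 \<Rightarrow> complex) \<Rightarrow> (C2 \<Rightarrow> complex) \<Rightarrow> bool" where
  "has_boundary_value m \<alpha> f b \<longleftrightarrow>
     b \<in> borel_measurable (fefferman_measure m)
     \<and> (AE \<xi> in fefferman_measure m. (f \<longlongrightarrow> b \<xi>) (at \<xi> within approach_region m \<alpha> \<xi>))"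

text \<open>For \<open>\<zeta>\<close> in the domain and \<open>\<xi>\<close> on the boundary, \<open>S \<zeta> \<xi>\<close> stands for the conjugate of the boundary
  value at \<open>\<xi>\<close> of \<open>S _ \<zeta>\<close>.\<close>

definition is_fefferman_szego_kernel ::
    "nat \<Rightarrow> real \<Rightarrow> (C2 \<Rightarrow> C2 \<Rightarrow> complex) \<Rightarrow> bool" where
  "is_fefferman_szego_kernel m \<alpha> S \<longleftrightarrow>
     (\<forall>\<zeta>\<in>egg m.
        (\<lambda>p. S p \<zeta>) \<in> fefferman_hardy m \<alpha>
        \<and> (\<exists>k. has_boundary_value m \<alpha> (\<lambda>p. S p \<zeta>) k
             \<and> (\<forall>f\<in>fefferman_hardy m \<alpha>. \<forall>b. has_boundary_value m \<alpha> f b \<longrightarrow>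
                  f \<zeta> = (LINT \<xi>|fefferman_measure m. cnj (k \<xi>) * b \<xi>))))"

text \<open>The defining property determines the kernel on \<open>egg m \<times> egg m\<close>.\<close>

definition fefferman_szego_kernel :: "nat \<Rightarrow> real \<Rightarrow> C2 \<Rightarrow> C2 \<Rightarrow> complex" where
  "fefferman_szego_kernel m \<alpha> = (SOME S. is_fefferman_szego_kernel m \<alpha> S)"


subsection \<open>The Bergman kernel\<close>

definition bergman_space :: "C2 set \<Rightarrow> (C2 \<Rightarrow> complex) set" where
  "bergman_space D =
     {f. holomorphic2_on f D \<and> set_integrable lborel D (\<lambda>p. cmod (f p) ^ 2)}"

definition is_bergman_kernel :: "C2 set \<Rightarrow> (C2 \<Rightarrow> C2 \<Rightarrow> complex) \<Rightarrow> bool" where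
  "is_bergman_kernel D K \<longleftrightarrow>
     (\<forall>\<zeta>\<in>D. (\<lambda>p. K p \<zeta>) \<in> bergman_space D
        \<and> (\<forall>f\<in>bergman_space D. f \<zeta> = (LINT p:D|lborel. cnj (K p \<zeta>) * f p)))"

definition bergman_kernel :: "C2 set \<Rightarrow> C2 \<Rightarrow> C2 \<Rightarrow> complex" where
  "bergman_kernel D = (SOME K. is_bergman_kernel D K)"


subsection \<open>The three metrics\<close>

definition fefferman_szego_metric :: "nat \<Rightarrow> real \<Rightarrow> C2 \<Rightarrow> complex^2^2" where
  "fefferman_szego_metric m \<alpha> = complex_hessian (\<lambda>p. ln (fefferman_szego_kernel m \<alpha> p p))"

definition bergman_metric :: "C2 set \<Rightarrow> C2 \<Rightarrow> complex^2^2" where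
  "bergman_metric D = complex_hessian (\<lambda>p. ln (bergman_kernel D p p))"

definition rho_root :: "nat \<Rightarrow> C2 \<Rightarrow> real" where
  "rho_root m p = (1 - cmod (fst p) ^ 2) powr (1 / real m) - cmod (snd p) ^ 2"

definition rho_root_metric :: "nat \<Rightarrow> C2 \<Rightarrow> complex^2^2" where
  "rho_root_metric m p = - complex_hessian (\<lambda>q. of_real (ln (rho_root m q))) p"

end

theory Submission
  imports Defs "HOL-Complex_Analysis.Complex_Analysis"
begin

text \<open>
  The domain and its boundary measure are invariant under the torus action, so the monomials are
  orthogonal in both function spaces. Their norms are beta integrals, and the two kernels sum in
  closed form: with \<open>x = |z|\<^sup>2\<close>, \<open>\<tau> = |w|\<^sup>2 (1 - x)\<^bsup>-1/m\<^esup>\<close> they are, on the diagonal, multiples of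
  \<open>(1 - x)\<^bsup>-e\<^esup> (1 - \<gamma> \<tau>) / (1 - \<tau>)\<^sup>n\<close>, where \<open>n = 2\<close>, \<open>\<gamma> = (m - 1) / (m + 2)\<close> in the
  Fefferman--Szego case and \<open>n = 3\<close>, \<open>\<gamma> = (m - 1) / (m + 1)\<close> in the Bergman case; \<open>- log \<rho>\<^sub>m\<close> is the
  logarithm of such an expression with \<open>n = 1\<close>, \<open>\<gamma> = 0\<close>. For \<open>m = 1\<close> all three metrics are multiples
  of that of the ball. For \<open>m > 1\<close> it suffices to look at the slice \<open>z = 0\<close>, where the metrics are
  diagonal with entries rational in \<open>|w|\<^sup>2\<close>.
\<close>

section \<open>Integration over the complex plane\<close>

text \<open>The obstacle lies on the Hardy side: its elements are controlled only through
  \<open>nt_maximal\<close> and have boundary values merely almost everywhere. Hence moments are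
  computed for the dilations \<open>f (r *\<^sub>R p)\<close>, which are continuous on the boundary,
  and \<open>r\<close> tends to 1 under the integral: radial segments end inside the approach
  regions, uniformly in the boundary point, so \<open>nt_maximal\<close> is an integrable majorant.
  Both kernels are fixed only by a choice operator; letting two kernels reproduce each other
  determines the diagonal, which is all that the metrics see. The parameters come from the moments.
  In the chart by \<open>w\<close> and the angle of \<open>z\<close>, the Gram density cancels the
  denominator of the Fefferman weight and leaves
  \<open>m powr (2/3) * (cmod w ^ 2) powr ((m - 1) / 3)\<close>; the cube root shifts the beta
  parameter from \<open>(k + 1) / m\<close> to \<open>(k + (m + 2) / 3) / m\<close>. Reciprocal
  moments are a polynomial in \<open>k\<close> times
  \<open>pochhammer (e + k / m) j / fact j\<close>, and that polynomial decides \<open>n\<close> and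
  \<open>\<gamma>\<close>. For \<open>m > 1\<close> the factor \<open>1 - \<gamma> * \<tau>\<close>
  with \<open>\<gamma> > 0\<close> is what rules out each proportionality.\<close>

text \<open>\<open>lborel\<close> on \<open>complex\<close> is built from \<open>Basis\<close>, not
  as a product; agreement on boxes identifies it with the image of planar Lebesgue measure, which
  opens the way to Tonelli in real and imaginary part.\<close>

lemma lborel_complex_eq_distr: "(lborel :: complex measure) = distr lborel borel (\<lambda>(x, y). Complex x y)"
proof (rule lborel_eqI)
  have [measurable]: "(\<lambda>(x, y). Complex x y) \<in> borel_measurable (borel :: (real \<times> real) measure)"
    by (intro borel_measurable_continuous_onI) (auto simp: case_prod_unfold intro!: continuous_intros)
  fix l u :: complex
  assume lu: "\<And>b. b \<in> Basis \<Longrightarrow> l \<bullet> b \<le> u \<bullet> b"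
  have le: "Re l \<le> Re u" "Im l \<le> Im u"
    using lu[of 1] lu[of \<i>] by (auto simp: Basis_complex_def inner_complex_def)
  have "(\<lambda>(x, y). Complex x y) -` box l u = box (Re l, Im l) (Re u, Im u)"
    by (auto simp: box_def Basis_complex_def inner_complex_def Basis_prod_def)
  then show "emeasure (distr lborel borel (\<lambda>(x, y). Complex x y)) (box l u) = (\<Prod>b\<in>Basis. (u - l) \<bullet> b)"
    using le by (subst emeasure_distr)
      (auto simp: emeasure_lborel_box_eq Basis_prod_def Basis_complex_def inner_complex_def
        prod.union_disjoint image_image)
qed simp

lemma nn_integral_lborel_complex:
  assumes [measurable]: "f \<in> borel_measurable borel"
  shows "(\<integral>\<^sup>+w. f w \<partial>lborel) = (\<integral>\<^sup>+y. \<integral>\<^sup>+x. f (Complex x y) \<partial>lborel \<partial>lborel)"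
    and "(\<integral>\<^sup>+w. f w \<partial>lborel) = (\<integral>\<^sup>+x. \<integral>\<^sup>+y. f (Complex x y) \<partial>lborel \<partial>lborel)"
proof -
  have [measurable]: "(\<lambda>(x, y). Complex x y) \<in> borel_measurable (borel :: (real \<times> real) measure)"
    by (intro borel_measurable_continuous_onI) (auto simp: case_prod_unfold intro!: continuous_intros)
  have cp: "(\<lambda>p. Complex (fst p) (snd p)) \<in> borel_measurable borel"
    by (auto intro!: borel_measurable_continuous_onI continuous_intros)
  from measurable_compose[OF cp assms]
  have m: "(\<lambda>p. f (Complex (fst p) (snd p))) \<in> borel_measurable borel" .
  then have [measurable]: "(\<lambda>p. f (Complex (fst p) (snd p))) \<in> borel_measurable (lborel \<Otimes>\<^sub>M lborel)"
    unfolding lborel_prod by simp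
  have "(\<integral>\<^sup>+w. f w \<partial>lborel) = (\<integral>\<^sup>+p. f (Complex (fst p) (snd p)) \<partial>(lborel \<Otimes>\<^sub>M lborel))"
    by (subst lborel_complex_eq_distr, subst nn_integral_distr) (auto simp: case_prod_unfold lborel_prod cp)
  then show "(\<integral>\<^sup>+w. f w \<partial>lborel) = (\<integral>\<^sup>+y. \<integral>\<^sup>+x. f (Complex x y) \<partial>lborel \<partial>lborel)"
    "(\<integral>\<^sup>+w. f w \<partial>lborel) = (\<integral>\<^sup>+x. \<integral>\<^sup>+y. f (Complex x y) \<partial>lborel \<partial>lborel)"
    using lborel_pair.nn_integral_snd[where f="\<lambda>p. f (Complex (fst p) (snd p))"]
      lborel.nn_integral_fst[where f="\<lambda>p. f (Complex (fst p) (snd p))"]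
    by (simp_all add: case_prod_unfold)
qed

text \<open>Each shear translates one real coordinate by an amount depending on the other, so the
  inner integral in the fitting Tonelli order is unchanged by it.\<close>

lemma nn_integral_lborel_shear:
  fixes a :: real
  assumes [measurable]: "f \<in> borel_measurable borel"
  shows "(\<integral>\<^sup>+w. f (w + of_real (a * Im w)) \<partial>lborel) = (\<integral>\<^sup>+w. f w \<partial>lborel)"
    and "(\<integral>\<^sup>+w. f (w + \<i> * of_real (a * Re w)) \<partial>lborel) = (\<integral>\<^sup>+w. f w \<partial>lborel)"
proof -
  have [measurable]: "(\<lambda>w::complex. w + of_real (a * Im w)) \<in> borel_measurable borel"
    "(\<lambda>w::complex. w + \<i> * of_real (a * Re w)) \<in> borel_measurable borel"
    by (auto intro!: borel_measurable_continuous_onI continuous_intros)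
  have c: "(\<lambda>x. Complex x y) \<in> borel_measurable borel" "(\<lambda>y. Complex x y) \<in> borel_measurable borel" for x y
    by (intro borel_measurable_continuous_onI continuous_intros)+
  note m = measurable_compose[OF c(1) assms] measurable_compose[OF c(2) assms]
  have "(\<integral>\<^sup>+w. f (w + of_real (a * Im w)) \<partial>lborel) = (\<integral>\<^sup>+y. \<integral>\<^sup>+x. f (Complex (a * y + 1 * x) y) \<partial>lborel \<partial>lborel)"
    by (subst nn_integral_lborel_complex(1))
       (measurable, auto intro!: nn_integral_cong arg_cong[where f=f] simp: complex_eq_iff)
  also have "\<dots> = (\<integral>\<^sup>+y. \<integral>\<^sup>+x. f (Complex x y) \<partial>lborel \<partial>lborel)"
    by (rule nn_integral_cong) (use nn_integral_real_affine[OF m(1), of 1] in simp)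
  finally show "(\<integral>\<^sup>+w. f (w + of_real (a * Im w)) \<partial>lborel) = (\<integral>\<^sup>+w. f w \<partial>lborel)"
    by (simp add: nn_integral_lborel_complex(1))
  have "(\<integral>\<^sup>+w. f (w + \<i> * of_real (a * Re w)) \<partial>lborel) = (\<integral>\<^sup>+x. \<integral>\<^sup>+y. f (Complex x (a * x + 1 * y)) \<partial>lborel \<partial>lborel)"
    by (subst nn_integral_lborel_complex(2))
       (measurable, auto intro!: nn_integral_cong arg_cong[where f=f] simp: complex_eq_iff)
  also have "\<dots> = (\<integral>\<^sup>+x. \<integral>\<^sup>+y. f (Complex x y) \<partial>lborel \<partial>lborel)"
    by (rule nn_integral_cong) (use nn_integral_real_affine[OF m(2), of 1] in simp)
  finally show "(\<integral>\<^sup>+w. f (w + \<i> * of_real (a * Re w)) \<partial>lborel) = (\<integral>\<^sup>+w. f w \<partial>lborel)"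
    by (simp add: nn_integral_lborel_complex(2))
qed

lemma nn_integral_lborel_rotate:
  assumes f [measurable]: "f \<in> borel_measurable borel" and c: "cmod c = 1"
  shows "(\<integral>\<^sup>+w. f (c * w) \<partial>lborel) = (\<integral>\<^sup>+w. f w \<partial>lborel)"
proof -
  have *: "(\<integral>\<^sup>+w. f (c * w) \<partial>lborel) = (\<integral>\<^sup>+w. f w \<partial>lborel)"
    if c: "cmod c = 1" "Im c \<noteq> 0" and f [measurable]: "f \<in> borel_measurable borel" for c f
  proof -
    \<comment> \<open>A rotation by an angle outside \<open>\<pi>\<int>\<close> is a product of three shears.\<close>
    define b where "b = Im c"
    \<comment> \<open>For \<open>c = cis \<theta>\<close> these are \<open>b = sin \<theta>\<close>
      and \<open>a = - tan (\<theta> / 2)\<close>.\<close>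
    define a where "a = (Re c - 1) / Im c"
    define S T where "S = (\<lambda>w. w + of_real (a * Im w))" and "T = (\<lambda>w. w + \<i> * of_real (b * Re w))"
    have [measurable]: "S \<in> borel_measurable borel" "T \<in> borel_measurable borel"
      unfolding S_def T_def by (auto intro!: borel_measurable_continuous_onI continuous_intros)
    have "Re c ^ 2 + Im c ^ 2 = 1" using c by (simp add: cmod_def)
    then have r: "(Re c - 1) * (Re c + 1) = - (Im c * Im c)"
      by (simp add: algebra_simps power2_eq_square)
    have ab: "1 + a * b = Re c" using c by (simp add: a_def b_def)
    have "a * (1 + Re c) = - Im c" using c r by (simp add: a_def field_simps)
    then have "S (T (S w)) = c * w" for w
      using ab by (simp add: S_def T_def complex_eq_iff b_def) algebra
    then have "(\<integral>\<^sup>+w. f (c * w) \<partial>lborel) = (\<integral>\<^sup>+w. (f \<circ> S \<circ> T) (S w) \<partial>lborel)" by simp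
    also have "\<dots> = (\<integral>\<^sup>+w. (f \<circ> S \<circ> T) w \<partial>lborel)"
      unfolding S_def by (rule nn_integral_lborel_shear) (simp add: S_def[symmetric])
    also have "\<dots> = (\<integral>\<^sup>+w. (f \<circ> S) (T w) \<partial>lborel)" by simp
    also have "\<dots> = (\<integral>\<^sup>+w. (f \<circ> S) w \<partial>lborel)"
      unfolding T_def by (rule nn_integral_lborel_shear) simp
    also have "\<dots> = (\<integral>\<^sup>+w. f (S w) \<partial>lborel)" by simp
    also have "\<dots> = (\<integral>\<^sup>+w. f w \<partial>lborel)" unfolding S_def by (rule nn_integral_lborel_shear) simp
    finally show ?thesis .
  qed
  show ?thesis
  proof (cases "Im c = 0")
    case False then show ?thesis using * c by simp
  next
    case True
    then have re: "Re c \<noteq> 0" using c by (auto simp: cmod_def)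
    \<comment> \<open>A real \<open>c\<close> is the product of \<open>\<i>\<close> and
      \<open>- \<i> * c\<close>, both of which have nonzero imaginary part.\<close>
    have [measurable]: "(\<lambda>w. f (\<i> * w)) \<in> borel_measurable borel" by simp
    have "(\<integral>\<^sup>+w. f (c * w) \<partial>lborel) = (\<integral>\<^sup>+w. (\<lambda>w. f (\<i> * w)) ((- \<i> * c) * w) \<partial>lborel)"
      by (simp add: mult.assoc[symmetric])
    also have "\<dots> = (\<integral>\<^sup>+w. f (\<i> * w) \<partial>lborel)"
      using re c by (intro *) (auto simp: norm_mult)
    also have "\<dots> = (\<integral>\<^sup>+w. f w \<partial>lborel)" by (intro *) auto
    finally show ?thesis .
  qed
qed

lemma distr_lborel_rotate:
  assumes "cmod c = 1"
  shows "distr lborel lborel ((*) c) = (lborel :: complex measure)"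
proof (rule measure_eqI)
  fix A :: "complex set" assume "A \<in> sets (distr lborel lborel ((*) c))"
  then have [measurable]: "A \<in> sets borel" by simp
  have "emeasure (distr lborel lborel ((*) c)) A = (\<integral>\<^sup>+w. indicator A (c * w) \<partial>lborel)"
    by (subst nn_integral_indicator[symmetric], simp, subst nn_integral_distr) auto
  also have "\<dots> = emeasure lborel A"
    using assms by (subst nn_integral_lborel_rotate) auto
  finally show "emeasure (distr lborel lborel ((*) c)) A = emeasure lborel A" .
qed simp

text \<open>The disc area \<open>pi * r^2\<close> is linear in \<open>r^2\<close>: the image of
  Lebesgue measure on the disc under the squared modulus is \<open>pi\<close> times Lebesgue measure
  on \<open>{0..R^2}\<close>. Half-lines determine a finite measure, so the two sides are compared
  on \<open>{x<..}\<close> only. This takes the place of polar coordinates.\<close>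

lemma nn_integral_radial:
  assumes [measurable]: "h \<in> borel_measurable borel" and R: "R > 0"
  shows "(\<integral>\<^sup>+w. h (cmod w ^ 2) * indicator (ball 0 R) w \<partial>lborel)
       = ennreal pi * (\<integral>\<^sup>+t. h t * indicator {0..R^2} t \<partial>lborel)"
proof -
  define M where "M = distr (density lborel (indicator (ball (0::complex) R))) borel (\<lambda>w. cmod w ^ 2)"
  define N where "N = density lborel (\<lambda>t::real. ennreal pi * indicator {0..R^2} t)"
  have [measurable]: "(indicator (ball (0::complex) R) :: complex \<Rightarrow> ennreal) \<in> borel_measurable borel"
    by (intro borel_measurable_indicator) simp
  have em: "emeasure M A = emeasure lborel {w \<in> ball 0 R. cmod w ^ 2 \<in> A}" if [measurable]: "A \<in> sets borel" for A
  proof -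
    have [measurable]: "(\<lambda>w::complex. cmod w ^ 2) -` A \<in> sets borel"
      by (rule measurable_sets_borel[of _ borel]) simp_all
    have "emeasure M A = (\<integral>\<^sup>+w. indicator (ball 0 R) w * indicator ((\<lambda>w. cmod w ^ 2) -` A) w \<partial>lborel)"
      unfolding M_def by (subst emeasure_distr, simp, simp, subst emeasure_density) auto
    also have "\<dots> = (\<integral>\<^sup>+w. indicator {w \<in> ball 0 R. cmod w ^ 2 \<in> A} w \<partial>lborel)"
      by (intro nn_integral_cong) (auto simp: indicator_def)
    also have "\<dots> = emeasure lborel {w \<in> ball 0 R. cmod w ^ 2 \<in> A}"
      by (rule nn_integral_indicator) measurable
    finally show ?thesis .
  qed
  have en: "emeasure N A = ennreal pi * emeasure lborel ({0..R^2} \<inter> A)" if [measurable]: "A \<in> sets borel" for A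
  proof -
    have "emeasure N A = (\<integral>\<^sup>+t. ennreal pi * indicator ({0..R^2} \<inter> A) t \<partial>lborel)"
      unfolding N_def by (subst emeasure_density) (auto simp: indicator_def intro!: nn_integral_cong)
    also have "\<dots> = ennreal pi * emeasure lborel ({0..R^2} \<inter> A)"
      by (rule nn_integral_cmult_indicator) simp
    finally show ?thesis .
  qed
  have bl: "emeasure lborel (ball (0::complex) r) = ennreal (pi * r ^ 2)" if "r \<ge> 0" for r
    using that by (simp add: emeasure_ball unit_ball_vol_2)
  have cbl: "emeasure lborel (cball (0::complex) r) = ennreal (pi * r ^ 2)" if "r \<ge> 0" for r
    using that by (simp add: emeasure_cball unit_ball_vol_2)
  have eq: "emeasure M {x<..} = emeasure N {x<..}" for x
  proof -
    consider "x < 0" | "0 \<le> x" "x < R^2" | "x \<ge> R^2" by linarith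
    then show ?thesis
    proof cases
      case 1
      then have "x < cmod w ^ 2" for w :: complex by (rule less_le_trans) simp
      then have "{w \<in> ball (0::complex) R. cmod w ^ 2 \<in> {x<..}} = ball 0 R" "{0..R^2} \<inter> {x<..} = {0..R^2}"
        using 1 by auto
      then show ?thesis using R by (simp add: em en bl ennreal_mult)
    next
      case 2
      have s: "sqrt x < R" using 2 R by (simp add: real_less_lsqrt)
      have "{w \<in> ball (0::complex) R. cmod w ^ 2 \<in> {x<..}} = ball 0 R - cball 0 (sqrt x)"
      proof -
        have "x < cmod w ^ 2 \<longleftrightarrow> sqrt x < cmod w" for w :: complex
          using real_sqrt_less_iff[of x "cmod w ^ 2"] by (simp only: real_sqrt_abs abs_norm_cancel)
        then show ?thesis by (intro set_eqI) (simp only: mem_Collect_eq Diff_iff mem_ball mem_cball greaterThan_iff dist_0_norm not_le)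
      qed
      moreover have "{0..R^2} \<inter> {x<..} = {x<..R^2}" using 2 by auto
      moreover have "emeasure lborel (ball (0::complex) R - cball 0 (sqrt x))
          = emeasure lborel (ball (0::complex) R) - emeasure lborel (cball (0::complex) (sqrt x))"
        using s 2 by (intro emeasure_Diff) (auto simp: cbl)
      moreover have "\<dots> = ennreal (pi * (R^2 - x))"
        using 2 R by (simp add: bl cbl ennreal_minus right_diff_distrib)
      moreover have "\<dots> = ennreal pi * ennreal (R^2 - x)" using 2 by (intro ennreal_mult) auto
      ultimately show ?thesis using 2 by (simp add: em en)
    next
      case 3
      have "cmod w ^ 2 < R ^ 2" if "cmod w < R" for w using that by (intro power_strict_mono) auto
      then have e: "{w \<in> ball (0::complex) R. cmod w ^ 2 \<in> {x<..}} = {}" "{0..R^2} \<inter> {x<..} = {}"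
        using 3 by force+
      show ?thesis by (subst em, simp, subst en, simp) (simp only: e emeasure_empty mult_zero_right)
    qed
  qed
  have "M = N"
  proof (rule measure_eqI_lessThan)
    fix x
    have "emeasure M {x<..} \<le> emeasure lborel (ball (0::complex) R)" by (simp add: em) (rule emeasure_mono, auto)
    then show "emeasure M {x<..} < \<infinity>" using R by (simp add: bl le_less_trans)
  qed (auto simp: M_def N_def eq[unfolded M_def N_def])
  have "(\<integral>\<^sup>+w. h (cmod w ^ 2) * indicator (ball 0 R) w \<partial>lborel) = (\<integral>\<^sup>+t. h t \<partial>M)"
    unfolding M_def by (subst nn_integral_distr, simp, simp, subst nn_integral_density) (auto simp: mult.commute)
  also have "\<dots> = (\<integral>\<^sup>+t. ennreal pi * (h t * indicator {0..R^2} t) \<partial>lborel)"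
    unfolding \<open>M = N\<close> N_def by (subst nn_integral_density) (auto simp: indicator_def intro!: nn_integral_cong)
  also have "\<dots> = ennreal pi * (\<integral>\<^sup>+t. h t * indicator {0..R^2} t \<partial>lborel)"
    by (rule nn_integral_cmult) simp
  finally show ?thesis .
qed

section \<open>Beta integrals\<close>

text \<open>The substitution \<open>s = t ^ m\<close> would turn this into
  \<open>B(c, j + 1) / m\<close>. The proof integrates by parts instead: induction on
  \<open>j\<close>, with \<open>c\<close> arbitrary because the step lowers \<open>j\<close> at the
  price of passing to \<open>c + 1\<close>.\<close>

lemma has_integral_beta_power:
  fixes c :: real
  assumes "m \<ge> 1" "c > 0"
  shows "((\<lambda>t. (1 - t ^ m) ^ j * t powr (m * c - 1)) has_integral
            fact j / (m * pochhammer c (Suc j))) {0..1}"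
  using assms(2)
proof (induction j arbitrary: c)
  case 0
  have "((\<lambda>t. t powr (m * c - 1)) has_integral 1 powr (m * c - 1 + 1) / (m * c - 1 + 1)) {0..1}"
    using 0 assms(1) by (intro has_integral_powr_from_0) auto
  then show ?case by simp
next
  case (Suc j)
  \<comment> \<open>The derivative of \<open>?F\<close> combines the integrand for
    \<open>Suc j\<close> and \<open>c\<close> with the known one for \<open>j\<close> and
    \<open>c + 1\<close>, and \<open>?F\<close> vanishes at both ends.\<close>
  let ?F = "\<lambda>t::real. (1 - t ^ m) ^ Suc j * t powr (m * c)"
  let ?f = "\<lambda>t::real. m * c * ((1 - t ^ m) ^ Suc j * t powr (m * c - 1)) 
      - m * Suc j * ((1 - t ^ m) ^ j * t powr (m * (c + 1) - 1))"
  have mc: "m * c > 0" using Suc.prems assms(1) by simp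
  have "(?f has_integral ?F 1 - ?F 0) {0..1}"
  proof (rule fundamental_theorem_of_calculus_interior)
    show "continuous_on {0..1} ?F"
      using mc by (intro continuous_intros continuous_on_powr') auto
    fix t :: real assume t: "t \<in> {0<..<1}"
    have p: "t ^ (m - 1) * t powr (m * c) = t powr (m * (c + 1) - 1)" 
      using t assms(1) by (simp add: powr_realpow[symmetric] powr_add[symmetric] algebra_simps of_nat_diff)
    have "(?F has_real_derivative 
       (Suc j * (1 - t ^ m) ^ j * (- (m * t ^ (m - 1)))) * t powr (m * c)
       + (1 - t ^ m) ^ Suc j * (m * c * t powr (m * c - 1))) (at t)"
      using t by (intro DERIV_cong[OF DERIV_mult[OF DERIV_power_Suc[of "\<lambda>t. 1 - t ^ m"]]])
        (auto intro!: derivative_eq_intros simp: algebra_simps)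
    also have "(Suc j * (1 - t ^ m) ^ j * (- (m * t ^ (m - 1)))) * t powr (m * c)
       + (1 - t ^ m) ^ Suc j * (m * c * t powr (m * c - 1)) = ?f t"
      unfolding p[symmetric] by (simp add: algebra_simps)
    finally show "(?F has_vector_derivative ?f t) (at t)"
      by (simp add: has_real_derivative_iff_has_vector_derivative)
  qed simp
  moreover have "?F 1 - ?F 0 = 0" using assms(1) by simp
  moreover have "((\<lambda>t. m * Suc j * ((1 - t ^ m) ^ j * t powr (m * (c + 1) - 1))) has_integral
       m * Suc j * (fact j / (m * pochhammer (c + 1) (Suc j)))) {0..1}"
    using Suc.IH[of "c + 1"] Suc.prems by (intro has_integral_mult_right) auto
  ultimately have "((\<lambda>t. ?f t + m * Suc j * ((1 - t ^ m) ^ j * t powr (m * (c + 1) - 1))) has_integral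
     0 + m * Suc j * (fact j / (m * pochhammer (c + 1) (Suc j)))) {0..1}"
    by (intro has_integral_add) auto
  then have "((\<lambda>t. m * c * ((1 - t ^ m) ^ Suc j * t powr (m * c - 1))) has_integral
     m * Suc j * (fact j / (m * pochhammer (c + 1) (Suc j)))) {0..1}"
    by simp
  from has_integral_mult_right[OF this, of "1 / (m * c)"]
  have "((\<lambda>t. 1 / (m * c) * (m * c * ((1 - t ^ m) ^ Suc j * t powr (m * c - 1)))) has_integral
     1 / (m * c) * (m * Suc j * (fact j / (m * pochhammer (c + 1) (Suc j))))) {0..1}" .
  moreover have "(\<lambda>t. 1 / (m * c) * (m * c * ((1 - t ^ m) ^ Suc j * t powr (m * c - 1))))
      = (\<lambda>t. (1 - t ^ m) ^ Suc j * t powr (m * c - 1))"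
    using mc by (auto simp: fun_eq_iff simp del: power_Suc)
  moreover have "1 / (m * c) * (m * Suc j * (fact j / (m * pochhammer (c + 1) (Suc j))))
      = fact (Suc j) / (m * pochhammer c (Suc (Suc j)))"
    using mc assms(1) by (simp add: pochhammer_rec[of c "Suc j"] divide_simps del: pochhammer_Suc) (simp add: algebra_simps)
  ultimately show ?case by simp
qed

lemma nn_integral_beta_power:
  fixes c :: real
  assumes "m \<ge> 1" "c > 0"
  shows "(\<integral>\<^sup>+t. ennreal ((1 - t ^ m) ^ j * t powr (m * c - 1)) * indicator {0..1} t \<partial>lborel)
           = ennreal (fact j / (m * pochhammer c (Suc j)))"
proof -
  have "((\<lambda>t. indicator {0..1} t * ((1 - t ^ m) ^ j * t powr (m * c - 1))) has_integral
            fact j / (m * pochhammer c (Suc j))) UNIV"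
    using has_integral_beta_power[OF assms, of j] has_integral_restrict_UNIV[of "{0..1::real}" "\<lambda>t. (1 - t ^ m) ^ j * t powr (m * c - 1)"]
    by (subst has_integral_cong[where g="\<lambda>t. if t \<in> {0..1} then (1 - t ^ m) ^ j * t powr (m * c - 1) else 0"]) auto
  then have "(\<integral>\<^sup>+t. ennreal (indicator {0..1} t * ((1 - t ^ m) ^ j * t powr (m * c - 1))) \<partial>lborel)
           = ennreal (fact j / (m * pochhammer c (Suc j)))"
    by (intro nn_integral_has_integral_lborel) (auto simp: indicator_def power_le_one)
  then show ?thesis
    by (simp add: ennreal_mult' mult.commute ennreal_indicator)
qed

section \<open>Averaging along measure-preserving maps\<close>

text \<open>If every \<open>T s\<close> preserves \<open>M\<close>, averaging \<open>F\<close> along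
  the family multiplies its integral by the mass of \<open>Q\<close>. Fubini applies because the
  integral of \<open>norm (F (T s x))\<close> over \<open>x\<close> does not depend on
  \<open>s\<close>. With rotations for \<open>T\<close>, the inner integral becomes a Fourier
  coefficient.\<close>

lemma rotation_average:
  fixes F :: "'a \<Rightarrow> complex"
  assumes M: "sigma_finite_measure M" and Q: "finite_measure Q"
    and T: "(\<lambda>(s, x). T s x) \<in> measurable (Q \<Otimes>\<^sub>M M) M"
    and inv: "\<And>s. s \<in> space Q \<Longrightarrow> distr M M (T s) = M"
    and F: "integrable M F"
  shows "integrable M (\<lambda>x. LINT s|Q. F (T s x))"
    and "(LINT x|M. LINT s|Q. F (T s x)) = measure Q (space Q) *\<^sub>R (LINT x|M. F x)"
proof -
  interpret M: sigma_finite_measure M by fact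
  interpret Q: finite_measure Q by fact
  interpret P: pair_sigma_finite Q M ..
  note T [measurable]
  have [measurable]: "F \<in> borel_measurable M" using F by auto
  have Ts [measurable]: "T s \<in> measurable M M" if "s \<in> space Q" for s
    using measurable_Pair2[OF T that] by simp
  have FT: "(LINT x|M. G (T s x)) = (LINT x|M. G x)" if "s \<in> space Q" "G \<in> borel_measurable M"
    for s and G :: "'a \<Rightarrow> 'c::{banach,second_countable_topology}"
    using integral_distr[OF Ts[OF that(1)] that(2)] inv[OF that(1)] by simp
  have FN: "(LINT x|M. norm (F (T s x))) = (LINT x|M. norm (F x))" if "s \<in> space Q" for s
    using that by (rule FT) simp
  have FI: "integrable M (\<lambda>x. F (T s x))" if "s \<in> space Q" for s
    using integrable_distr[OF Ts[OF that], of F] inv[OF that] F by simp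
  have I: "integrable (Q \<Otimes>\<^sub>M M) (\<lambda>(s, x). F (T s x))"
  proof (rule P.Fubini_integrable)
    have "integrable Q (\<lambda>s. LINT x|M. norm (F x))" by simp
    then show "integrable Q (\<lambda>s. LINT x|M. norm (case (s, x) of (s, x) \<Rightarrow> F (T s x)))"
      by (rule Bochner_Integration.integrable_cong[THEN iffD1, rotated 2])
         (auto simp: FN)
  qed (auto simp: FI)
  show "integrable M (\<lambda>x. LINT s|Q. F (T s x))"
    using P.integrable_snd[OF I] by simp
  have "(LINT x|M. LINT s|Q. F (T s x)) = (LINT s|Q. LINT x|M. F (T s x))"
    using P.Fubini_integral[OF I] by simp
  also have "\<dots> = (LINT s|Q. LINT x|M. F x)"
    by (rule Bochner_Integration.integral_cong) (auto simp: FT)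
  also have "\<dots> = measure Q (space Q) *\<^sub>R (LINT x|M. F x)" by simp
  finally show "(LINT x|M. LINT s|Q. F (T s x)) = measure Q (space Q) *\<^sub>R (LINT x|M. F x)" .
qed

section \<open>Taylor expansion on a Reinhardt domain\<close>

text \<open>Angles as a finite measure of total mass \<open>2 * pi\<close>: Fubini, dominated
  convergence and \<open>rotation_average\<close> then apply to angular integrals.\<close>

definition circle_measure :: "real measure" where
  "circle_measure = restrict_space lborel {0..2 * pi}"

lemma space_circle_measure [simp]: "space circle_measure = {0..2 * pi}"
  by (simp add: circle_measure_def)

lemma measurable_circle_measure [measurable]:
  "f \<in> borel_measurable borel \<Longrightarrow> f \<in> borel_measurable circle_measure"
  by (simp add: circle_measure_def measurable_restrict_space1)

lemma finite_measure_circle_measure: "finite_measure circle_measure"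
  by (rule finite_measureI) (simp add: circle_measure_def emeasure_restrict_space)

lemma measure_circle_measure [simp]: "measure circle_measure {0..2 * pi} = 2 * pi"
  by (simp add: circle_measure_def measure_restrict_space)

text \<open>Links the two integrals in use: contour integrals unfold to \<open>has_integral\<close>,
  whereas averaging works with Bochner integrals.\<close>

lemma has_integral_circle_measure:
  fixes g :: "real \<Rightarrow> complex"
  assumes "continuous_on UNIV g"
  shows "integrable circle_measure g"
    and "(g has_integral (LINT t|circle_measure. g t)) {0..2 * pi}"
proof -
  have c: "continuous_on {0..2*pi} g" using assms continuous_on_subset by blast
  have s: "set_integrable lborel {0..2 * pi} g"
    using borel_integrable_atLeastAtMost'[OF c] .
  then show "integrable circle_measure g"
    by (simp add: circle_measure_def integrable_restrict_space set_integrable_def)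
  have "(LINT t|circle_measure. g t) = (LBINT t:{0..2*pi}. g t)"
    by (simp add: circle_measure_def integral_restrict_space set_lebesgue_integral_def)
  also have "\<dots> = integral {0..2*pi} g"
    by (rule set_borel_integral_eq_integral(2)[OF s])
  finally show "(g has_integral (LINT t|circle_measure. g t)) {0..2 * pi}"
    using set_borel_integral_eq_integral(1)[OF s] by (simp add: has_integral_iff)
qed

lemma circle_measure_eqI:
  fixes g :: "real \<Rightarrow> complex"
  assumes "continuous_on UNIV g" "(g has_integral I) {0..2 * pi}"
  shows "(LINT t|circle_measure. g t) = I"
  using has_integral_circle_measure(2)[OF assms(1)] assms(2) has_integral_unique by blast

section \<open>Cauchy's formulas as angular integrals\<close>

text \<open>Cauchy's formula for the \<open>j\<close>-th derivative on the unit circle, applied to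
  \<open>u \<mapsto> f (z * u)\<close> rather than to \<open>f\<close> on the circle of radius
  \<open>cmod z\<close>; the factor \<open>z ^ j\<close> comes from the chain rule, and
  \<open>z = 0\<close> is covered.\<close>

lemma integral_circle_coeff:
  fixes z :: complex
  assumes f: "f holomorphic_on ball 0 \<rho>" and z: "cmod z < \<rho>"
  shows "(LINT t|circle_measure. f (cis t * z) * cis (- (real j * t)))
           = 2 * pi * z ^ j * ((deriv ^^ j) f 0 / fact j)"
proof -
  define S where "S = {u. z * u \<in> ball 0 \<rho>}"
  have "open ((\<lambda>u. z * u) -` ball 0 \<rho>)"
    by (intro open_vimage open_ball continuous_intros)
  then have S: "open S" by (simp add: S_def vimage_def)
  have cS: "cball 0 1 \<subseteq> S"
  proof
    fix u :: complex assume "u \<in> cball 0 1"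
    then have "cmod z * cmod u \<le> cmod z * 1" by (intro mult_left_mono) auto
    then show "u \<in> S" using z by (simp add: S_def norm_mult)
  qed
  have \<rho>: "\<rho> > 0" using z by (meson le_less_trans norm_ge_zero)
  let ?g = "\<lambda>u. f (z * u)"
  have g: "?g holomorphic_on S"
    by (rule holomorphic_on_compose_gen[OF _ f, unfolded o_def]) (auto simp: S_def intro: holomorphic_intros)
  have h: "(deriv ^^ j) ?g 0 = z ^ j * (deriv ^^ j) f 0"
    using higher_deriv_compose_linear[OF f S open_ball, of 0 z j] \<rho> by (simp add: S_def)
  have "((\<lambda>u. ?g u / (u - 0) ^ Suc j) has_contour_integral ((2 * pi * \<i>) / fact j * (deriv ^^ j) ?g 0))
           (circlepath 0 1)"
    using cS by (intro Cauchy_has_contour_integral_higher_derivative_circlepath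
        holomorphic_on_imp_continuous_on holomorphic_on_subset[OF g]) auto
  then have "((\<lambda>t. ?g (cis t) / cis t ^ Suc j * 1 * \<i> * cis t) has_integral
        ((2 * pi * \<i>) / fact j * (deriv ^^ j) ?g 0)) {0..2 * pi}"
    unfolding circlepath_def
    by (subst (asm) has_contour_integral_part_circlepath_iff) auto
  from has_integral_mult_right[OF this, of "- \<i>"]
  have "((\<lambda>t. - \<i> * (?g (cis t) / cis t ^ Suc j * 1 * \<i> * cis t)) has_integral
        2 * pi * z ^ j * ((deriv ^^ j) f 0 / fact j)) {0..2 * pi}"
    unfolding h by (simp add: mult_ac)
  moreover have "(\<lambda>t. - \<i> * (?g (cis t) / cis t ^ Suc j * 1 * \<i> * cis t))
      = (\<lambda>t. f (cis t * z) * cis (- (real j * t)))"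
  proof
    fix t
    have "cis t ^ j * cis (- (real j * t)) = 1" 
      by (metis Complex.DeMoivre cis_mult cis_zero add.right_inverse)
    then have "cis (- (real j * t)) = 1 / cis t ^ j" by (simp add: field_simps)
    then show "- \<i> * (?g (cis t) / cis t ^ Suc j * 1 * \<i> * cis t) = f (cis t * z) * cis (- (real j * t))"
      by (simp add: mult_ac)
  qed
  ultimately have I: "((\<lambda>t. f (cis t * z) * cis (- (real j * t))) has_integral
        2 * pi * z ^ j * ((deriv ^^ j) f 0 / fact j)) {0..2 * pi}" by simp
  have "continuous_on UNIV (\<lambda>t. f (cis t * z) * cis (- (real j * t)))"
    using z by (intro continuous_intros continuous_on_compose2[OF holomorphic_on_imp_continuous_on[OF f]])
      (auto simp: norm_mult)
  then show ?thesis using I by (rule circle_measure_eqI)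
qed

text \<open>Cauchy's formula with its kernel in the form \<open>1 / (1 - z / (r * cis t))\<close>,
  which expands into a geometric series whose ratio has the constant modulus
  \<open>cmod z / r < 1\<close>.\<close>

lemma integral_circle_cauchy:
  fixes f :: "complex \<Rightarrow> complex"
  assumes f: "f holomorphic_on ball 0 \<rho>" and r: "cmod z < r" "r < \<rho>"
  shows "(LINT t|circle_measure. f (r * cis t) / (1 - z / (r * cis t))) = 2 * pi * f z"
proof -
  have r0: "r > 0" using r by (meson le_less_trans norm_ge_zero)
  have "((\<lambda>u. f u / (u - z)) has_contour_integral (2 * pi * \<i> * f z)) (circlepath 0 r)"
  proof -
    have "cball 0 r \<subseteq> ball 0 \<rho>" using r by auto
    from Cauchy_integral_circlepath_simple[OF holomorphic_on_subset[OF f this]] r show ?thesis by simp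
  qed
  then have "((\<lambda>t. f (0 + r * cis t) / (0 + r * cis t - z) * r * \<i> * cis t) has_integral (2 * pi * \<i> * f z)) {0..2 * pi}"
    unfolding circlepath_def
    by (subst (asm) has_contour_integral_part_circlepath_iff) auto
  from has_integral_mult_right[OF this, of "- \<i>"]
  have "((\<lambda>t. - \<i> * (f (0 + r * cis t) / (0 + r * cis t - z) * r * \<i> * cis t)) has_integral
        2 * pi * f z) {0..2 * pi}"
    by (simp add: mult_ac)
  moreover have nz: "r * cis t \<noteq> z" for t using r r0 by (auto simp: norm_mult)
  moreover have "(\<lambda>t. - \<i> * (f (0 + r * cis t) / (0 + r * cis t - z) * r * \<i> * cis t))
      = (\<lambda>t. f (r * cis t) / (1 - z / (r * cis t)))"
    using nz r0 by (simp add: fun_eq_iff field_simps)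
  ultimately have I: "((\<lambda>t. f (r * cis t) / (1 - z / (r * cis t))) has_integral 2 * pi * f z) {0..2 * pi}" by simp
  have "continuous_on UNIV (\<lambda>t. f (r * cis t) / (1 - z / (r * cis t)))"
    using r r0 nz by (intro continuous_intros continuous_on_compose2[OF holomorphic_on_imp_continuous_on[OF f]])
      (auto simp: norm_mult field_simps)
  then show ?thesis using I by (rule circle_measure_eqI)
qed

section \<open>The egg as a complete Reinhardt domain\<close>

lemma egg_slice_fst:
  assumes "cmod w < 1" "m \<ge> 1"
  shows "\<exists>\<rho>>0. \<forall>z. (z, w) \<in> egg m \<longleftrightarrow> cmod z < \<rho>"
proof (intro exI conjI allI)
  have "cmod w ^ (2 * m) < 1" using assms by (simp add: power_less_one_iff)
  then show "sqrt (1 - cmod w ^ (2 * m)) > 0" by simp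
  show "(z, w) \<in> egg m \<longleftrightarrow> cmod z < sqrt (1 - cmod w ^ (2 * m))" for z
  proof -
    have "cmod z < sqrt (1 - cmod w ^ (2 * m)) \<longleftrightarrow> sqrt (cmod z ^ 2) < sqrt (1 - cmod w ^ (2 * m))"
      by simp
    also have "\<dots> \<longleftrightarrow> (z, w) \<in> egg m" unfolding real_sqrt_less_iff by (auto simp: egg_def)
    finally show ?thesis by simp
  qed
qed

lemma egg_slice_snd:
  assumes "cmod z < 1" "m \<ge> 1"
  shows "\<exists>\<rho>>0. \<forall>w. (z, w) \<in> egg m \<longleftrightarrow> cmod w < \<rho>"
proof (intro exI conjI allI)
  have z: "1 - cmod z ^ 2 > 0" using assms by (simp add: power_less_one_iff)
  then show "root (2 * m) (1 - cmod z ^ 2) > 0" using assms by simp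
  show "(z, w) \<in> egg m \<longleftrightarrow> cmod w < root (2 * m) (1 - cmod z ^ 2)" for w
  proof -
    have "cmod w < root (2 * m) (1 - cmod z ^ 2) \<longleftrightarrow> root (2 * m) (cmod w ^ (2 * m)) < root (2 * m) (1 - cmod z ^ 2)"
      using assms by (simp add: real_root_power_cancel)
    also have "\<dots> \<longleftrightarrow> (z, w) \<in> egg m" using assms by (auto simp: egg_def)
    finally show ?thesis by simp
  qed
qed

text \<open>Completeness of the Reinhardt domain: with a point it contains the closed polydisc
  through it, hence every torus of integration.\<close>

lemma egg_mono:
  assumes "(z, w) \<in> egg m" "cmod z' \<le> cmod z" "cmod w' \<le> cmod w"
  shows "(z', w') \<in> egg m"
proof -
  have "cmod z' ^ 2 \<le> cmod z ^ 2" "cmod w' ^ (2 * m) \<le> cmod w ^ (2 * m)"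
    using assms by (auto intro: power_mono)
  moreover have "cmod z ^ 2 + cmod w ^ (2 * m) < 1" using assms(1) by (simp add: egg_def)
  ultimately have "cmod z' ^ 2 + cmod w' ^ (2 * m) < 1" by linarith
  then show ?thesis by (simp add: egg_def)
qed

lemma egg_cmod_less_1:
  assumes "(z, w) \<in> egg m" "m \<ge> 1"
  shows "cmod z < 1" "cmod w < 1"
proof -
  have "cmod z ^ 2 < 1" "cmod w ^ (2 * m) < 1"
    using assms(1) zero_le_power2[of "cmod z"] zero_le_power[OF norm_ge_zero, of w "2 * m"]
    unfolding egg_def mem_Collect_eq fst_conv snd_conv by linarith+
  then show "cmod z < 1" "cmod w < 1" using assms(2) by (auto simp: power_less_one_iff)
qed

lemma open_egg: "open (egg m)"
  unfolding egg_def by (intro open_Collect_less continuous_intros)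

lemma holomorphic2_on_imp_continuous_on: "holomorphic2_on f D \<Longrightarrow> continuous_on D f"
  unfolding holomorphic2_on_def
  by (intro continuous_at_imp_continuous_on ballI) (auto dest: has_derivative_continuous)

lemma holomorphic2_on_slice_fst:
  assumes "holomorphic2_on f D" "\<And>z. z \<in> S \<Longrightarrow> (z, w) \<in> D"
  shows "(\<lambda>z. f (z, w)) holomorphic_on S"
proof (rule holomorphic_onI)
  fix z assume "z \<in> S"
  then obtain a b where "(f has_derivative (\<lambda>h. a * fst h + b * snd h)) (at (z, w))"
    using assms unfolding holomorphic2_on_def by blast
  moreover have "((\<lambda>z. (z, w)) has_derivative (\<lambda>h. (h, 0))) (at z)"
    by (auto intro!: derivative_eq_intros)
  ultimately have "((\<lambda>z. f (z, w)) has_derivative (\<lambda>h. a * fst (h, 0::complex) + b * snd (h, 0::complex))) (at z)"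
    by (rule has_derivative_compose[rotated])
  then show "(\<lambda>z. f (z, w)) field_differentiable at z within S"
    unfolding field_differentiable_def
    by (auto intro!: exI[of _ a] simp: has_field_derivative_def intro: has_derivative_at_withinI)
qed

lemma holomorphic2_on_slice_snd:
  assumes "holomorphic2_on f D" "\<And>w. w \<in> S \<Longrightarrow> (z, w) \<in> D"
  shows "(\<lambda>w. f (z, w)) holomorphic_on S"
proof (rule holomorphic_onI)
  fix w assume "w \<in> S"
  then obtain a b where "(f has_derivative (\<lambda>h. a * fst h + b * snd h)) (at (z, w))"
    using assms unfolding holomorphic2_on_def by blast
  moreover have "((\<lambda>w. (z, w)) has_derivative (\<lambda>h. (0, h))) (at w)"
    by (auto intro!: derivative_eq_intros)
  ultimately have "((\<lambda>w. f (z, w)) has_derivative (\<lambda>h. a * fst (0::complex, h) + b * snd (0::complex, h))) (at w)"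
    by (rule has_derivative_compose[rotated])
  then show "(\<lambda>w. f (z, w)) field_differentiable at w within S"
    unfolding field_differentiable_def
    by (auto intro!: exI[of _ b] simp: has_field_derivative_def intro: has_derivative_at_withinI)
qed

section \<open>Torus integrals and Taylor coefficients in two variables\<close>

lemma integrable_torus:
  fixes h :: "real \<Rightarrow> real \<Rightarrow> complex"
  assumes "continuous_on UNIV (\<lambda>(t, s). h t s)" "\<And>t s. norm (h t s) \<le> B"
  shows "integrable (circle_measure \<Otimes>\<^sub>M circle_measure) (\<lambda>(t, s). h t s)"
    and "(LINT t|circle_measure. LINT s|circle_measure. h t s)
       = (LINT p|(circle_measure \<Otimes>\<^sub>M circle_measure). (case p of (t, s) \<Rightarrow> h t s))"
    and "(LINT t|circle_measure. LINT s|circle_measure. h t s)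
       = (LINT s|circle_measure. LINT t|circle_measure. h t s)"
proof -
  interpret C: finite_measure circle_measure by (rule finite_measure_circle_measure)
  interpret P: pair_sigma_finite circle_measure circle_measure ..
  interpret P: finite_measure "circle_measure \<Otimes>\<^sub>M circle_measure"
    by (rule finite_measure_pair_measure) (rule finite_measure_circle_measure)+
  have 1: "(\<lambda>(t, s). h t s) \<in> borel_measurable (borel \<Otimes>\<^sub>M borel)"
    unfolding borel_prod using assms(1) by (rule borel_measurable_continuous_onI)
  have "(\<lambda>t. t) \<in> circle_measure \<rightarrow>\<^sub>M borel" by (rule measurable_circle_measure) simp
  then have 2: "(\<lambda>p. (fst p, snd p)) \<in> circle_measure \<Otimes>\<^sub>M circle_measure \<rightarrow>\<^sub>M borel \<Otimes>\<^sub>M borel"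
    by (intro measurable_Pair) (auto intro: measurable_compose[OF measurable_fst] measurable_compose[OF measurable_snd])
  from measurable_compose[OF 2 1]
  have [measurable]: "(\<lambda>(t, s). h t s) \<in> borel_measurable (circle_measure \<Otimes>\<^sub>M circle_measure)"
    by (simp add: case_prod_unfold)
  show I: "integrable (circle_measure \<Otimes>\<^sub>M circle_measure) (\<lambda>(t, s). h t s)"
    by (rule P.integrable_const_bound[of _ B]) (auto simp: assms(2))
  show "(LINT t|circle_measure. LINT s|circle_measure. h t s)
       = (LINT p|(circle_measure \<Otimes>\<^sub>M circle_measure). (case p of (t, s) \<Rightarrow> h t s))"
    using P.integral_fst'[OF I] by simp
  show "(LINT t|circle_measure. LINT s|circle_measure. h t s)
       = (LINT s|circle_measure. LINT t|circle_measure. h t s)"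
    using P.Fubini_integral[OF I] by simp
qed

lemma torus_bound:
  assumes "continuous_on (egg m) f" "(z, w) \<in> egg m"
  shows "\<exists>B. \<forall>z' w'. cmod z' \<le> cmod z \<longrightarrow> cmod w' \<le> cmod w \<longrightarrow> cmod (f (z', w')) \<le> B"
proof -
  have "compact (f ` (cball 0 (cmod z) \<times> cball 0 (cmod w)))"
    using assms egg_mono[OF assms(2)]
    by (intro compact_continuous_image continuous_on_subset[OF assms(1)] compact_Times) auto
  then obtain B where "\<forall>x\<in>f ` (cball 0 (cmod z) \<times> cball 0 (cmod w)). norm x \<le> B"
    using compact_imp_bounded bounded_iff by blast
  then show ?thesis by (intro exI[of _ B]) auto
qed

definition slice_coeff :: "(C2 \<Rightarrow> complex) \<Rightarrow> nat \<Rightarrow> complex \<Rightarrow> complex" where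
  "slice_coeff f j w = (deriv ^^ j) (\<lambda>z. f (z, w)) 0 / fact j"

text \<open>Cauchy integral for the \<open>k\<close>-th coefficient in \<open>w\<close> of
  \<open>slice_coeff f j\<close>, over the circle \<open>cmod w = 1 / 2\<close>, whence the factor
  \<open>2 ^ k\<close>. The radius has to lie below 1, so that the circle sits in the slice
  \<open>z = 0\<close>; \<open>integral_slice_coeff\<close> shows that its choice is
  immaterial.\<close>

definition taylor_coeff :: "(C2 \<Rightarrow> complex) \<Rightarrow> nat \<Rightarrow> nat \<Rightarrow> complex" where
  "taylor_coeff f j k =
     2 ^ k * (LINT s|circle_measure. slice_coeff f j (cis s * (1 / 2)) * cis (- (real k * s))) / (2 * pi)"

lemma integral_circle_slice_coeff:
  fixes z w :: complex
  assumes "holomorphic2_on f (egg m)" "m \<ge> 1" "(z, w) \<in> egg m"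
  shows "(LINT t|circle_measure. f (cis t * z, w) * cis (- (real j * t))) = 2 * pi * z ^ j * slice_coeff f j w"
proof -
  obtain \<rho> where \<rho>: "\<forall>z. (z, w) \<in> egg m \<longleftrightarrow> cmod z < \<rho>"
    using egg_slice_fst egg_cmod_less_1[OF assms(3,2)] assms(2) by blast
  have "(\<lambda>z. f (z, w)) holomorphic_on ball 0 \<rho>"
    using \<rho> by (intro holomorphic2_on_slice_fst[OF assms(1)]) auto
  from integral_circle_coeff[OF this, of z j] \<rho> assms(3) show ?thesis
    by (simp add: slice_coeff_def)
qed

lemma continuous_on_torus:
  assumes "continuous_on (egg m) f" "(z, w) \<in> egg m"
  shows "continuous_on UNIV (\<lambda>(t, s). f (cis t * z, cis s * w))"
proof -
  have "continuous_on UNIV (\<lambda>p::real\<times>real. f (cis (fst p) * z, cis (snd p) * w))"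
    using egg_mono[OF assms(2)]
    by (intro continuous_on_compose2[OF assms(1)] continuous_intros) (auto simp: norm_mult)
  then show ?thesis by (simp add: case_prod_unfold)
qed

text \<open>One double integral over the torus through \<open>(z, w)\<close>, evaluated in both
  orders. Integrating over \<open>t\<close> first produces \<open>slice_coeff\<close>; integrating
  over \<open>s\<close> first exhibits the dependence on \<open>w\<close> as exactly
  \<open>w ^ k\<close>.\<close>

lemma integral_torus_swap:
  fixes z w :: complex
  assumes f: "holomorphic2_on f (egg m)" and m: "m \<ge> 1" and zw: "(z, w) \<in> egg m"
  shows "2 * pi * z ^ j * (LINT s|circle_measure. slice_coeff f j (cis s * w) * cis (- (real k * s)))
    = (LINT t|circle_measure. LINT s|circle_measure. f (cis t * z, cis s * w) * cis (- (real j * t)) * cis (- (real k * s)))"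
    (is ?A)
    and "(LINT t|circle_measure. LINT s|circle_measure. f (cis t * z, cis s * w) * cis (- (real j * t)) * cis (- (real k * s)))
    = w ^ k * (2 * pi * (LINT t|circle_measure. (deriv ^^ k) (\<lambda>w. f (cis t * z, w)) 0 / fact k * cis (- (real j * t))))"
    (is ?B)
proof -
  note cont = holomorphic2_on_imp_continuous_on[OF f]
  obtain B where B: "\<forall>z' w'. cmod z' \<le> cmod z \<longrightarrow> cmod w' \<le> cmod w \<longrightarrow> cmod (f (z', w')) \<le> B"
    using torus_bound[OF cont zw] by blast
  define h where "h = (\<lambda>t s. f (cis t * z, cis s * w) * cis (- (real j * t)) * cis (- (real k * s)))"
  have hc: "continuous_on UNIV (\<lambda>(t, s). h t s)"
    using continuous_on_torus[OF cont zw] unfolding h_def case_prod_unfold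
    by (intro continuous_intros) auto
  have hB: "norm (h t s) \<le> B" for t s using B by (simp add: h_def norm_mult)
  have "(LINT s|circle_measure. LINT t|circle_measure. h t s)
      = (LINT s|circle_measure. 2 * pi * z ^ j * (slice_coeff f j (cis s * w) * cis (- (real k * s))))"
  proof (rule Bochner_Integration.integral_cong[OF refl])
    fix s
    have "(z, cis s * w) \<in> egg m" using egg_mono[OF zw] by (simp add: norm_mult)
    from integral_circle_slice_coeff[OF f m this, of j]
    show "(LINT t|circle_measure. h t s) = 2 * pi * z ^ j * (slice_coeff f j (cis s * w) * cis (- (real k * s)))"
      unfolding h_def by simp
  qed
  also have "\<dots> = 2 * pi * z ^ j * (LINT s|circle_measure. slice_coeff f j (cis s * w) * cis (- (real k * s)))"
    by simp
  finally show ?A using integrable_torus(3)[OF hc hB] by (simp add: h_def)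
  have "(LINT t|circle_measure. LINT s|circle_measure. h t s)
    = (LINT t|circle_measure. w ^ k * (2 * pi * ((deriv ^^ k) (\<lambda>w. f (cis t * z, w)) 0 / fact k * cis (- (real j * t)))))"
  proof (rule Bochner_Integration.integral_cong[OF refl])
    fix t
    have zw': "(cis t * z, w) \<in> egg m" using egg_mono[OF zw] by (simp add: norm_mult)
    then obtain \<rho> where \<rho>: "\<forall>w. (cis t * z, w) \<in> egg m \<longleftrightarrow> cmod w < \<rho>"
      using egg_slice_snd egg_cmod_less_1[OF zw' m] m by blast
    have "(\<lambda>w. f (cis t * z, w)) holomorphic_on ball 0 \<rho>"
      using \<rho> by (intro holomorphic2_on_slice_snd[OF f]) auto
    from integral_circle_coeff[OF this, of w k] \<rho> zw'
    have *: "(LINT s|circle_measure. f (cis t * z, cis s * w) * cis (- (real k * s)))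
        = 2 * pi * w ^ k * ((deriv ^^ k) (\<lambda>w. f (cis t * z, w)) 0 / fact k)" by simp
    have "(LINT s|circle_measure. h t s)
        = (LINT s|circle_measure. cis (- (real j * t)) * (f (cis t * z, cis s * w) * cis (- (real k * s))))"
      by (simp add: h_def mult_ac)
    also have "\<dots> = cis (- (real j * t)) * (2 * pi * w ^ k * ((deriv ^^ k) (\<lambda>w. f (cis t * z, w)) 0 / fact k))"
      by (simp only: integral_mult_right_zero *)
    finally show "(LINT s|circle_measure. h t s)
        = w ^ k * (2 * pi * ((deriv ^^ k) (\<lambda>w. f (cis t * z, w)) 0 / fact k * cis (- (real j * t))))"
      by (simp add: mult_ac)
  qed
  also have "\<dots> = w ^ k * (2 * pi * (LINT t|circle_measure. (deriv ^^ k) (\<lambda>w. f (cis t * z, w)) 0 / fact k * cis (- (real j * t))))"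
    by (simp only: integral_mult_right_zero)
  finally show ?B by (simp add: h_def)
qed

text \<open>By \<open>integral_torus_swap\<close> the left side is, up to a nonzero factor,
  \<open>w ^ k\<close> times a constant, and its value at \<open>1 / 2\<close> identifies that
  constant through \<open>taylor_coeff\<close>.\<close>

lemma integral_slice_coeff:
  fixes w :: complex
  assumes f: "holomorphic2_on f (egg m)" and m: "m \<ge> 1" and w: "cmod w < 1"
  shows "(LINT s|circle_measure. slice_coeff f j (cis s * w) * cis (- (real k * s)))
           = 2 * pi * taylor_coeff f j k * w ^ k"
proof -
  \<comment> \<open>A radius that majorizes both \<open>cmod w\<close> and \<open>1 / 2\<close>: a
    single \<open>z \<noteq> 0\<close> then serves for both circles, and \<open>z ^ j\<close> can be
    cancelled.\<close>
  define W where "W = complex_of_real (max (cmod w) (1 / 2))"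
  have W: "cmod W < 1" "cmod w \<le> cmod W" "1 / 2 \<le> cmod W" using w by (auto simp: W_def)
  then obtain \<rho> where \<rho>: "\<rho> > 0" "\<forall>z. (z, W) \<in> egg m \<longleftrightarrow> cmod z < \<rho>"
    using egg_slice_fst m by blast
  define z where "z = complex_of_real (\<rho> / 2)"
  have zW: "(z, W) \<in> egg m" "z \<noteq> 0" using \<rho> by (auto simp: z_def)
  define C where "C = 2 * pi * (LINT t|circle_measure. (deriv ^^ k) (\<lambda>w. f (cis t * z, w)) 0 / fact k * cis (- (real j * t)))"
  have *: "2 * pi * z ^ j * (LINT s|circle_measure. slice_coeff f j (cis s * w') * cis (- (real k * s))) = w' ^ k * C"
    if "cmod w' \<le> cmod W" for w'
  proof -
    have "(z, w') \<in> egg m" using egg_mono[OF zW(1)] that by simp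
    from integral_torus_swap[OF f m this, of j k] show ?thesis unfolding C_def by simp
  qed
  have C: "C = 2 * pi * z ^ j * (2 * pi * taylor_coeff f j k)"
    using *[of "1/2"] W by (simp add: taylor_coeff_def field_simps power_divide)
  show ?thesis using *[OF W(2)] zW(2) unfolding C by simp
qed

lemma integral_torus_taylor_coeff:
  fixes z w :: complex
  assumes f: "holomorphic2_on f (egg m)" and m: "m \<ge> 1" and zw: "(z, w) \<in> egg m"
  shows "(LINT t|circle_measure. LINT s|circle_measure. f (cis t * z, cis s * w) * cis (- (real j * t)) * cis (- (real k * s)))
    = 4 * pi ^ 2 * taylor_coeff f j k * z ^ j * w ^ k"
  using integral_torus_swap(1)[OF f m zw, of j k] integral_slice_coeff[OF f m egg_cmod_less_1(2)[OF zw m], of j k]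
  by (simp add: power2_eq_square mult_ac)

text \<open>Room between the point and the boundary: Cauchy's formula for \<open>(z, w)\<close> is
  integrated over the torus with these radii.\<close>

lemma egg_enlarge:
  assumes zw: "(z, w) \<in> egg m" and m: "m \<ge> 1"
  shows "\<exists>r s. cmod z < r \<and> cmod w < s \<and> (complex_of_real r, complex_of_real s) \<in> egg m"
proof -
  obtain \<rho> where \<rho>: "\<forall>z. (z, w) \<in> egg m \<longleftrightarrow> cmod z < \<rho>"
    using egg_slice_fst egg_cmod_less_1[OF zw m] m by blast
  then have "cmod z < \<rho>" using zw by blast
  then obtain r where r: "cmod z < r" "r < \<rho>" using dense by blast
  then have r0: "r > 0" by (meson le_less_trans norm_ge_zero)
  then have rw: "(complex_of_real r, w) \<in> egg m" using r \<rho> by simp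
  then obtain \<rho>' where \<rho>': "\<forall>w. (complex_of_real r, w) \<in> egg m \<longleftrightarrow> cmod w < \<rho>'"
    using egg_slice_snd egg_cmod_less_1[OF rw m] m by blast
  then have "cmod w < \<rho>'" using rw by blast
  then obtain s where s: "cmod w < s" "s < \<rho>'" using dense by blast
  then have "s > 0" by (meson le_less_trans norm_ge_zero)
  then have "(complex_of_real r, complex_of_real s) \<in> egg m" using s \<rho>' by simp
  then show ?thesis using r s by blast
qed

text \<open>Iterated Cauchy formula on a torus of slightly larger radii: both Cauchy kernels are
  expanded into geometric series, and the partial sums, bounded uniformly by \<open>K\<close>, pass
  to the limit under the integral. Square partial sums are the form in which
  \<open>integral_kernel_eq_limit\<close> takes the expansion.\<close>

lemma taylor_partial_sums_tendsto:
  fixes z w :: complex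
  assumes f: "holomorphic2_on f (egg m)" and m: "m \<ge> 1" and zw: "(z, w) \<in> egg m"
  shows "(\<lambda>N. \<Sum>j<N. \<Sum>k<N. taylor_coeff f j k * z ^ j * w ^ k) \<longlonglongrightarrow> f (z, w)"
proof -
  interpret C: finite_measure circle_measure by (rule finite_measure_circle_measure)
  interpret P: pair_sigma_finite circle_measure circle_measure ..
  interpret P: finite_measure "circle_measure \<Otimes>\<^sub>M circle_measure"
    by (rule finite_measure_pair_measure) (rule finite_measure_circle_measure)+
  obtain r s where rs: "cmod z < r" "cmod w < s" "(complex_of_real r, complex_of_real s) \<in> egg m"
    using egg_enlarge[OF zw m] by blast
  have r0: "r > 0" and s0: "s > 0" using rs by (meson le_less_trans norm_ge_zero)+
  note cont = holomorphic2_on_imp_continuous_on[OF f]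
  obtain B where B: "\<forall>z' w'. cmod z' \<le> cmod (complex_of_real r) \<longrightarrow> cmod w' \<le> cmod (complex_of_real s) \<longrightarrow> cmod (f (z', w')) \<le> B"
    using torus_bound[OF cont rs(3)] by blast
  have Bf: "cmod (f (cis t * r, cis u * s)) \<le> B" for t u using B by (simp add: norm_mult)
  have B0: "B \<ge> 0" using Bf[of 0 0] norm_ge_zero order_trans by blast
  define a b where "a = cmod z / r" and "b = cmod w / s"
  have ab: "0 \<le> a" "a < 1" "0 \<le> b" "b < 1" using rs r0 s0 by (auto simp: a_def b_def)
  \<comment> \<open>Ratios of the two geometric series; their moduli \<open>a\<close> and
    \<open>b\<close> are constant on the torus and below 1.\<close>
  define A where "A = (\<lambda>t. z / (r * cis t))"
  define E where "E = (\<lambda>t. w / (s * cis t))"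
  have nA: "cmod (A t) = a" and nE: "cmod (E t) = b" for t
    using r0 s0 by (auto simp: A_def E_def a_def b_def norm_divide norm_mult)
  have Ac: "continuous_on UNIV A" "continuous_on UNIV E"
    using r0 s0 unfolding A_def E_def by (auto intro!: continuous_intros)
  define F where "F = (\<lambda>t u. f (cis t * r, cis u * s))"
  have Fc: "continuous_on UNIV (\<lambda>(t, u). F t u)"
    using continuous_on_torus[OF cont rs(3)] by (simp add: F_def)
  have cc: "continuous_on UNIV (\<lambda>p::real\<times>real. F (fst p) (snd p))"
    "continuous_on UNIV (\<lambda>p::real\<times>real. A (fst p))" "continuous_on UNIV (\<lambda>p::real\<times>real. E (snd p))"
    using Fc continuous_on_compose2[OF Ac(1), of UNIV fst] continuous_on_compose2[OF Ac(2), of UNIV snd]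
    by (auto simp: case_prod_unfold continuous_on_fst continuous_on_snd continuous_on_id)
  have geo: "norm (\<Sum>j<N. X ^ j) \<le> 1 / (1 - x)" if "norm X = x" "0 \<le> x" "x < 1" for X :: complex and x N
  proof -
    have "norm (\<Sum>j<N. X ^ j) \<le> (\<Sum>j<N. x ^ j)"
      using that by (intro sum_norm_le) (simp add: norm_power)
    also have "\<dots> \<le> (\<Sum>j. x ^ j)" using that by (intro sum_le_suminf summable_geometric) auto
    finally show ?thesis using that by (simp add: suminf_geometric)
  qed
  define S where "S = (\<lambda>N t u. F t u * (\<Sum>j<N. A t ^ j) * (\<Sum>k<N. E u ^ k))"
  define L where "L = (\<lambda>t u. F t u * (1 / (1 - A t)) * (1 / (1 - E u)))"
  have ne: "A t \<noteq> 1" "E t \<noteq> 1" for t using nA[of t] nE[of t] ab by force+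
  have Sc: "continuous_on UNIV (\<lambda>(t, u). S N t u)" for N
    unfolding S_def case_prod_unfold by (intro continuous_intros cc)
  have Lc: "continuous_on UNIV (\<lambda>(t, u). L t u)"
    using ne unfolding L_def case_prod_unfold by (intro continuous_intros cc) auto
  define K where "K = B * (1 / (1 - a)) * (1 / (1 - b))"
  have SK: "norm (S N t u) \<le> K" for N t u
  proof -
    have "norm (\<Sum>j<N. A t ^ j) \<le> 1 / (1 - a)" "norm (\<Sum>k<N. E u ^ k) \<le> 1 / (1 - b)"
      using geo nA nE ab by blast+
    then show ?thesis unfolding S_def K_def norm_mult using Bf[of t u] ab B0
      by (intro mult_mono mult_nonneg_nonneg) (auto simp: F_def)
  qed
  have SL: "(\<lambda>N. S N t u) \<longlonglongrightarrow> L t u" for t u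
  proof -
    have "(\<lambda>j. A t ^ j) sums (1 / (1 - A t))" "(\<lambda>j. E u ^ j) sums (1 / (1 - E u))"
      using ab by (auto intro!: geometric_sums simp: nA nE)
    then show ?thesis unfolding S_def L_def sums_def by (intro tendsto_intros)
  qed
  have LK: "norm (L t u) \<le> K" for t u
    using LIMSEQ_le_const2[OF tendsto_norm[OF SL[of t u]], of K] SK by blast
  have lim: "(\<lambda>N. LINT t|circle_measure. LINT u|circle_measure. S N t u)
      \<longlonglongrightarrow> (LINT t|circle_measure. LINT u|circle_measure. L t u)"
    unfolding integrable_torus(2)[OF Sc SK] integrable_torus(2)[OF Lc LK]
  proof (rule integral_dominated_convergence[where w="\<lambda>_. K"])
    show "(\<lambda>p. case p of (t, u) \<Rightarrow> L t u) \<in> borel_measurable (circle_measure \<Otimes>\<^sub>M circle_measure)"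
      using integrable_torus(1)[OF Lc LK] by auto
    show "(\<lambda>p. case p of (t, u) \<Rightarrow> S N t u) \<in> borel_measurable (circle_measure \<Otimes>\<^sub>M circle_measure)" for N
      using integrable_torus(1)[OF Sc SK] by auto
  qed (auto simp: SL SK)
  have "(LINT t|circle_measure. LINT u|circle_measure. S N t u)
       = 4 * pi ^ 2 * (\<Sum>j<N. \<Sum>k<N. taylor_coeff f j k * z ^ j * w ^ k)" for N
  proof -
    define h where "h = (\<lambda>j k t u. F t u * A t ^ j * E u ^ k)"
    have hc: "continuous_on UNIV (\<lambda>(t, u). h j k t u)" for j k
      unfolding h_def case_prod_unfold by (intro continuous_intros cc)
    have hB: "norm (h j k t u) \<le> B" for j k t u
    proof -
      have "norm (h j k t u) \<le> B * 1 * 1"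
        unfolding h_def norm_mult norm_power nA nE using ab Bf[of t u] B0
        by (intro mult_mono mult_nonneg_nonneg) (auto simp: F_def power_le_one)
      then show ?thesis by simp
    qed
    have hI: "(LINT t|circle_measure. LINT u|circle_measure. h j k t u)
        = 4 * pi ^ 2 * (taylor_coeff f j k * z ^ j * w ^ k)" for j k
    proof -
      have "h j k t u = (z / r) ^ j * (w / s) ^ k * (f (cis t * r, cis u * s) * cis (- (real j * t)) * cis (- (real k * u)))" for t u
      proof -
        have ci: "cis (- (real n * x)) = 1 / cis x ^ n" for n x
          by (simp add: Complex.DeMoivre divide_inverse)
        show ?thesis
          unfolding h_def F_def A_def E_def ci by (simp add: power_mult_distrib power_divide mult_ac)
      qed
      then have "(LINT t|circle_measure. LINT u|circle_measure. h j k t u)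
        = (z / r) ^ j * (w / s) ^ k * (4 * pi ^ 2 * taylor_coeff f j k * of_real r ^ j * of_real s ^ k)"
        by (simp only: integral_mult_right_zero integral_torus_taylor_coeff[OF f m rs(3)])
      then show ?thesis using r0 s0 by (simp add: power_divide)
    qed
    have "(LINT t|circle_measure. LINT u|circle_measure. S N t u)
       = (LINT p|(circle_measure \<Otimes>\<^sub>M circle_measure). (\<Sum>j<N. \<Sum>k<N. case p of (t, u) \<Rightarrow> h j k t u))"
    proof -
      have "S N t u = (\<Sum>j<N. \<Sum>k<N. h j k t u)" for t u
        unfolding S_def h_def by (simp only: mult.assoc sum_product) (simp only: sum_distrib_left)
      then show ?thesis
        unfolding integrable_torus(2)[OF Sc SK] by (intro Bochner_Integration.integral_cong) auto
    qed
    also have "\<dots> = (\<Sum>j<N. \<Sum>k<N. (LINT p|(circle_measure \<Otimes>\<^sub>M circle_measure). (case p of (t, u) \<Rightarrow> h j k t u)))"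
      using integrable_torus(1)[OF hc hB]
      by (simp add: Bochner_Integration.integral_sum Bochner_Integration.integrable_sum)
    also have "\<dots> = (\<Sum>j<N. \<Sum>k<N. 4 * pi ^ 2 * (taylor_coeff f j k * z ^ j * w ^ k))"
      using integrable_torus(2)[OF hc hB] hI by simp
    finally show ?thesis by (simp add: sum_distrib_left)
  qed
  moreover have "(LINT t|circle_measure. LINT u|circle_measure. L t u) = 4 * pi ^ 2 * f (z, w)"
  proof -
    have "(LINT t|circle_measure. LINT u|circle_measure. L t u) = (LINT u|circle_measure. LINT t|circle_measure. L t u)"
      by (rule integrable_torus(3)[OF Lc LK])
    also have "\<dots> = (LINT u|circle_measure. 2 * pi * (f (z, s * cis u) / (1 - w / (s * cis u))))"
    proof (rule Bochner_Integration.integral_cong[OF refl])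
      fix u
      have e: "(complex_of_real r, s * cis u) \<in> egg m" using egg_mono[OF rs(3)] by (simp add: norm_mult)
      then obtain \<rho> where \<rho>: "\<forall>z. (z, s * cis u) \<in> egg m \<longleftrightarrow> cmod z < \<rho>"
        using egg_slice_fst egg_cmod_less_1[OF e m] m by blast
      have "(\<lambda>z. f (z, s * cis u)) holomorphic_on ball 0 \<rho>"
        using \<rho> by (intro holomorphic2_on_slice_fst[OF f]) auto
      moreover have "r < \<rho>" using \<rho> e r0 by auto
      ultimately have *: "(LINT t|circle_measure. f (r * cis t, s * cis u) / (1 - z / (r * cis t))) = 2 * pi * f (z, s * cis u)"
        using integral_circle_cauchy rs(1) by blast
      have "(LINT t|circle_measure. L t u) = (LINT t|circle_measure. 1 / (1 - w / (s * cis u)) * (f (r * cis t, s * cis u) / (1 - z / (r * cis t))))"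
        by (simp add: L_def F_def A_def E_def mult_ac)
      also have "\<dots> = 1 / (1 - w / (s * cis u)) * (2 * pi * f (z, s * cis u))"
        by (simp only: integral_mult_right_zero *)
      finally show "(LINT t|circle_measure. L t u) = 2 * pi * (f (z, s * cis u) / (1 - w / (s * cis u)))" by simp
    qed
    also have "\<dots> = 2 * pi * (LINT u|circle_measure. (f (z, s * cis u) / (1 - w / (s * cis u))))"
      by (simp only: integral_mult_right_zero)
    also have "(LINT u|circle_measure. (f (z, s * cis u) / (1 - w / (s * cis u)))) = 2 * pi * f (z, w)"
    proof -
      have e: "(z, complex_of_real s) \<in> egg m" using egg_mono[OF rs(3)] rs by simp
      then obtain \<rho> where \<rho>: "\<forall>w. (z, w) \<in> egg m \<longleftrightarrow> cmod w < \<rho>"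
        using egg_slice_snd egg_cmod_less_1[OF e m] m by blast
      have "(\<lambda>w. f (z, w)) holomorphic_on ball 0 \<rho>"
        using \<rho> by (intro holomorphic2_on_slice_snd[OF f]) auto
      moreover have "s < \<rho>" using \<rho> e s0 by auto
      ultimately show ?thesis using integral_circle_cauchy rs(2) by blast
    qed
    finally show ?thesis by (simp add: power2_eq_square)
  qed
  ultimately have "(\<lambda>N. 4 * pi ^ 2 * (\<Sum>j<N. \<Sum>k<N. taylor_coeff f j k * z ^ j * w ^ k)) \<longlonglongrightarrow> 4 * pi ^ 2 * f (z, w)"
    using lim by (simp only:)
  from tendsto_mult_left[OF this, of "1 / (4 * pi ^ 2)"] show ?thesis by simp
qed

section \<open>The candidate kernels\<close>

text \<open>Pointwise form of \<open>holomorphic2_on\<close>: product and composition rules hold at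
  a single point, and the same rules give continuity of the kernel at points of the closed
  egg.\<close>

definition cdiff :: "(C2 \<Rightarrow> complex) \<Rightarrow> C2 \<Rightarrow> bool" where
  "cdiff f p \<longleftrightarrow> (\<exists>a b. (f has_derivative (\<lambda>h. a * fst h + b * snd h)) (at p))"

lemma holomorphic2_on_iff: "holomorphic2_on f D \<longleftrightarrow> (\<forall>p\<in>D. cdiff f p)"
  by (simp add: holomorphic2_on_def cdiff_def)

lemma cdiff_const: "cdiff (\<lambda>_. c) p"
  unfolding cdiff_def by (rule exI[of _ 0], rule exI[of _ 0]) simp

lemma cdiff_fst: "cdiff fst p"
  unfolding cdiff_def by (rule exI[of _ 1], rule exI[of _ 0]) (auto intro!: derivative_eq_intros)

lemma cdiff_snd: "cdiff snd p"
  unfolding cdiff_def by (rule exI[of _ 0], rule exI[of _ 1]) (auto intro!: derivative_eq_intros)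

lemma cdiff_mult:
  assumes "cdiff f p" "cdiff g p"
  shows "cdiff (\<lambda>p. f p * g p) p"
proof -
  obtain a b c d where "(f has_derivative (\<lambda>h. a * fst h + b * snd h)) (at p)"
    "(g has_derivative (\<lambda>h. c * fst h + d * snd h)) (at p)"
    using assms unfolding cdiff_def by blast
  from has_derivative_mult[OF this] show ?thesis
    unfolding cdiff_def by (intro exI[of _ "f p * c + g p * a"] exI[of _ "f p * d + g p * b"]) (simp add: algebra_simps)
qed

lemma cdiff_compose:
  assumes "(g has_field_derivative g') (at (f p))" "cdiff f p"
  shows "cdiff (\<lambda>p. g (f p)) p"
proof -
  obtain a b where "(f has_derivative (\<lambda>h. a * fst h + b * snd h)) (at p)"
    using assms unfolding cdiff_def by blast
  from has_derivative_compose[OF this assms(1)[unfolded has_field_derivative_def]] show ?thesis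
    unfolding cdiff_def by (intro exI[of _ "g' * a"] exI[of _ "g' * b"]) (simp add: algebra_simps)
qed

lemma cdiff_isCont: "cdiff f p \<Longrightarrow> isCont f p"
  unfolding cdiff_def using has_derivative_continuous by blast

section \<open>The domain of the kernel variables\<close>

definition cegg :: "nat \<Rightarrow> C2 set" where
  "cegg m = {p. rho m p \<le> 0}"

text \<open>The range of \<open>X = z * cnj z'\<close> and \<open>Y = w * cnj w'\<close>: here
  \<open>1 - X\<close> avoids the branch cut of the power, and
  \<open>Y * (1 - X) powr (- 1 / m)\<close> has modulus below 1.\<close>

definition kernel_dom :: "nat \<Rightarrow> (complex \<times> complex) set" where
  "kernel_dom m = {(X, Y). cmod X < 1 \<and> cmod Y ^ m < 1 - cmod X}"

lemma egg_iff: "p \<in> egg m \<longleftrightarrow> rho m p < 0"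
  by (auto simp: egg_def rho_def)

lemma egg_subset_cegg: "egg m \<subseteq> cegg m"
  by (auto simp: egg_iff cegg_def)

lemma cegg_cmod_le_1:
  assumes "p \<in> cegg m" "m \<ge> 1"
  shows "cmod (fst p) \<le> 1" "cmod (snd p) \<le> 1"
proof -
  have "cmod (fst p) ^ 2 + cmod (snd p) ^ (2 * m) \<le> 1" using assms(1) by (simp add: cegg_def rho_def)
  moreover have "0 \<le> cmod (fst p) ^ 2" "0 \<le> cmod (snd p) ^ (2 * m)" by simp_all
  ultimately have "cmod (fst p) ^ 2 \<le> 1" "cmod (snd p) ^ (2 * m) \<le> 1" by linarith+
  then show "cmod (fst p) \<le> 1" "cmod (snd p) \<le> 1" 
    using assms(2) power_le_one_iff[of "cmod (fst p)" 2] power_le_one_iff[of "cmod (snd p)" "2 * m"] by auto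
qed

lemma compact_cegg:
  assumes "m \<ge> 1"
  shows "compact (cegg m)"
proof -
  have "cegg m \<subseteq> cball 0 1 \<times> cball 0 1"
    using cegg_cmod_le_1[OF _ assms] by auto
  moreover have "closed (cegg m)"
    unfolding cegg_def rho_def by (intro closed_Collect_le continuous_intros)
  ultimately show ?thesis
    using bounded_subset[OF compact_imp_bounded[OF compact_Times[OF compact_cball compact_cball]]]
    by (auto simp: compact_eq_bounded_closed)
qed

text \<open>A Cauchy--Schwarz argument resting on
  \<open>(1 - z^2) * (1 - a^2) = (1 - z * a)^2 - (z - a)^2\<close> for the moduli. Only
  \<open>q\<close> has to be interior; this is why the kernel extends continuously to the closed egg
  in its first variable.\<close>

lemma kernel_dom_mult:
  assumes p: "p \<in> cegg m" and q: "q \<in> egg m" and m: "m \<ge> 1"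
    and X: "cmod X = cmod (fst p) * cmod (fst q)" and Y: "cmod Y = cmod (snd p) * cmod (snd q)"
  shows "(X, Y) \<in> kernel_dom m"
proof -
  define z w a b where "z = cmod (fst p)" and "w = cmod (snd p) ^ m" and "a = cmod (fst q)" and "b = cmod (snd q) ^ m"
  have nn: "0 \<le> z" "0 \<le> w" "0 \<le> a" "0 \<le> b" by (auto simp: z_def w_def a_def b_def)
  have zw: "z^2 + w^2 \<le> 1" using p by (simp add: cegg_def rho_def z_def w_def power_mult mult.commute flip: power_mult)
  have ab: "a^2 + b^2 < 1" using q by (simp add: egg_def a_def b_def mult.commute flip: power_mult)
  have z1: "z \<le> 1" using cegg_cmod_le_1[OF p m] by (simp add: z_def)
  have "a^2 < 1" using ab zero_le_power2[of b] by linarith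
  then have a1: "a < 1" using nn by (simp add: power_less_one_iff abs_square_less_1)
  have za: "z * a < 1"
    using mult_right_mono[OF z1 nn(3)] a1 by simp
  have "(w * b)^2 < (1 - z * a)^2"
  \<comment> \<open>Strictness comes from \<open>a^2 + b^2 < 1\<close> multiplied by
    \<open>w^2\<close>, which must then be positive.\<close>
  proof (cases "w = 0")
    case True
    then show ?thesis using za by simp
  next
    case False
    then have w2: "w^2 > 0" by simp
    have "(w * b)^2 = w^2 * b^2" by (simp add: power_mult_distrib)
    also have "\<dots> < w^2 * (1 - a^2)" using ab w2 by (intro mult_strict_left_mono) auto
    also have "\<dots> \<le> (1 - z^2) * (1 - a^2)" using zw ab \<open>a^2 < 1\<close> by (intro mult_right_mono) auto
    also have "\<dots> = (1 - z * a)^2 - (z - a)^2" by (simp add: power2_eq_square algebra_simps)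
    also have "\<dots> \<le> (1 - z * a)^2" by simp
    finally show ?thesis .
  qed
  then have "w * b < 1 - z * a"
    using za by (intro power_less_imp_less_base[of "w * b" 2]) auto
  then show ?thesis using za X Y by (simp add: kernel_dom_def z_def w_def a_def b_def power_mult_distrib)
qed

section \<open>Closed form and power series of the kernels\<close>

text \<open>Common shape of both kernels: \<open>A2 = 0\<close> for Fefferman--Szego,
  \<open>A0 = 0\<close> for Bergman. The constants weight \<open>1\<close>, \<open>k + 1\<close> and
  \<open>(k + 1) * (k + 2)\<close> in the coefficient of \<open>T ^ k\<close>; the last of these
  series sums to \<open>2 / (1 - T)^3\<close>, whence the factor 2.\<close>

definition egg_kernel :: "nat \<Rightarrow> real \<Rightarrow> real \<Rightarrow> real \<Rightarrow> real \<Rightarrow> complex \<Rightarrow> complex \<Rightarrow> complex" where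
  "egg_kernel m e A0 A1 A2 X Y =
     (let T = Y * (1 - X) powr of_real (- 1 / real m)
      in (1 - X) powr of_real (- e) * (of_real A0 / (1 - T) + of_real A1 / (1 - T)^2 + 2 * of_real A2 / (1 - T)^3))"

text \<open>Coefficient of \<open>X ^ j * Y ^ k\<close> in \<open>egg_kernel\<close>; in both
  applications it is the reciprocal of the squared norm of the monomial
  \<open>z ^ j * w ^ k\<close>.\<close>

definition egg_coeff :: "nat \<Rightarrow> real \<Rightarrow> real \<Rightarrow> real \<Rightarrow> real \<Rightarrow> nat \<Rightarrow> nat \<Rightarrow> real" where
  "egg_coeff m e A0 A1 A2 j k =
     (A0 + A1 * (real k + 1) + A2 * (real k + 1) * (real k + 2)) * (pochhammer (e + k / m) j / fact j)"

text \<open>From \<open>cmod (1 - X) \<ge> 1 - cmod X > cmod Y ^ m\<close> by taking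
  \<open>m\<close>-th roots.\<close>

lemma kernel_dom_cmod_less_1:
  assumes "(X, Y) \<in> kernel_dom m" "m \<ge> 1"
  shows "cmod (Y * (1 - X) powr of_real (- 1 / real m)) < 1"
proof -
  have X: "cmod X < 1" "cmod Y ^ m < 1 - cmod X" using assms by (auto simp: kernel_dom_def)
  have "1 - cmod X \<le> cmod (1 - X)" using norm_triangle_ineq2[of 1 X] by simp
  then have le: "cmod Y ^ m < cmod (1 - X)" using X by linarith
  then have pos: "cmod (1 - X) > 0" using zero_le_power[OF norm_ge_zero, of Y m] by linarith
  have "cmod Y = root m (cmod Y ^ m)" using assms(2) by (simp add: real_root_power_cancel)
  also have "\<dots> < root m (cmod (1 - X))" using le assms(2) by simp
  also have "\<dots> = cmod (1 - X) powr (1 / m)" using pos assms(2) by (simp add: root_powr_inverse)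
  finally have "cmod Y * cmod (1 - X) powr (- 1 / m) < cmod (1 - X) powr (1 / m) * cmod (1 - X) powr (- 1 / m)"
    using pos by (intro mult_strict_right_mono) auto
  also have "\<dots> = 1" using pos by (simp add: powr_add[symmetric])
  finally show ?thesis by (simp add: norm_mult norm_powr_real_powr')
qed

lemma kernel_dom_one_minus_notin_nonpos:
  assumes "(X, Y) \<in> kernel_dom m"
  shows "1 - X \<notin> \<real>\<^sub>\<le>\<^sub>0"
proof -
  have "Re X < 1" using assms complex_Re_le_cmod[of X] by (auto simp: kernel_dom_def)
  then show ?thesis by (auto simp: complex_nonpos_Reals_iff)
qed

lemma cdiff_egg_kernel:
  assumes "(fst p * a, snd p * b) \<in> kernel_dom m" "m \<ge> 1"
  shows "cdiff (\<lambda>p. egg_kernel m e A0 A1 A2 (fst p * a) (snd p * b)) p"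
proof -
  have X: "cdiff (\<lambda>p. fst p * a) p" and Y: "cdiff (\<lambda>p. snd p * b) p"
    by (intro cdiff_mult cdiff_fst cdiff_snd cdiff_const)+
  have P: "cdiff (\<lambda>p. (1 - fst p * a) powr of_real s) p" for s
    using kernel_dom_one_minus_notin_nonpos[OF assms(1)]
    by (intro cdiff_compose[OF _ X, where g="\<lambda>x. (1 - x) powr of_real s"])
       (auto intro!: derivative_eq_intros)
  have T: "cdiff (\<lambda>p. snd p * b * (1 - fst p * a) powr of_real (- 1 / real m)) p"
    by (intro cdiff_mult[OF Y P])
  have ne: "1 - snd p * b * (1 - fst p * a) powr of_real (- 1 / real m) \<noteq> 0"
    using kernel_dom_cmod_less_1[OF assms] by auto
  define g where "g = (\<lambda>t::complex. of_real A0 / (1 - t) + of_real A1 / (1 - t)^2 + 2 * of_real A2 / (1 - t)^3)"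
  have "g holomorphic_on (- {1})" unfolding g_def by (intro holomorphic_intros) auto
  from holomorphic_derivI[OF this, of "snd p * b * (1 - fst p * a) powr of_real (- 1 / real m)"] ne
  have "cdiff (\<lambda>p. g (snd p * b * (1 - fst p * a) powr of_real (- 1 / real m))) p"
    by (intro cdiff_compose[OF _ T, of g]) auto
  note Q = this[unfolded g_def]
  show ?thesis unfolding egg_kernel_def Let_def by (intro cdiff_mult P Q)
qed

lemma binomial_series:
  fixes c X :: complex
  assumes "cmod X < 1"
  shows "(\<lambda>j. pochhammer c j / fact j * X ^ j) sums (1 - X) powr (- c)"
proof -
  have "(\<lambda>j. (- c gchoose j) * (- X) ^ j) sums (1 + - X) powr (- c)"
    using assms by (intro gen_binomial_complex) simp
  moreover have "(- c gchoose j) * (- X) ^ j = pochhammer c j / fact j * X ^ j" for j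
  proof -
    have "(- c gchoose j) * (- X) ^ j = ((- 1) ^ j * (- 1) ^ j) * (pochhammer c j / fact j * X ^ j)"
      unfolding gbinomial_pochhammer power_minus[of X] by simp
    also have "(- 1) ^ j * (- 1) ^ j = (1 :: complex)" by (simp flip: power_mult_distrib)
    finally show ?thesis by simp
  qed
  ultimately show ?thesis by simp
qed

lemma outer_series:
  fixes T :: complex and A0 A1 A2 :: real
  assumes "cmod T < 1"
  shows "(\<lambda>k. of_real (A0 + A1 * (real k + 1) + A2 * (real k + 1) * (real k + 2)) * T ^ k)
           sums (of_real A0 / (1 - T) + of_real A1 / (1 - T)^2 + 2 * of_real A2 / (1 - T)^3)"
proof -
  have s0: "(\<lambda>k. T ^ k) sums (1 / (1 - T))" using assms by (rule geometric_sums)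
  have s1: "(\<lambda>k. of_nat (Suc k) * T ^ k) sums (1 / (1 - T)^2)"
    using geometric_deriv_sums[OF assms] by simp
  have T: "1 - T \<noteq> 0" using assms by auto
  \<comment> \<open>The rising factorial of 3 is \<open>(k + 2)! / 2\<close>; it supplies the
    coefficients of the binomial series with exponent \<open>- 3\<close>.\<close>
  have p3: "pochhammer (3::complex) k = fact k * (of_nat (k + 1) * of_nat (k + 2) / 2)" for k
  proof (induction k)
    case (Suc k)
    have "pochhammer (3::complex) (Suc k) = pochhammer 3 k * (3 + of_nat k)" by (simp add: pochhammer_Suc)
    then show ?case unfolding Suc by (simp add: field_simps)
  qed simp
  have "(1 - T) powr (- 3) = 1 / (1 - T)^3"
    using T powr_nat[of "1 - T" 3] by (simp add: powr_minus divide_inverse)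
  then have s2: "(\<lambda>k. of_nat (k + 1) * of_nat (k + 2) / 2 * T ^ k) sums (1 / (1 - T)^3)"
    using binomial_series[OF assms, of 3] by (simp add: p3)
  have "(\<lambda>k. A0 * T ^ k + A1 * (of_nat (Suc k) * T ^ k) + 2 * A2 * (of_nat (k + 1) * of_nat (k + 2) / 2 * T ^ k))
      sums (A0 * (1 / (1 - T)) + A1 * (1 / (1 - T)^2) + 2 * A2 * (1 / (1 - T)^3))"
    by (intro sums_add sums_mult s0 s1 s2)
  moreover have "(\<lambda>k. A0 * T ^ k + A1 * (of_nat (Suc k) * T ^ k) + 2 * A2 * (of_nat (k + 1) * of_nat (k + 2) / 2 * T ^ k))
      = (\<lambda>k. of_real (A0 + A1 * (real k + 1) + A2 * (real k + 1) * (real k + 2)) * T ^ k)"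
    by (simp add: fun_eq_iff field_simps)
  ultimately show ?thesis by simp
qed

text \<open>Expansion in two stages: in powers of \<open>T\<close>, whose factors
  \<open>(1 - X) powr (- 1 / m)\<close> merge with the prefactor, and then of each resulting power
  of \<open>1 - X\<close> by the binomial series. The outcome is an iterated sum with
  \<open>j\<close> innermost.\<close>

lemma egg_kernel_series:
  fixes e A0 A1 A2 :: real
  assumes XY: "(X, Y) \<in> kernel_dom m" and m: "m \<ge> 1"
  defines "I \<equiv> \<lambda>k. of_real (A0 + A1 * (real k + 1) + A2 * (real k + 1) * (real k + 2)) * Y ^ k * (1 - X) powr (- of_real (e + k / m))"
  shows "I sums egg_kernel m e A0 A1 A2 X Y"
    and "(\<lambda>j. of_real (egg_coeff m e A0 A1 A2 j k) * X ^ j * Y ^ k) sums I k"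
proof -
  have X: "cmod X < 1" using XY by (auto simp: kernel_dom_def)
  then have X1: "1 - X \<noteq> 0" by auto
  define T where "T = Y * (1 - X) powr of_real (- 1 / real m)"
  have T: "cmod T < 1" unfolding T_def by (rule kernel_dom_cmod_less_1[OF XY m])
  have "((1 - X) powr of_real (- 1 / real m)) ^ k = (1 - X) powr of_real (- (k / m))" for k :: nat
    using X1 by (induction k) (simp_all add: powr_add[symmetric] add_divide_distrib)
  then have Tk: "(1 - X) powr of_real (- e) * T ^ k = Y ^ k * (1 - X) powr (- of_real (e + k / m))" for k :: nat
    by (simp add: T_def power_mult_distrib powr_add[symmetric] mult_ac)
  from sums_mult[OF outer_series[OF T, of A0 A1 A2], of "(1 - X) powr of_real (- e)"]
  have "(\<lambda>k. of_real (A0 + A1 * (real k + 1) + A2 * (real k + 1) * (real k + 2)) * ((1 - X) powr of_real (- e) * T ^ k))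
      sums egg_kernel m e A0 A1 A2 X Y"
    unfolding egg_kernel_def Let_def T_def[symmetric] by (simp add: mult_ac)
  then show "I sums egg_kernel m e A0 A1 A2 X Y"
    unfolding Tk I_def by (simp add: mult_ac)
  have poch: "pochhammer (complex_of_real x) j = of_real (pochhammer x j)" for x j
    by (rule pochhammer_of_real)
  from sums_mult[OF binomial_series[OF X, of "of_real (e + k / m)", unfolded poch],
      of "of_real (A0 + A1 * (real k + 1) + A2 * (real k + 1) * (real k + 2)) * Y ^ k"]
  show "(\<lambda>j. of_real (egg_coeff m e A0 A1 A2 j k) * X ^ j * Y ^ k) sums I k"
    by (simp add: I_def egg_coeff_def mult_ac)
qed

lemma egg_coeff_nonneg:
  assumes "e > 0" "A0 \<ge> 0" "A1 \<ge> 0" "A2 \<ge> 0"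
  shows "egg_coeff m e A0 A1 A2 j k \<ge> 0"
  unfolding egg_coeff_def using assms
  by (intro mult_nonneg_nonneg divide_nonneg_nonneg add_nonneg_nonneg pochhammer_nonneg) (auto intro: add_pos_nonneg)

text \<open>All coefficients are nonnegative, so the series at the moduli of \<open>X\<close> and
  \<open>Y\<close> dominates: it yields the bound, and through Tannery's theorem it turns the
  iterated sum into a limit of square partial sums.\<close>

lemma egg_kernel_partial_sums:
  assumes XY: "(X, Y) \<in> kernel_dom m" and m: "m \<ge> 1"
    and A: "e > 0" "A0 \<ge> 0" "A1 \<ge> 0" "A2 \<ge> 0"
  shows "(\<lambda>N. \<Sum>k<N. \<Sum>j<N. of_real (egg_coeff m e A0 A1 A2 j k) * X ^ j * Y ^ k)
           \<longlonglongrightarrow> egg_kernel m e A0 A1 A2 X Y"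
    and "norm (\<Sum>k<N. \<Sum>j<N. of_real (egg_coeff m e A0 A1 A2 j k) * X ^ j * Y ^ k)
           \<le> norm (egg_kernel m e A0 A1 A2 (cmod X) (cmod Y))"
proof -
  let ?D = "egg_coeff m e A0 A1 A2"
  define I where "I = (\<lambda>X Y k. of_real (A0 + A1 * (real k + 1) + A2 * (real k + 1) * (real k + 2)) * Y ^ k * (1 - X) powr (- of_real (e + k / m)) :: complex)"
  have xy: "(complex_of_real (cmod X), complex_of_real (cmod Y)) \<in> kernel_dom m"
    using XY by (simp add: kernel_dom_def)
  note D = egg_coeff_nonneg[OF A, of m]
  have s: "(\<lambda>j. of_real (?D j k) * X ^ j * Y ^ k) sums I X Y k" for k
    unfolding I_def by (rule egg_kernel_series(2)[OF XY m])
  have s': "(\<lambda>j. complex_of_real (?D j k * cmod X ^ j * cmod Y ^ k)) sums I (cmod X) (cmod Y) k" for k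
    using egg_kernel_series(2)[OF xy m, of e A0 A1 A2 k] unfolding I_def by simp
  define M where "M = (\<lambda>k. Re (I (cmod X) (cmod Y) k))"
  have sM: "(\<lambda>j. ?D j k * cmod X ^ j * cmod Y ^ k) sums M k" for k
    using sums_Re[OF s'[of k]] unfolding M_def by simp
  have KM: "M sums Re (egg_kernel m e A0 A1 A2 (cmod X) (cmod Y))"
    unfolding M_def I_def by (rule sums_Re[OF egg_kernel_series(1)[OF xy m]])
  have in_le: "norm (\<Sum>j<N. of_real (?D j k) * X ^ j * Y ^ k) \<le> M k" for N k
  proof -
    have "norm (\<Sum>j<N. of_real (?D j k) * X ^ j * Y ^ k) \<le> (\<Sum>j<N. ?D j k * cmod X ^ j * cmod Y ^ k)"
      using D by (intro sum_norm_le) (simp add: norm_mult norm_power)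
    also have "\<dots> \<le> (\<Sum>j. ?D j k * cmod X ^ j * cmod Y ^ k)"
      using sM D by (intro sum_le_suminf) (auto simp: sums_iff)
    finally show ?thesis using sM by (simp add: sums_iff)
  qed
  have M0: "M k \<ge> 0" for k by (rule order_trans[OF norm_ge_zero in_le])
  have "norm (\<Sum>k<N. \<Sum>j<N. of_real (?D j k) * X ^ j * Y ^ k) \<le> (\<Sum>k<N. M k)"
    by (rule sum_norm_le) (rule in_le)
  also have "\<dots> \<le> suminf M" using KM M0 by (intro sum_le_suminf) (auto simp: sums_iff)
  also have "\<dots> = Re (egg_kernel m e A0 A1 A2 (cmod X) (cmod Y))" using KM by (simp add: sums_iff)
  also have "\<dots> \<le> norm (egg_kernel m e A0 A1 A2 (cmod X) (cmod Y))" by (rule complex_Re_le_cmod)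
  finally show "norm (\<Sum>k<N. \<Sum>j<N. of_real (?D j k) * X ^ j * Y ^ k)
           \<le> norm (egg_kernel m e A0 A1 A2 (cmod X) (cmod Y))" .
  \<comment> \<open>Rows cut off at \<open>N\<close>, with zero rows from \<open>N\<close> on; the
    full rows \<open>M k\<close> at the moduli form the summable majorant.\<close>
  define a where "a = (\<lambda>k N. if k < N then (\<Sum>j<N. of_real (?D j k) * X ^ j * Y ^ k) else 0)"
  have "((\<lambda>N. \<Sum>k. a k N) \<longlongrightarrow> (\<Sum>k. I X Y k)) sequentially"
  proof (rule tannerys_theorem[where M=M, THEN conjunct2, THEN conjunct2])
    fix k
    have "eventually (\<lambda>N. (\<Sum>j<N. of_real (?D j k) * X ^ j * Y ^ k) = a k N) sequentially"
      using eventually_gt_at_top[of k] by eventually_elim (simp add: a_def)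
    from Lim_transform_eventually[OF s[of k, unfolded sums_def] this]
    show "(\<lambda>N. a k N) \<longlonglongrightarrow> I X Y k" .
    show "summable M" using KM by (simp add: sums_iff)
    show "\<forall>\<^sub>F (k, N) in at_top \<times>\<^sub>F sequentially. norm (a k N) \<le> M k"
      by (rule always_eventually) (auto simp: a_def in_le M0)
  qed simp
  moreover have "(\<Sum>k. a k N) = (\<Sum>k<N. \<Sum>j<N. of_real (?D j k) * X ^ j * Y ^ k)" for N
    by (subst suminf_finite[of "{..<N}"]) (auto simp: a_def)
  moreover have "(\<Sum>k. I X Y k) = egg_kernel m e A0 A1 A2 X Y"
    using egg_kernel_series(1)[OF XY m, of A0 A1 A2 e] unfolding I_def by (simp add: sums_iff)
  ultimately show "(\<lambda>N. \<Sum>k<N. \<Sum>j<N. of_real (?D j k) * X ^ j * Y ^ k)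
           \<longlonglongrightarrow> egg_kernel m e A0 A1 A2 X Y" by simp
qed

definition egg_kernel2 :: "nat \<Rightarrow> real \<Rightarrow> real \<Rightarrow> real \<Rightarrow> real \<Rightarrow> C2 \<Rightarrow> C2 \<Rightarrow> complex" where
  "egg_kernel2 m e A0 A1 A2 p q = egg_kernel m e A0 A1 A2 (fst p * cnj (fst q)) (snd p * cnj (snd q))"

lemma kernel_dom_cnj:
  assumes "p \<in> cegg m" "q \<in> egg m" "m \<ge> 1"
  shows "(fst p * cnj (fst q), snd p * cnj (snd q)) \<in> kernel_dom m"
  by (rule kernel_dom_mult[OF assms]) (auto simp: norm_mult)

lemma continuous_on_egg_kernel2:
  assumes "q \<in> egg m" "m \<ge> 1"
  shows "continuous_on (cegg m) (\<lambda>p. egg_kernel2 m e A0 A1 A2 p q)"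
  unfolding egg_kernel2_def
  by (intro continuous_at_imp_continuous_on ballI cdiff_isCont cdiff_egg_kernel kernel_dom_cnj assms)

lemma holomorphic2_on_egg_kernel2:
  assumes "q \<in> egg m" "m \<ge> 1"
  shows "holomorphic2_on (\<lambda>p. egg_kernel2 m e A0 A1 A2 p q) (egg m)"
  unfolding egg_kernel2_def holomorphic2_on_iff
  using egg_subset_cegg by (intro ballI cdiff_egg_kernel kernel_dom_cnj assms) auto

text \<open>With \<open>q\<close> replaced by the point \<open>q'\<close> of its moduli, the kernel
  is bounded on the compact closed egg, and this bound dominates every partial sum at every point.
  Such a constant is what dominated convergence asks for.\<close>

lemma egg_kernel2_partial_sums:
  fixes e A0 A1 A2 :: real
  assumes q: "q \<in> egg m" and m: "m \<ge> 1" and A: "e > 0" "A0 \<ge> 0" "A1 \<ge> 0" "A2 \<ge> 0"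
  defines "P \<equiv> \<lambda>N p. \<Sum>k<N. \<Sum>j<N. of_real (egg_coeff m e A0 A1 A2 j k) * (fst p * cnj (fst q)) ^ j * (snd p * cnj (snd q)) ^ k"
  shows "\<exists>B. \<forall>p\<in>cegg m. (\<lambda>N. P N p) \<longlonglongrightarrow> egg_kernel2 m e A0 A1 A2 p q \<and>
            (\<forall>N. cmod (P N p) \<le> B) \<and> cmod (egg_kernel2 m e A0 A1 A2 p q) \<le> B"
proof -
  define q' where "q' = (complex_of_real (cmod (fst q)), complex_of_real (cmod (snd q)))"
  have q': "q' \<in> egg m" using q by (simp add: q'_def egg_def)
  have "compact ((\<lambda>p. egg_kernel2 m e A0 A1 A2 p q') ` cegg m)"
    by (intro compact_continuous_image continuous_on_egg_kernel2 compact_cegg q' m)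
  then obtain B where B: "\<forall>x\<in>(\<lambda>p. egg_kernel2 m e A0 A1 A2 p q') ` cegg m. norm x \<le> B"
    using compact_imp_bounded bounded_iff by blast
  show ?thesis
  proof (intro exI[of _ B] ballI conjI allI)
    fix p assume p: "p \<in> cegg m"
    note kd = kernel_dom_cnj[OF p q m]
    show lim: "(\<lambda>N. P N p) \<longlonglongrightarrow> egg_kernel2 m e A0 A1 A2 p q"
      unfolding P_def egg_kernel2_def by (rule egg_kernel_partial_sums(1)[OF kd m A])
    define p' where "p' = (complex_of_real (cmod (fst p)), complex_of_real (cmod (snd p)))"
    have "p' \<in> cegg m" using p by (simp add: p'_def cegg_def rho_def)
    then have "norm (egg_kernel2 m e A0 A1 A2 p' q') \<le> B" using B by blast
    then have "norm (egg_kernel m e A0 A1 A2 (cmod (fst p * cnj (fst q))) (cmod (snd p * cnj (snd q)))) \<le> B"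
      by (simp add: egg_kernel2_def p'_def q'_def norm_mult)
    then show *: "cmod (P N p) \<le> B" for N
      using egg_kernel_partial_sums(2)[OF kd m A, of N] unfolding P_def by linarith
    show "cmod (egg_kernel2 m e A0 A1 A2 p q) \<le> B"
      using LIMSEQ_le_const2[OF tendsto_norm[OF lim], of B] * by blast
  qed
qed

section \<open>The Bergman kernel\<close>

lemma egg_coeff_pos:
  assumes "e > 0" "A0 \<ge> 0" "A1 \<ge> 0" "A2 \<ge> 0" "A0 + A1 + A2 > 0"
  shows "egg_coeff m e A0 A1 A2 j k > 0"
proof -
  have "A0 + A1 + A2 \<le> A0 + A1 * (real k + 1) + A2 * (real k + 1) * (real k + 2)"
  proof -
    have "A1 * 1 \<le> A1 * (real k + 1)" using assms by (intro mult_left_mono) auto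
    moreover have "A2 * (1 * 1) \<le> A2 * ((real k + 1) * (real k + 2))" using assms by (intro mult_left_mono mult_mono) auto
    ultimately show ?thesis by (simp add: mult.assoc)
  qed
  then have "0 < A0 + A1 * (real k + 1) + A2 * (real k + 1) * (real k + 2)" using assms(5) by linarith
  moreover have "0 < pochhammer (e + real k / real m) j"
    using assms(1) by (intro pochhammer_pos add_pos_nonneg) auto
  ultimately show ?thesis unfolding egg_coeff_def by (intro mult_pos_pos divide_pos_pos) auto
qed

lemma borel_measurable_cnj [measurable]: "cnj \<in> borel_measurable borel"
  by (intro borel_measurable_continuous_onI continuous_intros)

text \<open>A reproducing formula from moments, for a measure carried by the closed egg, so that
  volume and boundary measure are treated alike. The moments turn integrals of partial sums of the
  kernel into partial sums of the Taylor series at \<open>q\<close>, whose coefficients are the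
  \<open>c j k\<close>; \<open>B * norm (g p)\<close> dominates.\<close>

lemma integral_kernel_eq_limit:
  fixes e A0 A1 A2 :: real and g :: "C2 \<Rightarrow> complex"
  assumes q: "q \<in> egg m" and m: "m \<ge> 1"
    and A: "e > 0" "A0 \<ge> 0" "A1 \<ge> 0" "A2 \<ge> 0" "A0 + A1 + A2 > 0"
    and sp: "space M \<subseteq> cegg m" and id: "(\<lambda>p. p) \<in> measurable M borel"
    and g: "integrable M g"
    and mom: "\<And>j k. (LINT p|M. cnj (fst p ^ j * snd p ^ k) * g p) = c j k / of_real (egg_coeff m e A0 A1 A2 j k)"
    and lim: "(\<lambda>N. \<Sum>j<N. \<Sum>k<N. c j k * fst q ^ j * snd q ^ k) \<longlonglongrightarrow> L"
  shows "(LINT p|M. cnj (egg_kernel2 m e A0 A1 A2 p q) * g p) = L"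
    and "(\<lambda>p. egg_kernel2 m e A0 A1 A2 p q) \<in> borel_measurable M"
proof -
  let ?D = "egg_coeff m e A0 A1 A2"
  let ?K = "\<lambda>p. egg_kernel2 m e A0 A1 A2 p q"
  define P where "P = (\<lambda>N p. \<Sum>k<N. \<Sum>j<N. of_real (?D j k) * (fst p * cnj (fst q)) ^ j * (snd p * cnj (snd q)) ^ k)"
  obtain B where B: "\<forall>p\<in>cegg m. (\<lambda>N. P N p) \<longlonglongrightarrow> ?K p \<and> (\<forall>N. cmod (P N p) \<le> B) \<and> cmod (?K p) \<le> B"
    using egg_kernel2_partial_sums[OF q m A(1-4)] unfolding P_def by blast
  have fm [measurable]: "(\<lambda>p. fst p) \<in> borel_measurable M" "(\<lambda>p. snd p) \<in> borel_measurable M"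
    by (rule measurable_compose[OF id], simp add: borel_measurable_continuous_onI continuous_on_fst continuous_on_snd continuous_on_id)+
  have gm [measurable]: "g \<in> borel_measurable M" using g by auto
  have Pm [measurable]: "P N \<in> borel_measurable M" for N unfolding P_def by measurable
  show Km [measurable]: "?K \<in> borel_measurable M"
    by (rule borel_measurable_LIMSEQ_metric[where f=P, OF Pm]) (use sp B in blast)
  have mono: "integrable M (\<lambda>p. cnj (fst p ^ j * snd p ^ k) * g p)" for j k
  proof (rule Bochner_Integration.integrable_bound[OF g])
    show "AE p in M. norm (cnj (fst p ^ j * snd p ^ k) * g p) \<le> norm (g p)"
    proof (rule AE_I2)
      fix p assume "p \<in> space M"
      then have "cmod (fst p) \<le> 1" "cmod (snd p) \<le> 1" using sp cegg_cmod_le_1[of p m] m by auto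
      then have "cmod (fst p) ^ j * cmod (snd p) ^ k \<le> 1 * 1" by (intro mult_mono power_le_one) auto
      then have "cmod (fst p) ^ j * cmod (snd p) ^ k * cmod (g p) \<le> 1 * cmod (g p)" by (intro mult_right_mono) auto
      then show "norm (cnj (fst p ^ j * snd p ^ k) * g p) \<le> norm (g p)" by (simp add: norm_mult norm_power)
    qed
  qed simp
  have "(LINT p|M. cnj (P N p) * g p) = (\<Sum>j<N. \<Sum>k<N. c j k * fst q ^ j * snd q ^ k)" for N
  proof -
    have "cnj (P N p) * g p = (\<Sum>k<N. \<Sum>j<N. (of_real (?D j k) * fst q ^ j * snd q ^ k) * (cnj (fst p ^ j * snd p ^ k) * g p))" for p
      unfolding P_def cnj_sum sum_distrib_right by (intro sum.cong) (simp_all add: power_mult_distrib mult_ac)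
    then have "(LINT p|M. cnj (P N p) * g p)
        = (\<Sum>k<N. \<Sum>j<N. (of_real (?D j k) * fst q ^ j * snd q ^ k) * (LINT p|M. cnj (fst p ^ j * snd p ^ k) * g p))"
      using mono by (simp add: Bochner_Integration.integral_sum Bochner_Integration.integrable_sum)
    also have "\<dots> = (\<Sum>k<N. \<Sum>j<N. c j k * fst q ^ j * snd q ^ k)"
      using egg_coeff_pos[OF A, of m] unfolding mom by (intro sum.cong refl) (simp add: less_imp_neq[symmetric])
    also have "\<dots> = (\<Sum>j<N. \<Sum>k<N. c j k * fst q ^ j * snd q ^ k)" by (rule sum.swap)
    finally show ?thesis .
  qed
  moreover have "(\<lambda>N. LINT p|M. cnj (P N p) * g p) \<longlonglongrightarrow> (LINT p|M. cnj (?K p) * g p)"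
  proof (rule integral_dominated_convergence[where w="\<lambda>p. B * norm (g p)"])
    show "integrable M (\<lambda>p. B * norm (g p))" using g by simp
    show "AE p in M. (\<lambda>N. cnj (P N p) * g p) \<longlonglongrightarrow> cnj (?K p) * g p"
      using B sp by (intro AE_I2 tendsto_intros) blast
    show "AE p in M. norm (cnj (P N p) * g p) \<le> B * norm (g p)" for N
      using B sp by (intro AE_I2) (auto simp: norm_mult intro!: mult_right_mono)
  qed auto
  ultimately show "(LINT p|M. cnj (?K p) * g p) = L" using lim LIMSEQ_unique by (simp only:) blast
qed

section \<open>Moments over the egg\<close>

lemma distr_lborel_rotate2:
  assumes "cmod c = 1" "cmod d = 1"
  shows "distr lborel lborel (\<lambda>(z, w). (c * z, d * w)) = (lborel :: C2 measure)"
proof -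
  have "distr (lborel \<Otimes>\<^sub>M lborel) (lborel \<Otimes>\<^sub>M lborel) (\<lambda>(z, w). (c * z, d * w))
      = distr lborel lborel ((*) c) \<Otimes>\<^sub>M distr lborel lborel ((*) d)"
    by (rule pair_measure_distr[symmetric]) (auto simp: distr_lborel_rotate[OF assms(2)] sigma_finite_lborel)
  then show ?thesis by (simp only: distr_lborel_rotate[OF assms(1)] distr_lborel_rotate[OF assms(2)] lborel_prod)
qed

text \<open>Averaging over rotations of \<open>z\<close> and then of \<open>w\<close> replaces
  \<open>f\<close> by its single component
  \<open>taylor_coeff f j k * z ^ j * w ^ k\<close>.\<close>

lemma moment_integral:
  assumes m: "m \<ge> 1" and f: "holomorphic2_on f (egg m)" and i: "set_integrable lborel (egg m) f"
  shows "(LINT p:egg m|lborel. cnj (fst p ^ j * snd p ^ k) * f p)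
           = taylor_coeff f j k * (LINT p:egg m|lborel. of_real (cmod (fst p) ^ (2 * j) * cmod (snd p) ^ (2 * k)))"
proof -
  have [measurable]: "egg m \<in> sets borel" using open_egg by simp
  define I where "I = (\<lambda>p. indicator (egg m) p :: complex)"
  have I: "indicator (egg m) p *\<^sub>R c = I p * c" for p c by (simp add: I_def indicator_def)
  have rot: "I (cis s * z, w) = I (z, w)" "I (z, cis s * w) = I (z, w)" for s z w
    by (auto simp: I_def indicator_def egg_def norm_mult)
  have fm [measurable]: "(\<lambda>p. I p * f p) \<in> borel_measurable borel"
    using i unfolding set_integrable_def I by auto
  have cm: "cmod ((cnj (fst p)) ^ j * cnj (snd p) ^ k * (I p * f p)) \<le> cmod (I p * f p)" for p
  proof (cases "p \<in> egg m")
    case True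
    then have "cmod (fst p) < 1" "cmod (snd p) < 1" using egg_cmod_less_1[OF _ m, of "fst p" "snd p"] by auto
    then have "cmod (fst p) ^ j * cmod (snd p) ^ k \<le> 1 * 1" by (intro mult_mono power_le_one) auto
    then have "cmod (fst p) ^ j * cmod (snd p) ^ k * cmod (I p * f p) \<le> 1 * cmod (I p * f p)" by (intro mult_right_mono) auto
    then show ?thesis by (simp add: norm_mult norm_power)
  qed (simp add: I_def)
  define F where "F = (\<lambda>p. cnj (fst p) ^ j * cnj (snd p) ^ k * (I p * f p))"
  have [measurable]: "(\<lambda>p::C2. cnj (fst p)) \<in> borel_measurable borel" "(\<lambda>p::C2. cnj (snd p)) \<in> borel_measurable borel"
    by (intro borel_measurable_continuous_onI continuous_intros)+
  have F: "integrable lborel F"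
    unfolding F_def
    by (rule Bochner_Integration.integrable_bound[OF i[unfolded set_integrable_def I]]) (auto intro!: cm)
  \<comment> \<open>\<open>F1\<close> is, up to constants, what averaging \<open>F\<close> in
    \<open>z\<close> leaves; \<open>F2\<close> is what averaging in \<open>w\<close> as well
    leaves.\<close>
  define F1 where "F1 = (\<lambda>(z, w). I (z, w) * (cnj z ^ j * cnj w ^ k * z ^ j * slice_coeff f j w))"
  define F2 where "F2 = (\<lambda>(z, w). I (z, w) * (cnj z ^ j * cnj w ^ k * z ^ j * w ^ k))"
  have cc: "cnj (cis s) ^ n = cis (- (real n * s))" for s n
    by (simp add: cis_cnj Complex.DeMoivre)
  have T: "(\<lambda>(s, x). case x of (z, w) \<Rightarrow> (cis s * z, w)) \<in> measurable (circle_measure \<Otimes>\<^sub>M lborel) (lborel :: C2 measure)"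
      "(\<lambda>(s, x). case x of (z, w) \<Rightarrow> (z, cis s * w)) \<in> measurable (circle_measure \<Otimes>\<^sub>M lborel) (lborel :: C2 measure)"
  proof -
    have "(\<lambda>t. t) \<in> circle_measure \<rightarrow>\<^sub>M borel" by (rule measurable_circle_measure) simp
    then have id: "(\<lambda>x. (fst x, snd x)) \<in> circle_measure \<Otimes>\<^sub>M (lborel :: C2 measure) \<rightarrow>\<^sub>M borel \<Otimes>\<^sub>M borel"
      by (intro measurable_Pair) (rule measurable_compose[OF measurable_fst], simp, rule measurable_compose[OF measurable_snd], simp)
    have c: "(\<lambda>x::real \<times> C2. (cis (fst x) * fst (snd x), snd (snd x))) \<in> borel_measurable (borel \<Otimes>\<^sub>M borel)"
      "(\<lambda>x::real \<times> C2. (fst (snd x), cis (fst x) * snd (snd x))) \<in> borel_measurable (borel \<Otimes>\<^sub>M borel)"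
      unfolding borel_prod by (rule borel_measurable_continuous_onI, auto intro!: continuous_intros)+
    show "(\<lambda>(s, x). case x of (z, w) \<Rightarrow> (cis s * z, w)) \<in> measurable (circle_measure \<Otimes>\<^sub>M lborel) (lborel :: C2 measure)"
      "(\<lambda>(s, x). case x of (z, w) \<Rightarrow> (z, cis s * w)) \<in> measurable (circle_measure \<Otimes>\<^sub>M lborel) (lborel :: C2 measure)"
      using measurable_compose[OF id c(1)] measurable_compose[OF id c(2)]
      by (simp_all only: case_prod_unfold fst_conv snd_conv measurable_lborel1)
  qed
  note ra1 = rotation_average[OF sigma_finite_lborel finite_measure_circle_measure T(1) _ F]
  have pres: "distr lborel lborel (\<lambda>(z, w). (cis s * z, w)) = (lborel :: C2 measure)"
    "distr lborel lborel (\<lambda>(z, w). (z, cis s * w)) = (lborel :: C2 measure)" for s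
    using distr_lborel_rotate2[of "cis s" 1] distr_lborel_rotate2[of 1 "cis s"] by simp_all
  have in1: "(LINT s|circle_measure. F (case p of (z, w) \<Rightarrow> (cis s * z, w))) = 2 * pi * F1 p" for p
  proof (cases p)
    case (Pair z w)
    have "F (cis s * z, w) = cnj z ^ j * cnj w ^ k * I (z, w) * (f (cis s * z, w) * cis (- (real j * s)))" for s
      unfolding F_def fst_conv snd_conv rot complex_cnj_mult power_mult_distrib cc by (simp only: mult_ac)
    then have "(LINT s|circle_measure. F (cis s * z, w))
       = cnj z ^ j * cnj w ^ k * I (z, w) * (LINT s|circle_measure. f (cis s * z, w) * cis (- (real j * s)))"
      by (simp only: integral_mult_right_zero)
    also have "\<dots> = 2 * pi * F1 (z, w)"
    proof (cases "(z, w) \<in> egg m")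
      case True
      from integral_circle_slice_coeff[OF f m this, of j] show ?thesis by (simp add: F1_def mult_ac)
    qed (simp add: F1_def I_def)
    finally show ?thesis by (simp add: Pair)
  qed
  have i1: "integrable lborel F1"
  proof -
    have "integrable lborel (\<lambda>p. 2 * pi * F1 p)"
      using ra1(1) pres(1) unfolding in1 by blast
    from integrable_mult_right[OF this, of "1 / (2 * pi)"] show ?thesis by simp
  qed
  have e1: "(LINT p|lborel. F1 p) = (LINT p|lborel. F p)"
  proof -
    have "(LINT p|lborel. 2 * pi * F1 p) = (2 * pi) *\<^sub>R (LINT p|lborel. F p)"
      using ra1(2) pres(1) unfolding in1 by simp
    then show ?thesis by (simp add: scaleR_conv_of_real)
  qed
  note ra2 = rotation_average[OF sigma_finite_lborel finite_measure_circle_measure T(2) _ i1]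
  have in2: "(LINT s|circle_measure. F1 (case p of (z, w) \<Rightarrow> (z, cis s * w))) = 2 * pi * taylor_coeff f j k * F2 p" for p
  proof (cases p)
    case (Pair z w)
    have "F1 (z, cis s * w) = cnj z ^ j * cnj w ^ k * z ^ j * I (z, w) * (slice_coeff f j (cis s * w) * cis (- (real k * s)))" for s
      unfolding F1_def prod.case rot complex_cnj_mult power_mult_distrib cc by (simp only: mult_ac)
    then have "(LINT s|circle_measure. F1 (z, cis s * w))
       = cnj z ^ j * cnj w ^ k * z ^ j * I (z, w) * (LINT s|circle_measure. slice_coeff f j (cis s * w) * cis (- (real k * s)))"
      by (simp only: integral_mult_right_zero)
    also have "\<dots> = 2 * pi * taylor_coeff f j k * F2 (z, w)"
    proof (cases "(z, w) \<in> egg m")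
      case True
      from integral_slice_coeff[OF f m egg_cmod_less_1(2)[OF this m], of j k] show ?thesis by (simp add: F2_def mult_ac)
    qed (simp add: F2_def I_def)
    finally show ?thesis by (simp add: Pair)
  qed
  have e2: "(LINT p|lborel. F1 p) = taylor_coeff f j k * (LINT p|lborel. F2 p)"
  proof -
    have "(LINT p|lborel. 2 * pi * taylor_coeff f j k * F2 p) = (2 * pi) *\<^sub>R (LINT p|lborel. F1 p)"
      using ra2(2) pres(2) unfolding in2 by simp
    then show ?thesis by (simp add: scaleR_conv_of_real)
  qed
  have "F2 p = I p * of_real (cmod (fst p) ^ (2 * j) * cmod (snd p) ^ (2 * k))" for p
  proof -
    have "cnj x ^ n * x ^ n = complex_of_real (cmod x ^ (2 * n))" for x n
    proof -
      have "cnj x ^ n * x ^ n = (x * cnj x) ^ n" by (simp add: power_mult_distrib mult.commute)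
      also have "x * cnj x = of_real (cmod x ^ 2)" by (rule complex_norm_square[symmetric])
      also have "of_real (cmod x ^ 2) ^ n = complex_of_real (cmod x ^ (2 * n))" by (simp add: power_mult)
      finally show ?thesis .
    qed
    then have "cnj (fst p) ^ j * fst p ^ j * (cnj (snd p) ^ k * snd p ^ k) = of_real (cmod (fst p) ^ (2 * j) * cmod (snd p) ^ (2 * k))"
      by simp
    then show ?thesis by (simp add: F2_def case_prod_unfold mult_ac)
  qed
  then show ?thesis using e1 e2 unfolding set_lebesgue_integral_def I F_def by (simp add: mult_ac)
qed

lemma nn_integral_power_Icc:
  assumes "x \<ge> 0"
  shows "(\<integral>\<^sup>+t. ennreal (t ^ j) * indicator {0..x} t \<partial>lborel) = ennreal (x ^ Suc j / Suc j)"
proof -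
  have "(\<integral>\<^sup>+t. ennreal (t ^ j) * indicator {0..x} t \<partial>lborel) = ennreal (x ^ Suc j / Suc j - 0 ^ Suc j / Suc j)"
  proof (rule nn_integral_FTC_Icc[where F="\<lambda>t. t ^ Suc j / Suc j"])
    fix t :: real assume t: "t \<in> {0..x}"
    show "((\<lambda>t. t ^ Suc j / Suc j) has_real_derivative t ^ j) (at t)"
      by (rule DERIV_cong[OF DERIV_cdivide[OF DERIV_pow]]) simp
  qed (use assms in auto)
  then show ?thesis by simp
qed

lemma borel_measurable_monomial:
  "(\<lambda>p::C2. cmod (fst p) ^ a * cmod (snd p) ^ b) \<in> borel_measurable borel"
  by (intro borel_measurable_continuous_onI continuous_intros)

text \<open>The fibre over \<open>w\<close> is a disc of squared radius
  \<open>1 - cmod w ^ (2 * m)\<close>. Radial integration over it, and then over \<open>w\<close>,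
  leaves a beta integral with parameter \<open>(k + 1) / m\<close>.\<close>

lemma nn_integral_monomial_egg:
  assumes m: "m \<ge> 1"
  shows "(\<integral>\<^sup>+p. ennreal (cmod (fst p) ^ (2 * j) * cmod (snd p) ^ (2 * k)) * indicator (egg m) p \<partial>lborel)
     = ennreal (pi^2 * fact j / (m * pochhammer ((k + 1) / m) (j + 2)))"
proof -
  have [measurable]: "egg m \<in> sets borel" using open_egg by simp
  define c where "c = (real k + 1) / m"
  have c: "c > 0" using m by (simp add: c_def)
  define H where "H = (\<lambda>z w. ennreal (cmod z ^ (2 * j) * cmod w ^ (2 * k)) * indicator (egg m) (z, w))"
  have "(\<integral>\<^sup>+p. ennreal (cmod (fst p) ^ (2 * j) * cmod (snd p) ^ (2 * k)) * indicator (egg m) p \<partial>lborel)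
      = (\<integral>\<^sup>+w. \<integral>\<^sup>+z. H z w \<partial>lborel \<partial>lborel)"
  proof -
    have "(\<lambda>p. ennreal (cmod (fst p) ^ (2 * j) * cmod (snd p) ^ (2 * k)) * indicator (egg m) p) \<in> borel_measurable (borel :: C2 measure)"
      by (intro borel_measurable_times_ennreal measurable_compose[OF borel_measurable_monomial measurable_ennreal] borel_measurable_indicator) fact
    then have "(\<lambda>p. ennreal (cmod (fst p) ^ (2 * j) * cmod (snd p) ^ (2 * k)) * indicator (egg m) p)
        \<in> borel_measurable ((lborel :: complex measure) \<Otimes>\<^sub>M lborel)"
      by (simp only: lborel_prod measurable_lborel2)
    from lborel_pair.nn_integral_snd[OF this] show ?thesis
      by (simp only: lborel_prod fst_conv snd_conv H_def)
  qed
  also have "\<dots> = (\<integral>\<^sup>+w. ennreal ((cmod w ^ 2) ^ k * (pi * ((1 - (cmod w ^ 2) ^ m) ^ Suc j / Suc j))) * indicator (ball 0 1) w \<partial>lborel)"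
  proof (rule nn_integral_cong)
    fix w :: complex
    show "(\<integral>\<^sup>+z. H z w \<partial>lborel) = ennreal ((cmod w ^ 2) ^ k * (pi * ((1 - (cmod w ^ 2) ^ m) ^ Suc j / Suc j))) * indicator (ball 0 1) w"
    proof (cases "cmod w < 1")
      case True
      have lt: "(cmod w ^ 2) ^ m < 1" using True m by (simp add: power_less_one_iff flip: power_mult)
      define R where "R = sqrt (1 - (cmod w ^ 2) ^ m)"
      have R: "R > 0" "R^2 = 1 - (cmod w ^ 2) ^ m" using lt by (auto simp: R_def)
      have "(z, w) \<in> egg m \<longleftrightarrow> z \<in> ball 0 R" for z
      proof -
        have "z \<in> ball 0 R \<longleftrightarrow> cmod z ^ 2 < R ^ 2" using R(1) by (auto simp: power_strict_mono dest: power_less_imp_less_base)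
        also have "\<dots> \<longleftrightarrow> (z, w) \<in> egg m" unfolding R by (auto simp: egg_def power_mult)
        finally show ?thesis by simp
      qed
      then have ind: "indicator (egg m) (z, w) = (indicator (ball 0 R) z :: ennreal)" for z
        by (simp add: indicator_def)
      have "H z w = ennreal ((cmod w ^ 2) ^ k) * (ennreal ((cmod z ^ 2) ^ j) * indicator (ball 0 R) z)" for z
      proof -
        have "H z w = ennreal ((cmod z ^ 2) ^ j * (cmod w ^ 2) ^ k) * indicator (ball 0 R) z"
          by (simp only: H_def power_mult ind)
        also have "ennreal ((cmod z ^ 2) ^ j * (cmod w ^ 2) ^ k) = ennreal ((cmod z ^ 2) ^ j) * ennreal ((cmod w ^ 2) ^ k)"
          by (rule ennreal_mult) simp_all
        finally show ?thesis by (simp only: mult_ac)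
      qed
      then have "(\<integral>\<^sup>+z. H z w \<partial>lborel) = ennreal ((cmod w ^ 2) ^ k) * (\<integral>\<^sup>+z. ennreal ((cmod z ^ 2) ^ j) * indicator (ball 0 R) z \<partial>lborel)"
      proof -
        assume H: "\<And>z. H z w = ennreal ((cmod w ^ 2) ^ k) * (ennreal ((cmod z ^ 2) ^ j) * indicator (ball 0 R) z)"
        have "(\<lambda>z::complex. (cmod z ^ 2) ^ j) \<in> borel_measurable lborel" by measurable
        from measurable_compose[OF this measurable_ennreal]
        have "(\<lambda>z. ennreal ((cmod z ^ 2) ^ j) * indicator (ball 0 R) z) \<in> borel_measurable lborel"
          by (rule borel_measurable_times_ennreal) (rule borel_measurable_indicator, simp)
        then show ?thesis unfolding H by (rule nn_integral_cmult)
      qed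
      also have "(\<integral>\<^sup>+z. ennreal ((cmod z ^ 2) ^ j) * indicator (ball 0 R) z \<partial>lborel)
          = ennreal pi * (\<integral>\<^sup>+t. ennreal (t ^ j) * indicator {0..R^2} t \<partial>lborel)"
        using R by (intro nn_integral_radial) auto
      also have "\<dots> = ennreal pi * ennreal ((1 - (cmod w ^ 2) ^ m) ^ Suc j / Suc j)"
        using lt by (subst nn_integral_power_Icc) (simp_all add: R)
      finally have "(\<integral>\<^sup>+z. H z w \<partial>lborel) = ennreal ((cmod w ^ 2) ^ k * (pi * ((1 - (cmod w ^ 2) ^ m) ^ Suc j / Suc j)))"
        by (subst ennreal_mult', simp, subst ennreal_mult', simp)
      then show ?thesis using True by (simp only: indicator_simps mem_ball dist_0_norm mult_1_right)
    next
      case False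
      then have "H z w = 0" for z using egg_cmod_less_1[OF _ m] by (auto simp: H_def indicator_def)
      then show ?thesis using False by simp
    qed
  qed
  also have "\<dots> = ennreal pi * (\<integral>\<^sup>+t. ennreal (t ^ k * (pi * ((1 - t ^ m) ^ Suc j / Suc j))) * indicator {0..1^2} t \<partial>lborel)"
    by (rule nn_integral_radial[where h="\<lambda>t. ennreal (t ^ k * (pi * ((1 - t ^ m) ^ Suc j / Suc j)))"]) (auto simp del: power_Suc)
  also have "(\<integral>\<^sup>+t. ennreal (t ^ k * (pi * ((1 - t ^ m) ^ Suc j / Suc j))) * indicator {0..1^2} t \<partial>lborel)
      = (\<integral>\<^sup>+t. ennreal (pi / Suc j) * (ennreal ((1 - t ^ m) ^ Suc j * t powr (m * c - 1)) * indicator {0..1} t) \<partial>lborel)"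
  proof (rule nn_integral_cong_AE)
    \<comment> \<open>At \<open>t = 0\<close> the integrands may differ, since
      \<open>0 powr 0 = 0\<close> whereas \<open>0 ^ 0 = 1\<close>.\<close>
    have "AE t in lborel. t \<noteq> (0::real)" by (rule AE_lborel_singleton)
    then show "AE t in lborel. ennreal (t ^ k * (pi * ((1 - t ^ m) ^ Suc j / Suc j))) * indicator {0..1^2} t
       = ennreal (pi / Suc j) * (ennreal ((1 - t ^ m) ^ Suc j * t powr (m * c - 1)) * indicator {0..1} t)"
    proof eventually_elim
      case (elim t)
      show ?case
      proof (cases "t \<in> {0..1}")
        case True
        then have "t > 0" using elim by auto
        then have "t powr (m * c - 1) = t ^ k" using m by (simp add: c_def powr_realpow)
        moreover have "ennreal (pi / Suc j) * ennreal ((1 - t ^ m) ^ Suc j * t ^ k) = ennreal (pi / Suc j * ((1 - t ^ m) ^ Suc j * t ^ k))"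
          using True by (subst ennreal_mult) (auto simp: power_le_one simp del: power_Suc)
        ultimately show ?thesis using True by (simp add: mult_ac del: power_Suc)
      qed simp
    qed
  qed
  also have "\<dots> = ennreal (pi / Suc j) * ennreal (fact (Suc j) / (m * pochhammer c (Suc (Suc j))))"
    by (subst nn_integral_cmult) (auto simp: nn_integral_beta_power[OF m c] simp del: power_Suc)
  also have "ennreal pi * (ennreal (pi / Suc j) * ennreal (fact (Suc j) / (m * pochhammer c (Suc (Suc j)))))
      = ennreal (pi * (pi / Suc j * (fact (Suc j) / (m * pochhammer c (Suc (Suc j))))))"
    using c pochhammer_pos[OF c, of "Suc (Suc j)"]
    by (subst ennreal_mult[symmetric], simp, simp del: fact_Suc pochhammer_Suc)+ simp
  also have "pi * (pi / Suc j * (fact (Suc j) / (m * pochhammer c (Suc (Suc j))))) = pi^2 * fact j / (m * pochhammer c (j + 2))"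
    by (simp add: power2_eq_square del: pochhammer_Suc of_nat_Suc)
  finally show ?thesis by (simp add: c_def)
qed

text \<open>Origin of the Bergman parameters. With \<open>c = (k + 1) / m\<close> the reciprocal
  moment is \<open>m / pi^2 * c * (c + 1) * pochhammer (c + 2) j / fact j\<close>; here
  \<open>c + 2 = 2 + 1 / m + k / m\<close>, and \<open>m * c * (c + 1)\<close> equals
  \<open>((m - 1) * (k + 1) + (k + 1) * (k + 2)) / m\<close>.\<close>

lemma bergman_moment:
  assumes m: "m \<ge> 1"
  shows "(LINT p:egg m|lborel. complex_of_real (cmod (fst p) ^ (2 * j) * cmod (snd p) ^ (2 * k)))
    = 1 / of_real (egg_coeff m (2 + 1 / m) 0 ((real m - 1) / (m * pi^2)) (1 / (m * pi^2)) j k)"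
proof -
  have [measurable]: "egg m \<in> sets borel" using open_egg by simp
  define c where "c = (real k + 1) / m"
  have c: "c > 0" using m by (simp add: c_def)
  have p0: "pochhammer c (j + 2) > 0" using c by (rule pochhammer_pos)
  have "(LINT p|lborel. cmod (fst p) ^ (2 * j) * cmod (snd p) ^ (2 * k) * indicator (egg m) p)
      = enn2real (\<integral>\<^sup>+p. ennreal (cmod (fst p) ^ (2 * j) * cmod (snd p) ^ (2 * k) * indicator (egg m) p) \<partial>lborel)"
  proof (rule integral_eq_nn_integral)
    show "(\<lambda>p::C2. cmod (fst p) ^ (2 * j) * cmod (snd p) ^ (2 * k) * indicator (egg m) p) \<in> borel_measurable lborel"
      unfolding measurable_lborel2
      by (intro borel_measurable_times borel_measurable_monomial borel_measurable_indicator) fact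
  qed (rule AE_I2, simp)
  also have "(\<integral>\<^sup>+p. ennreal (cmod (fst p) ^ (2 * j) * cmod (snd p) ^ (2 * k) * indicator (egg m) p) \<partial>lborel)
      = (\<integral>\<^sup>+p. ennreal (cmod (fst p) ^ (2 * j) * cmod (snd p) ^ (2 * k)) * indicator (egg m) p \<partial>lborel)"
    by (intro nn_integral_cong) (simp add: indicator_def)
  also have "enn2real \<dots> = pi^2 * fact j / (m * pochhammer c (j + 2))"
    unfolding nn_integral_monomial_egg[OF m] using p0 by (simp add: c_def)
  also have "\<dots> = 1 / egg_coeff m (2 + 1 / m) 0 ((real m - 1) / (m * pi^2)) (1 / (m * pi^2)) j k"
  proof -
    have p: "pochhammer c (j + 2) = c * ((c + 1) * pochhammer (c + 2) j)"
      using pochhammer_rec[of c "Suc j"] pochhammer_rec[of "c + 1" j] by (simp add: add.assoc del: pochhammer_Suc)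
    have e: "2 + 1 / real m + real k / real m = c + 2" by (simp add: c_def add_divide_distrib)
    have a: "0 + (real m - 1) / (m * pi^2) * (real k + 1) + 1 / (m * pi^2) * (real k + 1) * (real k + 2) = m / pi^2 * (c * (c + 1))"
      using m by (simp add: c_def of_nat_diff divide_simps power2_eq_square) (simp add: algebra_simps)
    show ?thesis unfolding egg_coeff_def p e a by simp
  qed
  finally have "(LINT p|lborel. cmod (fst p) ^ (2 * j) * cmod (snd p) ^ (2 * k) * indicator (egg m) p)
      = 1 / egg_coeff m (2 + 1 / m) 0 ((real m - 1) / (m * pi^2)) (1 / (m * pi^2)) j k" .
  moreover have "(LINT p:egg m|lborel. complex_of_real (cmod (fst p) ^ (2 * j) * cmod (snd p) ^ (2 * k)))
     = (LINT p|lborel. complex_of_real (cmod (fst p) ^ (2 * j) * cmod (snd p) ^ (2 * k) * indicator (egg m) p))"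
    unfolding set_lebesgue_integral_def by (intro Bochner_Integration.integral_cong) (auto simp: indicator_def)
  ultimately show ?thesis by (simp only: integral_complex_of_real) simp
qed

lemma set_integrable_bounded_continuous:
  fixes h :: "'a::euclidean_space \<Rightarrow> real"
  assumes S: "open S" "emeasure lborel S < \<infinity>" and h: "continuous_on S h"
    and B: "\<And>p. p \<in> S \<Longrightarrow> norm (h p) \<le> B"
  shows "set_integrable lborel S h"
  unfolding set_integrable_def
proof (rule Bochner_Integration.integrable_bound)
  have "S \<in> sets borel" using S by simp
  then show "integrable lborel (\<lambda>p. B * indicator S p)"
    using S(2) by (intro integrable_mult_right integrable_real_indicator) simp_all
  have "(\<lambda>p. indicator S p *\<^sub>R h p) \<in> borel_measurable borel"
    using h by (rule borel_measurable_continuous_on_indicator[rotated]) fact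
  then show "(\<lambda>p. indicator S p *\<^sub>R h p) \<in> borel_measurable lborel" by (simp only: measurable_lborel2)
  show "AE p in lborel. norm (indicator S p *\<^sub>R h p) \<le> norm (B * indicator S p)"
  proof (rule AE_I2)
    fix p show "norm (indicator S p *\<^sub>R h p) \<le> norm (B * indicator S p)"
      using B[of p] by (cases "p \<in> S") auto
  qed
qed

abbreviation bergman_formula :: "nat \<Rightarrow> C2 \<Rightarrow> C2 \<Rightarrow> complex" where
  "bergman_formula m \<equiv> egg_kernel2 m (2 + 1 / m) 0 ((real m - 1) / (m * pi^2)) (1 / (m * pi^2))"

text \<open>The egg has finite volume, so square-integrable functions are integrable and
  \<open>moment_integral\<close> applies to them; the kernel functions lie in the space because they
  are bounded.\<close>

lemma is_bergman_kernel_formula: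
  assumes m: "m \<ge> 1"
  shows "is_bergman_kernel (egg m) (bergman_formula m)"
  unfolding is_bergman_kernel_def
proof (intro ballI conjI)
  have em [measurable]: "egg m \<in> sets borel" using open_egg by simp
  have fin: "emeasure lborel (egg m) < \<infinity>"
    using bounded_subset[OF compact_imp_bounded[OF compact_cegg[OF m]] egg_subset_cegg]
    by (rule emeasure_bounded_finite)
  have A: "2 + 1 / real m > 0" "(0::real) \<ge> 0" "(real m - 1) / (m * pi^2) \<ge> 0" "1 / (m * pi^2) \<ge> 0"
      "0 + (real m - 1) / (m * pi^2) + 1 / (m * pi^2) > 0"
  proof -
    have a: "1 / (m * pi^2) > 0" "(real m - 1) / (m * pi^2) \<ge> 0" using m by simp_all
    show "2 + 1 / real m > 0" by (simp add: add_pos_nonneg)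
    show "(0::real) \<ge> 0" by simp
    show "(real m - 1) / (m * pi^2) \<ge> 0" "1 / (m * pi^2) \<ge> 0" using a by linarith+
    show "0 + (real m - 1) / (m * pi^2) + 1 / (m * pi^2) > 0" using a by linarith
  qed
  fix q assume q: "q \<in> egg m"
  show "(\<lambda>p. bergman_formula m p q) \<in> bergman_space (egg m)"
    unfolding bergman_space_def
  proof (intro CollectI conjI)
    show hol: "holomorphic2_on (\<lambda>p. bergman_formula m p q) (egg m)"
      by (rule holomorphic2_on_egg_kernel2[OF q m])
    obtain B where B: "\<forall>p\<in>cegg m. cmod (bergman_formula m p q) \<le> B"
      using egg_kernel2_partial_sums[OF q m A(1-4)] by blast
    have "continuous_on (egg m) (\<lambda>p. cmod (bergman_formula m p q) ^ 2)"
      by (intro continuous_on_power continuous_on_norm holomorphic2_on_imp_continuous_on[OF hol])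
    then show "set_integrable lborel (egg m) (\<lambda>p. cmod (bergman_formula m p q) ^ 2)"
    proof (rule set_integrable_bounded_continuous[OF open_egg fin])
      fix p assume "p \<in> egg m"
      then show "norm (cmod (bergman_formula m p q) ^ 2) \<le> B ^ 2"
        using B egg_subset_cegg by (auto intro!: power_mono)
    qed
  qed
  fix f assume "f \<in> bergman_space (egg m)"
  then have f: "holomorphic2_on f (egg m)" and f2: "set_integrable lborel (egg m) (\<lambda>p. cmod (f p) ^ 2)"
    by (auto simp: bergman_space_def)
  have fm: "(\<lambda>p. indicator (egg m) p *\<^sub>R f p) \<in> borel_measurable borel"
    using holomorphic2_on_imp_continuous_on[OF f] by (intro borel_measurable_continuous_on_indicator) auto
  have fi: "set_integrable lborel (egg m) f"
    unfolding set_integrable_def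
  proof (rule Bochner_Integration.integrable_bound)
    have "integrable lborel (\<lambda>p. indicator (egg m) p *\<^sub>R (1::real))"
      using fin by (simp add: integrable_real_indicator)
    then show "integrable lborel (\<lambda>p. indicator (egg m) p *\<^sub>R (1::real) + indicator (egg m) p *\<^sub>R (cmod (f p) ^ 2))"
      using f2 unfolding set_integrable_def by (rule Bochner_Integration.integrable_add)
    have "x \<le> 1 + x^2" for x :: real using zero_le_power2[of "x - 1/2"] by (simp add: power2_eq_square algebra_simps)
    then show "AE p in lborel. norm (indicator (egg m) p *\<^sub>R f p) \<le> norm (indicator (egg m) p *\<^sub>R (1::real) + indicator (egg m) p *\<^sub>R (cmod (f p) ^ 2))"
      by (intro AE_I2) (auto simp: indicator_def)
  qed (simp only: measurable_lborel2 fm)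
  define M where "M = restrict_space lborel (egg m)"
  have LM: "(LINT p|M. h p) = (LINT p:egg m|lborel. h p)" for h :: "C2 \<Rightarrow> complex"
    unfolding M_def set_lebesgue_integral_def by (subst integral_restrict_space) auto
  have "(LINT p|M. cnj (bergman_formula m p q) * f p) = f q"
  proof (rule integral_kernel_eq_limit(1)[OF q m A])
    show "space M \<subseteq> cegg m" using egg_subset_cegg by (auto simp: M_def)
    show "(\<lambda>p. p) \<in> measurable M borel" by (simp add: M_def measurable_restrict_space1)
    show "integrable M f" using fi by (simp add: M_def integrable_restrict_space set_integrable_def)
    show "(LINT p|M. cnj (fst p ^ j * snd p ^ k) * f p)
        = taylor_coeff f j k / of_real (egg_coeff m (2 + 1 / m) 0 ((real m - 1) / (m * pi^2)) (1 / (m * pi^2)) j k)" for j k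
      unfolding LM moment_integral[OF m f fi] bergman_moment[OF m] by simp
    show "(\<lambda>N. \<Sum>j<N. \<Sum>k<N. taylor_coeff f j k * fst q ^ j * snd q ^ k) \<longlonglongrightarrow> f q"
      using taylor_partial_sums_tendsto[OF f m, of "fst q" "snd q"] q by simp
  qed
  then show "f q = (LINT p:egg m|lborel. cnj (bergman_formula m p q) * f p)" by (simp add: LM)
qed

text \<open>\<open>bergman_kernel\<close> is a choice among functions with the reproducing property;
  letting it and the closed form reproduce each other at \<open>q\<close> shows that the two
  diagonal values are conjugate. The conjugate is harmless, since the closed form is real on the
  diagonal by \<open>egg_kernel2_diagonal\<close>.\<close>

lemma bergman_kernel_eq:
  assumes m: "m \<ge> 1" and q: "q \<in> egg m"
  shows "bergman_kernel (egg m) q q = cnj (bergman_formula m q q)"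
proof -
  let ?K = "bergman_kernel (egg m)" and ?B = "bergman_formula m"
  have B: "is_bergman_kernel (egg m) ?B" by (rule is_bergman_kernel_formula[OF m])
  have K: "is_bergman_kernel (egg m) ?K" unfolding bergman_kernel_def
    by (rule someI[of "is_bergman_kernel (egg m)", OF B])
  have k: "(\<lambda>p. ?K p q) \<in> bergman_space (egg m)" "(\<lambda>p. ?B p q) \<in> bergman_space (egg m)"
    and r: "\<forall>f\<in>bergman_space (egg m). f q = (LINT p:egg m|lborel. cnj (?K p q) * f p)"
      "\<forall>f\<in>bergman_space (egg m). f q = (LINT p:egg m|lborel. cnj (?B p q) * f p)"
    using B K q unfolding is_bergman_kernel_def by blast+
  have "?K q q = (LINT p:egg m|lborel. cnj (?B p q) * ?K p q)"
    using bspec[OF r(2) k(1)] .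
  also have "\<dots> = cnj (LINT p:egg m|lborel. cnj (?K p q) * ?B p q)"
    unfolding set_lebesgue_integral_def Bochner_Integration.integral_cnj[symmetric]
    by (intro Bochner_Integration.integral_cong) (auto simp: mult.commute)
  also have "(LINT p:egg m|lborel. cnj (?K p q) * ?B p q) = ?B q q"
    using bspec[OF r(1) k(2)] by simp
  finally show ?thesis .
qed

section \<open>Wirtinger derivatives of functions of the radii\<close>

lemma partial_dir_cong:
  assumes "eventually (\<lambda>q. f q = g q) (nhds p)"
  shows "partial_dir v f p = partial_dir v g p"
proof -
  have "filterlim (\<lambda>t::real. p + t *\<^sub>R v) (nhds (p + 0 *\<^sub>R v)) (nhds 0)"
    by (auto intro!: tendsto_eq_intros filterlim_ident)
  then have "filterlim (\<lambda>t::real. p + t *\<^sub>R v) (nhds p) (nhds 0)" by simp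
  from eventually_compose_filterlim[OF assms this]
  have "eventually (\<lambda>t::real. f (p + t *\<^sub>R v) = g (p + t *\<^sub>R v)) (nhds 0)" .
  then show ?thesis unfolding partial_dir_def by (intro vector_derivative_cong_eq) auto
qed

lemma wirt_cong:
  assumes "eventually (\<lambda>q. f q = g q) (nhds p)"
  shows "wirt j f p = wirt j g p" "wirt_bar j f p = wirt_bar j g p"
  unfolding wirt_def wirt_bar_def by (simp_all add: partial_dir_cong[OF assms])

text \<open>The outer derivative requires agreement of the inner ones on a neighbourhood; this
  follows because a property that holds near \<open>p\<close> also holds near every point close to
  \<open>p\<close>.\<close>

lemma complex_hessian_cong:
  assumes "eventually (\<lambda>q. f q = g q) (nhds p)"
  shows "complex_hessian f p = complex_hessian g p"
proof -
  have "eventually (\<lambda>q. wirt_bar j f q = wirt_bar j g q) (nhds p)" for j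
  proof -
    have "eventually (\<lambda>q. eventually (\<lambda>q. f q = g q) (nhds q)) (nhds p)"
      using assms by (simp only: eventually_eventually)
    then show ?thesis by eventually_elim (rule wirt_cong)
  qed
  from wirt_cong(1)[OF this] show ?thesis by (simp add: complex_hessian_def)
qed

lemma partial_dir_eq:
  assumes "(f has_derivative f') (at p)"
  shows "partial_dir v f p = f' v"
proof -
  interpret bounded_linear f' using assms by (rule has_derivative_bounded_linear)
  have "((\<lambda>t::real. p + t *\<^sub>R v) has_derivative (\<lambda>t. t *\<^sub>R v)) (at 0)"
    by (auto intro!: derivative_eq_intros)
  moreover have "(f has_derivative f') (at (p + 0 *\<^sub>R v))" using assms by simp
  ultimately have "((\<lambda>t. f (p + t *\<^sub>R v)) has_derivative (\<lambda>t. f' (t *\<^sub>R v))) (at 0)"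
    by (rule has_derivative_compose)
  then have "((\<lambda>t. f (p + t *\<^sub>R v)) has_vector_derivative f' v) (at 0)"
    by (simp add: has_vector_derivative_def scaleR)
  then show ?thesis unfolding partial_dir_def by (rule vector_derivative_at)
qed

text \<open>Squared moduli, so that the map is smooth across the axes, in particular at
  \<open>z = 0\<close>.\<close>

definition radii :: "C2 \<Rightarrow> real \<times> real" where
  "radii q = (cmod (fst q) ^ 2, cmod (snd q) ^ 2)"

lemma continuous_radii: "isCont radii p"
  unfolding radii_def by (intro continuous_intros)

lemma has_derivative_radii:
  "(radii has_derivative (\<lambda>h. (2 * Re (cnj (fst p) * fst h), 2 * Re (cnj (snd p) * snd h)))) (at p)"
proof -
  have eq: "radii = (\<lambda>q. (fst q \<bullet> fst q, snd q \<bullet> snd q))"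
    by (simp add: fun_eq_iff radii_def power2_norm_eq_inner)
  show ?thesis unfolding eq
    by (auto intro!: derivative_eq_intros simp: fun_eq_iff inner_complex_def)
qed

lemma has_derivative_radial:
  assumes "(\<phi> has_derivative \<phi>') (at (radii p))"
  shows "((\<lambda>q. complex_of_real (\<phi> (radii q))) has_derivative
    (\<lambda>h. of_real (2 * Re (cnj (fst p) * fst h) * \<phi>' (1, 0) + 2 * Re (cnj (snd p) * snd h) * \<phi>' (0, 1)))) (at p)"
proof -
  interpret bounded_linear \<phi>' using assms by (rule has_derivative_bounded_linear)
  have l: "\<phi>' (a, b) = a * \<phi>' (1, 0) + b * \<phi>' (0, 1)" for a b
    using add[of "(a, 0)" "(0, b)"] scaleR[of a "(1, 0)"] scaleR[of b "(0, 1)"] by simp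
  have "((\<lambda>q. \<phi> (radii q)) has_derivative
      (\<lambda>h. \<phi>' (2 * Re (cnj (fst p) * fst h), 2 * Re (cnj (snd p) * snd h)))) (at p)"
    using has_derivative_compose[OF has_derivative_radii assms] .
  then show ?thesis unfolding l[of "2 * Re _"] by (rule has_derivative_of_real)
qed

lemma wirt_radial:
  assumes "(\<phi> has_derivative \<phi>') (at (radii p))"
  shows "wirt_bar 1 (\<lambda>q. of_real (\<phi> (radii q))) p = of_real (\<phi>' (1, 0)) * fst p"
    and "wirt_bar 2 (\<lambda>q. of_real (\<phi> (radii q))) p = of_real (\<phi>' (0, 1)) * snd p"
    and "wirt 1 (\<lambda>q. of_real (\<phi> (radii q))) p = of_real (\<phi>' (1, 0)) * cnj (fst p)"
    and "wirt 2 (\<lambda>q. of_real (\<phi> (radii q))) p = of_real (\<phi>' (0, 1)) * cnj (snd p)"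
  unfolding wirt_bar_def wirt_def partial_dir_eq[OF has_derivative_radial[OF assms]] cvec_def
  by (simp_all add: complex_eq_iff)

text \<open>By \<open>wirt_radial\<close>, \<open>wirt_bar\<close> of a radial function is a radial
  function times a coordinate; such products are what the second derivative acts on.\<close>

lemma wirt_radial_mult:
  assumes "(\<phi> has_derivative \<phi>') (at (radii p))"
  shows "wirt 1 (\<lambda>q. of_real (\<phi> (radii q)) * fst q) p = of_real (\<phi> (radii p) + \<phi>' (1, 0) * cmod (fst p) ^ 2)"
    and "wirt 2 (\<lambda>q. of_real (\<phi> (radii q)) * fst q) p = of_real (\<phi>' (0, 1)) * cnj (snd p) * fst p"
    and "wirt 1 (\<lambda>q. of_real (\<phi> (radii q)) * snd q) p = of_real (\<phi>' (1, 0)) * cnj (fst p) * snd p"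
    and "wirt 2 (\<lambda>q. of_real (\<phi> (radii q)) * snd q) p = of_real (\<phi> (radii p) + \<phi>' (0, 1) * cmod (snd p) ^ 2)"
proof -
  note d = has_derivative_mult[OF has_derivative_radial[OF assms] has_derivative_fst[OF has_derivative_ident]]
    has_derivative_mult[OF has_derivative_radial[OF assms] has_derivative_snd[OF has_derivative_ident]]
  show "wirt 1 (\<lambda>q. of_real (\<phi> (radii q)) * fst q) p = of_real (\<phi> (radii p) + \<phi>' (1, 0) * cmod (fst p) ^ 2)"
    "wirt 2 (\<lambda>q. of_real (\<phi> (radii q)) * fst q) p = of_real (\<phi>' (0, 1)) * cnj (snd p) * fst p"
    "wirt 1 (\<lambda>q. of_real (\<phi> (radii q)) * snd q) p = of_real (\<phi>' (1, 0)) * cnj (fst p) * snd p"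
    "wirt 2 (\<lambda>q. of_real (\<phi> (radii q)) * snd q) p = of_real (\<phi> (radii p) + \<phi>' (0, 1) * cmod (snd p) ^ 2)"
    unfolding wirt_def partial_dir_eq[OF d(1)] partial_dir_eq[OF d(2)] cvec_def
    by (simp_all add: complex_eq_iff cmod_power2 algebra_simps) (simp_all add: field_simps power2_eq_square)
qed

text \<open>The complex Hessian of a radial function has entries
  \<open>\<psi>_ij * cnj z_i * z_j\<close>, plus \<open>\<psi>_i\<close> on the diagonal, with
  subscripts for derivatives in the squared radii. The gradient must be known on a neighbourhood
  because it is differentiated again.\<close>

lemma wirt_wirt_bar_radial:
  assumes "eventually (\<lambda>r. (\<psi> has_derivative (\<lambda>h. \<psi>1 r * fst h + \<psi>2 r * snd h)) (at r)) (nhds (radii p))"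
    and d1: "(\<psi>1 has_derivative D1) (at (radii p))" and d2: "(\<psi>2 has_derivative D2) (at (radii p))"
  defines "f \<equiv> \<lambda>q. complex_of_real (\<psi> (radii q))"
  shows "wirt 1 (wirt_bar 1 f) p = of_real (\<psi>1 (radii p) + D1 (1, 0) * cmod (fst p) ^ 2)"
    and "wirt 2 (wirt_bar 1 f) p = of_real (D1 (0, 1)) * cnj (snd p) * fst p"
    and "wirt 1 (wirt_bar 2 f) p = of_real (D2 (1, 0)) * cnj (fst p) * snd p"
    and "wirt 2 (wirt_bar 2 f) p = of_real (\<psi>2 (radii p) + D2 (0, 1) * cmod (snd p) ^ 2)"
proof -
  have ev: "eventually (\<lambda>q. (\<psi> has_derivative (\<lambda>h. \<psi>1 (radii q) * fst h + \<psi>2 (radii q) * snd h)) (at (radii q))) (nhds p)"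
    using continuous_radii[of p] unfolding continuous_at tendsto_at_iff_tendsto_nhds
    by (rule eventually_compose_filterlim[OF assms(1)])
  have e1: "eventually (\<lambda>q. wirt_bar 1 f q = of_real (\<psi>1 (radii q)) * fst q) (nhds p)"
    using ev by eventually_elim (simp add: f_def wirt_radial)
  have e2: "eventually (\<lambda>q. wirt_bar 2 f q = of_real (\<psi>2 (radii q)) * snd q) (nhds p)"
    using ev by eventually_elim (simp add: f_def wirt_radial)
  show "wirt 1 (wirt_bar 1 f) p = of_real (\<psi>1 (radii p) + D1 (1, 0) * cmod (fst p) ^ 2)"
    "wirt 2 (wirt_bar 1 f) p = of_real (D1 (0, 1)) * cnj (snd p) * fst p"
    using wirt_cong(1)[OF e1] wirt_radial_mult[OF d1] by simp_all
  show "wirt 1 (wirt_bar 2 f) p = of_real (D2 (1, 0)) * cnj (fst p) * snd p"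
    "wirt 2 (wirt_bar 2 f) p = of_real (\<psi>2 (radii p) + D2 (0, 1) * cmod (snd p) ^ 2)"
    using wirt_cong(1)[OF e2] wirt_radial_mult[OF d2] by simp_all
qed

text \<open>On the boundary the corner entry of the bordered determinant vanishes, and with
  \<open>t = cmod (snd p) ^ 2\<close> expansion gives
  \<open>- m^2 * t ^ (m - 1) * (cmod (fst p) ^ 2 + t ^ m)\<close>, whose last factor is 1.\<close>

lemma fefferman_weight_eq:
  assumes "rho m p = 0" "m \<ge> 1"
  shows "fefferman_weight m p = root 3 (m^2 * cmod (snd p) ^ (2 * m - 2)) / sqrt (cmod (fst p)^2 + m^2 * cmod (snd p) ^ (4 * m - 2))"
proof -
  define \<psi> where "\<psi> = (\<lambda>r::real\<times>real. fst r + snd r ^ m - 1)"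
  define r where "r = (\<lambda>q. complex_of_real (rho m q))"
  have r: "r = (\<lambda>q. of_real (\<psi> (radii q)))"
    by (simp add: fun_eq_iff r_def \<psi>_def radii_def rho_def flip: power_mult)
  define t where "t = cmod (snd p) ^ 2"
  define b where "b = m * t ^ (m - 1)"
  have d: "(\<psi> has_derivative (\<lambda>h. 1 * fst h + (real m * snd s ^ (m - 1)) * snd h)) (at s)" for s :: "real \<times> real"
    unfolding \<psi>_def by (auto intro!: derivative_eq_intros simp: fun_eq_iff)
  have d1: "((\<lambda>_::real\<times>real. 1::real) has_derivative (\<lambda>_. 0)) (at (radii p))" by simp
  have d2: "((\<lambda>s::real\<times>real. real m * snd s ^ (m - 1)) has_derivative (\<lambda>h. m * (real (m - 1) * snd h * snd (radii p) ^ (m - 1 - 1)))) (at (radii p))"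
    by (auto intro!: derivative_eq_intros simp: fun_eq_iff)
  have ev: "eventually (\<lambda>s. (\<psi> has_derivative (\<lambda>h. 1 * fst h + (real m * snd s ^ (m - 1)) * snd h)) (at s)) (nhds (radii p))"
    by (rule always_eventually) (use d in blast)
  note h = wirt_wirt_bar_radial[OF ev d1 d2, folded r]
  note w = wirt_radial[OF d[of "radii p"], folded r]
  have rp: "r p = 0" using assms by (simp add: r_def)
  \<comment> \<open>At \<open>m = 1\<close> the truncated exponent \<open>m - 1 - 1\<close> is 0,
    but its coefficient \<open>real (m - 1)\<close> vanishes; hence the case distinction.\<close>
  have b2: "real m * t ^ (m - 1) + m * (real (m - 1) * t ^ (m - 1 - 1)) * t = m^2 * t ^ (m - 1)"
  proof (cases "m = 1")
    case False
    then obtain k where k: "m = Suc (Suc k)" using assms(2) by (metis One_nat_def Suc_le_D not0_implies_Suc)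
    show ?thesis by (simp add: k power2_eq_square algebra_simps)
  qed simp
  have w1: "wirt_bar 1 r p = fst p" "wirt 1 r p = cnj (fst p)" "wirt_bar 2 r p = b * snd p" "wirt 2 r p = b * cnj (snd p)"
    using w by (simp_all add: radii_def t_def b_def)
  have h1: "wirt 1 (wirt_bar 1 r) p = 1" "wirt 2 (wirt_bar 1 r) p = 0" "wirt 1 (wirt_bar 2 r) p = 0"
    using h by (simp_all add: radii_def)
  have "wirt 2 (wirt_bar 2 r) p = of_real (real m * t ^ (m - 1) + m * (real (m - 1) * t ^ (m - 1 - 1)) * t)"
    unfolding h(4) by (simp add: radii_def t_def)
  then have h2: "wirt 2 (wirt_bar 2 r) p = of_real (m^2 * t ^ (m - 1))" unfolding b2 .
  have pw: "cmod (snd p) ^ (2 * m - 2) = t ^ (m - 1)" "cmod (snd p) ^ (4 * m - 2) = (t ^ (m - 1))^2 * t"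
  proof -
    have e: "4 * m - 2 = 2 * (m - 1) * 2 + 2" "2 * m - 2 = 2 * (m - 1)" using assms(2) by simp_all
    show "cmod (snd p) ^ (2 * m - 2) = t ^ (m - 1)" "cmod (snd p) ^ (4 * m - 2) = (t ^ (m - 1))^2 * t"
      by (simp_all only: e t_def power_add power_mult)
  qed
  have "t ^ m = t ^ (m - 1) * t" using assms(2) by (cases m) auto
  moreover have "cmod (fst p) ^ 2 + t ^ m = 1"
    using assms(1) by (simp add: rho_def t_def flip: power_mult)
  ultimately have sum1: "cmod (fst p) ^ 2 + t ^ (m - 1) * t = 1" by simp
  have det: "det (vector
         [vector [r p, wirt_bar 1 r p, wirt_bar 2 r p],
          vector [wirt 1 r p, wirt 1 (wirt_bar 1 r) p, wirt 1 (wirt_bar 2 r) p],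
          vector [wirt 2 r p, wirt 2 (wirt_bar 1 r) p, wirt 2 (wirt_bar 2 r) p]]
          :: complex^3^3) = - of_real (m^2 * t ^ (m - 1))" (is "det ?M = _")
  proof -
    have "det ?M = - (fst p * cnj (fst p)) * of_real (m^2 * t ^ (m - 1)) - (snd p * cnj (snd p)) * of_real (b^2)"
      unfolding rp w1 h1 h2 by (simp add: det_3 vector_3 power2_eq_square)
    also have "\<dots> = - of_real (cmod (fst p)^2 * (m^2 * t ^ (m - 1)) + t * b^2)"
      by (simp add: t_def flip: complex_norm_square)
    also have "cmod (fst p)^2 * (m^2 * t ^ (m - 1)) + t * b^2 = m^2 * t ^ (m - 1) * (cmod (fst p) ^ 2 + t ^ (m - 1) * t)"
      by (simp add: b_def power2_eq_square algebra_simps)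
    also have "\<dots> = m^2 * t ^ (m - 1)" using sum1 by simp
    finally show ?thesis .
  qed
  have t0: "t \<ge> 0" by (simp add: t_def)
  have "cmod (wirt 1 r p) ^ 2 + cmod (wirt 2 r p) ^ 2 = cmod (fst p)^2 + m^2 * ((t ^ (m - 1))^2 * t)"
    unfolding w1 norm_mult norm_of_real complex_mod_cnj power_mult_distrib power2_abs
    by (simp add: b_def t_def power_mult_distrib)
  moreover have "cmod (- complex_of_real (m^2 * t ^ (m - 1))) = m^2 * t ^ (m - 1)"
    using t0 by (simp only: norm_minus_cancel norm_of_real) simp
  ultimately show ?thesis unfolding fefferman_weight_def Let_def r_def[symmetric] det pw by simp
qed

section \<open>The Fefferman measure\<close>

lemma rho_scaleR_le:
  assumes "rho m p = 0" "0 \<le> r" "r < 1" "m \<ge> 1"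
  shows "rho m (r *\<^sub>R p) < 0"
proof -
  have "r ^ (2 * m) \<le> r ^ 2" using assms by (intro power_decreasing) auto
  then have "r ^ (2 * m) * cmod (snd p) ^ (2 * m) \<le> r ^ 2 * cmod (snd p) ^ (2 * m)" by (intro mult_right_mono) auto
  then have "rho m (r *\<^sub>R p) + 1 \<le> r^2 * (cmod (fst p) ^ 2 + cmod (snd p) ^ (2 * m))"
    using assms(2) by (simp add: rho_def power_mult_distrib algebra_simps)
  also have "cmod (fst p) ^ 2 + cmod (snd p) ^ (2 * m) = 1" using assms(1) by (simp add: rho_def)
  also have "r^2 * 1 < 1" using assms by (simp add: power_less_one_iff abs_square_less_1)
  finally show ?thesis by simp
qed

text \<open>Zeros of \<open>rho m\<close> are limits of their own dilations, which lie in the egg by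
  \<open>rho_scaleR_le\<close>; conversely the closure of the egg stays within the closed set
  \<open>cegg m\<close>.\<close>

lemma frontier_egg:
  assumes "m \<ge> 1"
  shows "frontier (egg m) = {p. rho m p = 0}"
proof -
  have "closed (cegg m)" using compact_cegg[OF assms] by (rule compact_imp_closed)
  then have 1: "closure (egg m) \<subseteq> cegg m" by (rule closure_minimal[OF egg_subset_cegg])
  have 2: "p \<in> closure (egg m)" if p: "rho m p = 0" for p
  proof (rule closure_sequential[THEN iffD2], intro exI conjI allI)
    show "(\<lambda>n. (1 - inverse (real (Suc n))) *\<^sub>R p) \<longlonglongrightarrow> p"
      using tendsto_scaleR[OF tendsto_diff[OF tendsto_const[of 1] LIMSEQ_inverse_real_of_nat] tendsto_const[of p]] by simp
    fix n
    have "inverse (real (Suc n)) \<le> 1" "inverse (real (Suc n)) > 0"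
      by (auto simp: inverse_le_1_iff)
    then show "(1 - inverse (real (Suc n))) *\<^sub>R p \<in> egg m"
      unfolding egg_iff by (intro rho_scaleR_le[OF p _ _ assms]) auto
  qed
  have "frontier (egg m) = closure (egg m) - egg m"
    by (simp add: frontier_def interior_open[OF open_egg])
  also have "\<dots> = {p. rho m p = 0}"
    using 1 2 closure_subset[of "egg m"] by (force simp: egg_iff cegg_def)
  finally show ?thesis .
qed

section \<open>The Fefferman measure in the chart\<close>

text \<open>Sarrus' rule for permutations of an abstract three-element set, the form that
  \<open>gram_det\<close> takes over the basis of the parameter space.\<close>

lemma sum_permutations_3:
  fixes f :: "'a \<Rightarrow> 'a \<Rightarrow> real"
  assumes "a \<noteq> b" "a \<noteq> c" "b \<noteq> c"
  shows "(\<Sum>\<pi> | \<pi> permutes {a, b, c}. of_int (sign \<pi>) * (\<Prod>x\<in>{a, b, c}. f x (\<pi> x)))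
    = f a a * f b b * f c c + f a b * f b c * f c a + f a c * f b a * f c b
      - f a a * f b c * f c b - f a b * f b a * f c c - f a c * f b b * f c a"
proof -
  have f: "finite {b, c}" "a \<notin> {b, c}" "finite {c}" "b \<notin> {c}" using assms by auto
  have g: "(\<Sum>x\<in>insert a {b, c}. g x) = g a + g b + g c" "(\<Sum>x\<in>insert b {c}. g x) = g b + g c" for g :: "'a \<Rightarrow> real"
    using assms by (simp_all add: add.assoc)
  have h: "(\<Prod>x\<in>{a, b, c}. g x) = g a * (g b * g c)" for g :: "'a \<Rightarrow> real"
    using assms by simp
  show ?thesis
    unfolding sum_over_permutations_insert[OF f(1,2)] sum_over_permutations_insert[OF f(3,4)] permutes_sing h g
    using assms
    by (simp add: sign_swap_id sign_compose permutation_swap_id sign_id swap_id_eq algebra_simps)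
qed

lemma egg_param_derivative:
  assumes w: "cmod (fst u) < 1" and m: "m \<ge> 1"
  defines "R \<equiv> sqrt (1 - cmod (fst u) ^ (2 * m))"
  shows "(egg_param m has_derivative
    (\<lambda>h. (of_real (- (m * cmod (fst u) ^ (2 * (m - 1)) * (fst u \<bullet> fst h)) / R) * cis (snd u) + of_real (R * snd h) * (\<i> * cis (snd u)), fst h))) (at u)"
proof -
  have lt: "(fst u \<bullet> fst u) ^ m < 1" using w m by (simp add: power_less_one_iff dot_square_norm flip: power_mult)
  have Req: "R = sqrt (1 - (fst u \<bullet> fst u) ^ m)" by (simp add: R_def dot_square_norm power_mult)
  have R0: "R > 0" using lt by (simp add: Req)
  \<comment> \<open>Inner products replace powers of \<open>cmod\<close>, which is not
    differentiable at 0.\<close>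
  have eq: "egg_param m = (\<lambda>u. (of_real (sqrt (1 - (fst u \<bullet> fst u) ^ m)) * cis (snd u), fst u))"
    by (simp add: fun_eq_iff egg_param_def dot_square_norm power_mult)
  have d: "((\<lambda>u. sqrt (1 - (fst u \<bullet> fst u) ^ m)) has_derivative
      (\<lambda>h. - (m * cmod (fst u) ^ (2 * (m - 1)) * (fst u \<bullet> fst h)) / R)) (at u)"
  proof -
    have i: "((\<lambda>u. fst u \<bullet> fst u) has_derivative (\<lambda>h. fst u \<bullet> fst h + fst h \<bullet> fst u)) (at u)"
      by (rule has_derivative_inner[OF has_derivative_fst[OF has_derivative_ident] has_derivative_fst[OF has_derivative_ident]])
    have "((\<lambda>t. 1 - t ^ m) has_real_derivative (0 - real m * (fst u \<bullet> fst u) ^ (m - Suc 0))) (at (fst u \<bullet> fst u))"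
      by (intro DERIV_diff DERIV_const DERIV_pow)
    then have "((\<lambda>t. sqrt (1 - t ^ m)) has_real_derivative
        inverse (sqrt (1 - (fst u \<bullet> fst u) ^ m)) / 2 * (0 - real m * (fst u \<bullet> fst u) ^ (m - Suc 0))) (at (fst u \<bullet> fst u))"
      using lt by (intro DERIV_chain2[of sqrt, OF DERIV_real_sqrt]) auto
    from has_derivative_compose[OF i this[unfolded has_field_derivative_def]]
    show ?thesis
    proof (rule has_derivative_eq_rhs, intro ext)
      fix h :: "complex \<times> real"
      have p: "(fst u \<bullet> fst u) ^ (m - Suc 0) = cmod (fst u) ^ (2 * (m - 1))"
        by (simp only: dot_square_norm power_mult One_nat_def)
      have c: "fst h \<bullet> fst u = fst u \<bullet> fst h" by (rule inner_commute)
      show "inverse (sqrt (1 - (fst u \<bullet> fst u) ^ m)) / 2 * (0 - real m * (fst u \<bullet> fst u) ^ (m - Suc 0)) * (fst u \<bullet> fst h + fst h \<bullet> fst u)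
         = - (m * cmod (fst u) ^ (2 * (m - 1)) * (fst u \<bullet> fst h)) / R"
        unfolding p c Req[symmetric] using R0 by (simp add: field_simps)
    qed
  qed
  have c: "((\<lambda>u. cis (snd u)) has_derivative (\<lambda>h. snd h *\<^sub>R (\<i> * cis (snd u)))) (at u)"
    by (rule has_derivative_cis[OF has_derivative_snd[OF has_derivative_ident]])
  show ?thesis
    unfolding eq
    using has_derivative_Pair[OF has_derivative_mult[OF has_derivative_of_real[OF d] c] has_derivative_fst[OF has_derivative_ident]]
    by (rule has_derivative_eq_rhs) (simp add: fun_eq_iff Req[symmetric] scaleR_conv_of_real mult_ac)
qed

text \<open>The angle is orthogonal to the \<open>w\<close> directions: the Gram matrix is
  \<open>R^2\<close> on the angle and the identity plus a rank-one form on the plane, so its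
  determinant is \<open>R^2 * (1 + k^2 * cmod w ^ 2)\<close>. At the corresponding boundary point
  this is the radicand in the denominator of the Fefferman weight.\<close>

lemma gram_det_egg_param:
  assumes w: "cmod (fst u) < 1" and m: "m \<ge> 1"
  shows "gram_det (egg_param m) u = 1 - cmod (fst u) ^ (2 * m) + m^2 * cmod (fst u) ^ (4 * m - 2)"
proof -
  define R where "R = sqrt (1 - cmod (fst u) ^ (2 * m))"
  have lt: "cmod (fst u) ^ (2 * m) < 1" using w m by (simp add: power_less_one_iff)
  have R0: "R > 0" and R2: "R^2 = 1 - cmod (fst u) ^ (2 * m)" using lt by (simp_all add: R_def)
  define k where "k = - (m * cmod (fst u) ^ (2 * (m - 1))) / R"
  define D where "D = frechet_derivative (egg_param m) (at u)"
  have D: "D h = (of_real (k * (fst u \<bullet> fst h)) * cis (snd u) + of_real (R * snd h) * (\<i> * cis (snd u)), fst h)" for h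
    unfolding D_def frechet_derivative_at[OF egg_param_derivative[OF w m], symmetric]
    by (simp add: k_def R_def)
  have ic: "(x * cis t) \<bullet> (y * cis t) = x \<bullet> y" for x y :: complex and t
  proof -
    have "(x * cis t) \<bullet> (y * cis t) = (x \<bullet> y) * (cos t * cos t + sin t * sin t)"
      by (simp add: inner_complex_def algebra_simps del: sin_cos_squared_add3)
    then show ?thesis by simp
  qed
  have D': "D h = ((of_real (k * (fst u \<bullet> fst h)) + of_real (R * snd h) * \<i>) * cis (snd u), fst h)" for h
    by (simp add: D algebra_simps)
  have inner: "D a \<bullet> D b = k^2 * (fst u \<bullet> fst a) * (fst u \<bullet> fst b) + R^2 * snd a * snd b + fst a \<bullet> fst b" for a b
    unfolding D' inner_prod_def fst_conv snd_conv ic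
    by (simp add: inner_complex_def power2_eq_square algebra_simps)
  have B: "(Basis :: (complex \<times> real) set) = {(1, 0), (\<i>, 0), (0, 1)}"
    by (auto simp: Basis_prod_def Basis_complex_def)
  have "gram_det (egg_param m) u = R^2 * (1 + k^2 * cmod (fst u)^2)"
  proof -
    have n: "cmod (fst u) ^ 2 = Re (fst u) * Re (fst u) + Im (fst u) * Im (fst u)"
      unfolding cmod_power2 by (simp only: power2_eq_square)
    show ?thesis
      unfolding gram_det_def D_def[symmetric] B n
      by (subst sum_permutations_3) (simp_all add: inner inner_complex_def power2_eq_square algebra_simps)
  qed
  also have "\<dots> = R^2 + (R * k)^2 * cmod (fst u)^2" by (simp add: power_mult_distrib algebra_simps)
  also have "(R * k)^2 = m^2 * cmod (fst u) ^ (4 * (m - 1))" using R0 by (simp add: k_def power_mult_distrib flip: power_mult)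
  also have "m^2 * cmod (fst u) ^ (4 * (m - 1)) * cmod (fst u)^2 = m^2 * cmod (fst u) ^ (4 * m - 2)"
  proof -
    have "4 * m - 2 = 4 * (m - 1) + 2" using m by simp
    then show ?thesis by (simp only: power_add mult.assoc)
  qed
  finally show ?thesis by (simp add: R2)
qed

text \<open>Density of the Fefferman measure with respect to Lebesgue measure in the chart, after
  the Gram factor has cancelled the denominator of \<open>fefferman_weight\<close>.\<close>

definition fefferman_density :: "nat \<Rightarrow> complex \<Rightarrow> real" where
  "fefferman_density m w = root 3 (m^2 * cmod w ^ (2 * m - 2))"

lemma fefferman_density_nonneg: "fefferman_density m w \<ge> 0"
  by (simp add: fefferman_density_def)

lemma continuous_on_fefferman_density: "continuous_on S (fefferman_density m)"
  unfolding fefferman_density_def by (intro continuous_intros)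

lemma continuous_on_egg_param: "continuous_on S (egg_param m)"
  unfolding egg_param_def by (intro continuous_intros)

lemma egg_param_in_frontier:
  assumes "u \<in> egg_param_dom" "m \<ge> 1"
  shows "rho m (egg_param m u) = 0"
  using bij_betw_egg_param[OF assms(2)] assms(1) by (auto simp: bij_betw_def)

lemma sets_egg_param_dom: "egg_param_dom \<in> sets borel"
proof -
  have "ball (0::complex) 1 \<times> {0..<2 * pi} \<in> sets (borel \<Otimes>\<^sub>M borel)"
    by (intro pair_measureI) simp_all
  then show ?thesis unfolding egg_param_dom_def borel_prod .
qed

text \<open>The weight is pulled back to the parameter space, where it multiplies the Gram factor.
  That factor is positive on the whole chart since \<open>1 - cmod w ^ (2 * m) > 0\<close> there, so
  the cancellation is legitimate.\<close>

lemma fefferman_measure_eq: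
  assumes m: "m \<ge> 1"
  shows "fefferman_measure m = distr (density (restrict_space lborel egg_param_dom)
     (\<lambda>u. ennreal (fefferman_density m (fst u)))) (restrict_space borel (frontier (egg m))) (egg_param m)"
proof -
  define RU where "RU = restrict_space (lborel :: (complex \<times> real) measure) egg_param_dom"
  define RF where "RF = restrict_space (borel :: C2 measure) (frontier (egg m))"
  define G where "G = (\<lambda>u::complex \<times> real. sqrt (1 - cmod (fst u) ^ (2 * m) + m^2 * cmod (fst u) ^ (4 * m - 2)))"
  define W where "W = (\<lambda>p::C2. root 3 (m^2 * cmod (snd p) ^ (2 * m - 2)) / sqrt (cmod (fst p)^2 + m^2 * cmod (snd p) ^ (4 * m - 2)))"
  have sU: "space RU = egg_param_dom" by (simp add: RU_def space_restrict_space)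
  have sF: "space RF = {p. rho m p = 0}" by (simp add: RF_def space_restrict_space frontier_egg[OF m])
  have lt: "cmod (fst u) < 1" if "u \<in> egg_param_dom" for u using that by (auto simp: egg_param_dom_def)
  have Gm: "G \<in> borel_measurable RU"
    unfolding RU_def G_def
    by (intro measurable_restrict_space1, unfold measurable_lborel2, intro borel_measurable_continuous_onI continuous_intros)
  have gm: "(\<lambda>u. ennreal (sqrt (gram_det (egg_param m) u))) \<in> borel_measurable RU"
  proof (subst measurable_cong)
    show "ennreal (sqrt (gram_det (egg_param m) u)) = ennreal (G u)" if "u \<in> space RU" for u
      using that lt by (simp add: sU G_def gram_det_egg_param[OF _ m])
    show "(\<lambda>u. ennreal (G u)) \<in> borel_measurable RU" using measurable_compose[OF Gm measurable_ennreal] .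
  qed
  have Wm0: "W \<in> borel_measurable RF"
    unfolding RF_def W_def
    by (intro measurable_restrict_space1 borel_measurable_divide borel_measurable_continuous_onI continuous_intros)
  have Wm: "(\<lambda>p. ennreal (fefferman_weight m p)) \<in> borel_measurable RF"
  proof (subst measurable_cong)
    show "ennreal (fefferman_weight m p) = ennreal (W p)" if "p \<in> space RF" for p
      using that by (simp add: sF W_def fefferman_weight_eq[OF _ m])
    show "(\<lambda>p. ennreal (W p)) \<in> borel_measurable RF" using measurable_compose[OF Wm0 measurable_ennreal] .
  qed
  have Pm: "egg_param m \<in> measurable RU RF"
    unfolding RF_def
  proof (rule measurable_restrict_space2)
    show "egg_param m \<in> space RU \<rightarrow> frontier (egg m)"
      using egg_param_in_frontier[OF _ m] by (auto simp: sU frontier_egg[OF m])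
    show "egg_param m \<in> measurable RU borel"
      unfolding RU_def
      by (intro measurable_restrict_space1, unfold measurable_lborel2, intro borel_measurable_continuous_onI continuous_on_egg_param)
  qed
  have "fefferman_measure m = density (distr (density RU (\<lambda>u. ennreal (sqrt (gram_det (egg_param m) u)))) RF (egg_param m))
      (\<lambda>p. ennreal (fefferman_weight m p))"
    unfolding fefferman_measure_def euclid_measure_def surface_measure_def RU_def RF_def ..
  also have "\<dots> = distr (density (density RU (\<lambda>u. ennreal (sqrt (gram_det (egg_param m) u))))
       (\<lambda>u. ennreal (fefferman_weight m (egg_param m u)))) RF (egg_param m)"
    by (rule density_distr[OF Wm]) (use Pm in \<open>simp add: measurable_cong_sets[OF sets_density refl]\<close>)
  also have "density (density RU (\<lambda>u. ennreal (sqrt (gram_det (egg_param m) u))))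
       (\<lambda>u. ennreal (fefferman_weight m (egg_param m u)))
     = density RU (\<lambda>u. ennreal (sqrt (gram_det (egg_param m) u)) * ennreal (fefferman_weight m (egg_param m u)))"
    by (rule density_density_eq[OF gm measurable_compose[OF Pm Wm]])
  also have "\<dots> = density RU (\<lambda>u. ennreal (fefferman_density m (fst u)))"
  proof (rule density_cong)
    show "(\<lambda>u. ennreal (sqrt (gram_det (egg_param m) u)) * ennreal (fefferman_weight m (egg_param m u))) \<in> borel_measurable RU"
      by (intro borel_measurable_times_ennreal gm measurable_compose[OF Pm Wm])
    show "(\<lambda>u. ennreal (fefferman_density m (fst u))) \<in> borel_measurable RU"
      unfolding RU_def
      by (intro measurable_restrict_space1, unfold measurable_lborel2,
          intro measurable_compose[OF _ measurable_ennreal] borel_measurable_continuous_onI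
          continuous_on_compose2[OF continuous_on_fefferman_density] continuous_intros) auto
    show "AE u in RU. ennreal (sqrt (gram_det (egg_param m) u)) * ennreal (fefferman_weight m (egg_param m u)) = ennreal (fefferman_density m (fst u))"
    proof (rule AE_I2)
      fix u assume "u \<in> space RU"
      then have u: "u \<in> egg_param_dom" by (simp add: sU)
      note lt = lt[OF u]
      have x: "cmod (fst u) ^ (2 * m) < 1" using lt m by (simp add: power_less_one_iff)
      have z2: "cmod (fst (egg_param m u)) ^ 2 = 1 - cmod (fst u) ^ (2 * m)"
        using x by (simp add: egg_param_def norm_mult)
      have s: "snd (egg_param m u) = fst u" by (simp add: egg_param_def)
      have pos: "1 - cmod (fst u) ^ (2 * m) + m^2 * cmod (fst u) ^ (4 * m - 2) > 0"
        using x by (intro add_pos_nonneg) auto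
      have "sqrt (gram_det (egg_param m) u) * fefferman_weight m (egg_param m u) = fefferman_density m (fst u)"
        unfolding gram_det_egg_param[OF lt m] fefferman_weight_eq[OF egg_param_in_frontier[OF u m] m] z2 s fefferman_density_def
        using pos by simp
      moreover have "sqrt (gram_det (egg_param m) u) \<ge> 0"
        using pos by (simp add: gram_det_egg_param[OF lt m])
      ultimately show "ennreal (sqrt (gram_det (egg_param m) u)) * ennreal (fefferman_weight m (egg_param m u)) = ennreal (fefferman_density m (fst u))"
        using ennreal_mult' by metis
    qed
  qed
  finally show ?thesis unfolding RU_def RF_def .
qed

lemma space_fefferman_measure: "m \<ge> 1 \<Longrightarrow> space (fefferman_measure m) = {p. rho m p = 0}"
  by (simp add: fefferman_measure_eq space_restrict_space frontier_egg)

lemma sets_fefferman_measure: "sets (fefferman_measure m) = sets (restrict_space borel (frontier (egg m)))"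
  unfolding fefferman_measure_def euclid_measure_def surface_measure_def by simp

lemma egg_param_measurable:
  assumes m: "m \<ge> 1"
  shows "egg_param m \<in> measurable (restrict_space lborel egg_param_dom) (restrict_space borel (frontier (egg m)))"
proof (rule measurable_restrict_space2)
  show "egg_param m \<in> space (restrict_space lborel egg_param_dom) \<rightarrow> frontier (egg m)"
    using egg_param_in_frontier[OF _ m] by (auto simp: space_restrict_space frontier_egg[OF m])
  show "egg_param m \<in> measurable (restrict_space lborel egg_param_dom) borel"
    by (intro measurable_restrict_space1, unfold measurable_lborel2, intro borel_measurable_continuous_onI continuous_on_egg_param)
qed

lemma fefferman_density_measurable: "(\<lambda>u. fefferman_density m (fst u)) \<in> borel_measurable (restrict_space lborel egg_param_dom)"
  by (intro measurable_restrict_space1, unfold measurable_lborel2,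
      intro borel_measurable_continuous_onI continuous_on_compose2[OF continuous_on_fefferman_density] continuous_intros) auto

lemma integral_fefferman_measure:
  fixes h :: "C2 \<Rightarrow> complex"
  assumes m: "m \<ge> 1" and h: "h \<in> borel_measurable (fefferman_measure m)"
  shows "(LINT p|fefferman_measure m. h p)
      = (LINT u|lborel. indicator egg_param_dom u *\<^sub>R (fefferman_density m (fst u) *\<^sub>R h (egg_param m u)))"
    and "integrable (fefferman_measure m) h \<longleftrightarrow>
      integrable lborel (\<lambda>u. indicator egg_param_dom u *\<^sub>R (fefferman_density m (fst u) *\<^sub>R h (egg_param m u)))"
proof -
  have h': "h \<in> borel_measurable (restrict_space borel (frontier (egg m)))"
    using h by (simp add: measurable_cong_sets[OF sets_fefferman_measure refl])
  have hP: "(\<lambda>u. h (egg_param m u)) \<in> borel_measurable (restrict_space lborel egg_param_dom)"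
    by (rule measurable_compose[OF egg_param_measurable[OF m] h'])
  have P: "egg_param m \<in> measurable (density (restrict_space lborel egg_param_dom) (\<lambda>u. ennreal (fefferman_density m (fst u)))) (restrict_space borel (frontier (egg m)))"
    using egg_param_measurable[OF m] by (simp add: measurable_cong_sets[OF sets_density refl])
  have nn: "AE u in restrict_space lborel egg_param_dom. 0 \<le> fefferman_density m (fst u)"
    by (rule AE_I2) (rule fefferman_density_nonneg)
  have U: "egg_param_dom \<inter> space lborel \<in> sets lborel" using sets_egg_param_dom by simp
  show "(LINT p|fefferman_measure m. h p)
      = (LINT u|lborel. indicator egg_param_dom u *\<^sub>R (fefferman_density m (fst u) *\<^sub>R h (egg_param m u)))"
    unfolding fefferman_measure_eq[OF m] integral_distr[OF P h']
      integral_density[OF hP fefferman_density_measurable nn] integral_restrict_space[OF U] ..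
  show "integrable (fefferman_measure m) h \<longleftrightarrow>
      integrable lborel (\<lambda>u. indicator egg_param_dom u *\<^sub>R (fefferman_density m (fst u) *\<^sub>R h (egg_param m u)))"
    unfolding fefferman_measure_eq[OF m] integrable_distr_eq[OF P h']
      integrable_density[OF hP fefferman_density_measurable nn] integrable_restrict_space[OF U] ..
qed

lemma fefferman_density_le:
  assumes "cmod w \<le> 1"
  shows "fefferman_density m w \<le> root 3 (m^2)"
proof -
  have "cmod w ^ (2 * m - 2) \<le> 1" using assms by (simp add: power_le_one)
  then have "real m ^ 2 * cmod w ^ (2 * m - 2) \<le> real m ^ 2 * 1" by (intro mult_left_mono) auto
  then show ?thesis by (simp add: fefferman_density_def)
qed

lemma finite_measure_fefferman_measure:
  assumes m: "m \<ge> 1"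
  shows "finite_measure (fefferman_measure m)"
proof (rule finite_measureI)
  let ?R = "restrict_space (lborel :: (complex \<times> real) measure) egg_param_dom"
  let ?d = "density ?R (\<lambda>u. ennreal (fefferman_density m (fst u)))"
  have P: "egg_param m \<in> measurable ?d (restrict_space borel (frontier (egg m)))"
    using egg_param_measurable[OF m] by (simp add: measurable_cong_sets[OF sets_density refl])
  have v: "egg_param m -` space (restrict_space borel (frontier (egg m))) \<inter> space ?d = space ?d"
    using measurable_space[OF P] by blast
  have "emeasure (fefferman_measure m) (space (fefferman_measure m)) = emeasure ?d (space ?d)"
    by (simp only: fefferman_measure_eq[OF m] space_distr emeasure_distr[OF P sets.top] v)
  also have "\<dots> = (\<integral>\<^sup>+u. ennreal (fefferman_density m (fst u)) * indicator (space ?R) u \<partial>?R)"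
    unfolding space_density
    by (rule emeasure_density[OF measurable_compose[OF fefferman_density_measurable measurable_ennreal] sets.top])
  also have "\<dots> = (\<integral>\<^sup>+u. ennreal (fefferman_density m (fst u)) \<partial>?R)"
    by (rule nn_integral_cong) (simp only: indicator_simps mult_1_right)
  also have "\<dots> \<le> (\<integral>\<^sup>+u. ennreal (root 3 (m^2)) \<partial>?R)"
    by (intro nn_integral_mono ennreal_leI fefferman_density_le) (auto simp: space_restrict_space egg_param_dom_def)
  also have "\<dots> = ennreal (root 3 (m^2)) * emeasure lborel egg_param_dom"
    using sets_egg_param_dom by (simp add: space_restrict_space emeasure_restrict_space)
  also have "\<dots> < \<infinity>"
  proof -
    have "bounded (egg_param_dom)" unfolding egg_param_dom_def by (intro bounded_Times bounded_ball bounded_subset[OF bounded_closed_interval[of 0 "2 * pi"]]) auto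
    then have "emeasure lborel egg_param_dom < \<infinity>" by (rule emeasure_bounded_finite)
    then show ?thesis by (simp add: ennreal_mult_less_top)
  qed
  finally show "emeasure (fefferman_measure m) (space (fefferman_measure m)) \<noteq> \<infinity>" by simp
qed

lemma continuous_on_measurable_fefferman:
  fixes h :: "C2 \<Rightarrow> 'a::topological_space"
  assumes "m \<ge> 1" "continuous_on {p. rho m p = 0} h"
  shows "h \<in> borel_measurable (fefferman_measure m)"
proof -
  have "h \<in> borel_measurable (restrict_space borel (frontier (egg m)))"
    using assms by (simp add: frontier_egg borel_measurable_continuous_on_restrict)
  then show ?thesis by (simp add: measurable_cong_sets[OF sets_fefferman_measure refl])
qed

lemma fefferman_density_powr:
  assumes "m \<ge> 1" "w \<noteq> 0"
  shows "fefferman_density m w = real m powr (2 / 3) * (cmod w ^ 2) powr ((real m - 1) / 3)"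
proof -
  have "fefferman_density m w = root 3 (m^2) * root 3 ((cmod w ^ 2) ^ (m - 1))"
  proof -
    have "2 * m - 2 = 2 * (m - 1)" using assms by simp
    then show ?thesis by (simp add: fefferman_density_def real_root_mult power_mult)
  qed
  moreover have "root 3 (real m^2) = real m powr (2 / 3)"
  proof -
    have m0: "real m > 0" using assms by simp
    have "root 3 (real m ^ 2) = (real m ^ 2) powr (1 / 3)" using root_powr_inverse[of 3 "real m ^ 2"] m0 by simp
    also have "real m ^ 2 = real m powr 2" using m0 by (simp add: powr_numeral)
    finally show ?thesis by (simp only: powr_powr) simp
  qed
  moreover have "root 3 ((cmod w ^ 2) ^ (m - 1)) = (cmod w ^ 2) powr ((real m - 1) / 3)"
  proof -
    define t where "t = cmod w ^ 2"
    have t: "t > 0" using assms by (simp add: t_def)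
    have "root 3 (t ^ (m - 1)) = (t ^ (m - 1)) powr (1 / 3)" using root_powr_inverse[of 3 "t ^ (m - 1)"] t by simp
    moreover have "t ^ (m - 1) = t powr real (m - 1)" using t by (simp only: powr_realpow)
    ultimately have "root 3 (t ^ (m - 1)) = (t powr real (m - 1)) powr (1 / 3)" by (simp only:)
    then have "root 3 (t ^ (m - 1)) = t powr (real (m - 1) * (1 / 3))" by (simp only: powr_powr)
    then show ?thesis using assms by (simp add: t_def of_nat_diff)
  qed
  ultimately show ?thesis by simp
qed

section \<open>Moments of the Fefferman measure\<close>

text \<open>On the boundary \<open>cmod z ^ (2 * j)\<close> is
  \<open>(1 - cmod w ^ (2 * m)) ^ j\<close>. In \<open>t = cmod w ^ 2\<close> the density
  contributes \<open>t powr ((m - 1) / 3)\<close>, and \<open>c\<close> is determined by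
  \<open>m * c - 1 = k + (m - 1) / 3\<close>.\<close>

lemma hardy_moment:
  fixes k :: nat
  assumes m: "m \<ge> 1"
  defines "c \<equiv> (real k + (real m + 2) / 3) / m"
  shows "(LINT w|lborel. complex_of_real (indicator (ball 0 1) w * (fefferman_density m w * (1 - cmod w ^ (2 * m)) ^ j * cmod w ^ (2 * k))))
     = of_real (pi * real m powr (2/3) * fact j / (m * pochhammer c (Suc j)))"
proof -
  have c: "c > 0" using m unfolding c_def by (intro divide_pos_pos add_nonneg_pos) auto
  have p0: "pochhammer c (Suc j) > 0" using c by (rule pochhammer_pos)
  define H where "H = (\<lambda>w::complex. fefferman_density m w * (1 - cmod w ^ (2 * m)) ^ j * cmod w ^ (2 * k))"
  define g where "g = (\<lambda>t::real. real m powr (2/3) * ((1 - t ^ m) ^ j * t powr (m * c - 1)))"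
  have gm: "(\<lambda>t. ennreal (g t)) \<in> borel_measurable borel" unfolding g_def by measurable
  have Hc: "H \<in> borel_measurable borel" unfolding H_def
    by (intro borel_measurable_continuous_onI continuous_intros continuous_on_fefferman_density)
  have nn: "0 \<le> indicator (ball 0 1) w * H w" for w
    using m by (auto simp: indicator_def H_def fefferman_density_nonneg power_le_one intro!: mult_nonneg_nonneg)
  have Hg: "H w = g (cmod w ^ 2)" if "w \<noteq> 0" for w
  proof -
    have "(cmod w ^ 2) powr ((real m - 1) / 3) * (cmod w ^ 2) ^ k = (cmod w ^ 2) powr (m * c - 1)"
    proof -
      have T: "cmod w ^ 2 > 0" using that by simp
      have e: "m * c - 1 = (real m - 1) / 3 + real k" using m by (simp add: c_def field_simps)
      show ?thesis unfolding e powr_add powr_realpow[OF T] ..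
    qed
    then show ?thesis
      unfolding H_def g_def fefferman_density_powr[OF m that] power_mult by (simp add: mult_ac)
  qed
  have "(LINT w|lborel. indicator (ball 0 1) w * H w) = enn2real (\<integral>\<^sup>+w. ennreal (indicator (ball 0 1) w * H w) \<partial>lborel)"
  proof (rule integral_eq_nn_integral)
    show "(\<lambda>w. indicator (ball 0 1) w * H w) \<in> borel_measurable lborel"
      unfolding measurable_lborel2 by (intro borel_measurable_times Hc borel_measurable_indicator) simp
  qed (use nn in simp)
  also have "(\<integral>\<^sup>+w. ennreal (indicator (ball 0 1) w * H w) \<partial>lborel)
     = (\<integral>\<^sup>+w. ennreal (g (cmod w ^ 2)) * indicator (ball 0 1) w \<partial>lborel)"
  proof (rule nn_integral_cong_AE)
    have "AE w in lborel. w \<noteq> (0::complex)" by (rule AE_lborel_singleton)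
    then show "AE w in lborel. ennreal (indicator (ball 0 1) w * H w) = ennreal (g (cmod w ^ 2)) * indicator (ball 0 1) w"
      by eventually_elim (simp add: Hg indicator_def)
  qed
  also have "\<dots> = ennreal pi * (\<integral>\<^sup>+t. ennreal (g t) * indicator {0..1^2} t \<partial>lborel)"
    by (rule nn_integral_radial[OF gm]) simp
  also have "(\<integral>\<^sup>+t. ennreal (g t) * indicator {0..1^2} t \<partial>lborel)
     = (\<integral>\<^sup>+t. ennreal (real m powr (2/3)) * (ennreal ((1 - t ^ m) ^ j * t powr (m * c - 1)) * indicator {0..1} t) \<partial>lborel)"
    by (intro nn_integral_cong) (simp add: g_def ennreal_mult' mult.assoc)
  also have "\<dots> = ennreal (real m powr (2/3)) * ennreal (fact j / (m * pochhammer c (Suc j)))"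
  proof -
    have "(\<lambda>t. ennreal ((1 - t ^ m) ^ j * t powr (m * c - 1))) \<in> borel_measurable borel" by measurable
    then have "(\<lambda>t. ennreal ((1 - t ^ m) ^ j * t powr (m * c - 1)) * indicator {0..1} t) \<in> borel_measurable lborel"
      unfolding measurable_lborel2 by (intro borel_measurable_times_ennreal borel_measurable_indicator) simp_all
    from nn_integral_cmult[OF this] show ?thesis by (simp only: nn_integral_beta_power[OF m c])
  qed
  also have "enn2real (ennreal pi * (ennreal (real m powr (2/3)) * ennreal (fact j / (m * pochhammer c (Suc j)))))
     = pi * real m powr (2/3) * fact j / (m * pochhammer c (Suc j))"
    using p0 by (simp add: enn2real_mult del: pochhammer_Suc)
  finally show ?thesis unfolding H_def by (simp only: integral_complex_of_real)
qed

text \<open>Read off from the reciprocal moment: with the \<open>c\<close> of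
  \<open>hardy_coeff\<close>, \<open>c + 1 = hardy_e m + k / m\<close> and
  \<open>c = (m - 1) / (3 * m) + (k + 1) / m\<close>. The factor
  \<open>m powr (1/3) / (2 * pi^2)\<close> collects \<open>2 * pi\<close> from the angle of
  \<open>z\<close>, \<open>pi\<close> from radial integration in \<open>w\<close>, and
  \<open>m / m powr (2/3)\<close>.\<close>

abbreviation hardy_e :: "nat \<Rightarrow> real" where "hardy_e m \<equiv> 1 + (real m + 2) / (3 * m)"
abbreviation hardy_A0 :: "nat \<Rightarrow> real" where "hardy_A0 m \<equiv> real m powr (1/3) / (2 * pi^2) * ((real m - 1) / (3 * m))"
abbreviation hardy_A1 :: "nat \<Rightarrow> real" where "hardy_A1 m \<equiv> real m powr (1/3) / (2 * pi^2) * (1 / m)"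

abbreviation hardy_formula :: "nat \<Rightarrow> C2 \<Rightarrow> C2 \<Rightarrow> complex" where
  "hardy_formula m \<equiv> egg_kernel2 m (hardy_e m) (hardy_A0 m) (hardy_A1 m) 0"

lemma hardy_coeff:
  fixes k :: nat
  assumes m: "m \<ge> 1"
  defines "c \<equiv> (real k + (real m + 2) / 3) / m"
  shows "2 * pi * (pi * real m powr (2/3) * fact j / (m * pochhammer c (Suc j)))
     = 1 / egg_coeff m (hardy_e m) (hardy_A0 m) (hardy_A1 m) 0 j k"
proof -
  have c: "c > 0" using m unfolding c_def by (intro divide_pos_pos add_nonneg_pos) auto
  have p: "pochhammer c (Suc j) = c * pochhammer (c + 1) j" by (rule pochhammer_rec)
  have e: "hardy_e m + real k / real m = c + 1" using m by (simp add: c_def field_simps)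
  have a: "hardy_A0 m + hardy_A1 m * (real k + 1) + 0 * (real k + 1) * (real k + 2) = real m powr (1/3) / (2 * pi^2) * c"
    using m by (simp add: c_def field_simps)
  have "real m powr (2/3) * real m powr (1/3) = m" using m by (simp add: powr_add[symmetric])
  then have mm: "real m powr (2/3) = m / real m powr (1/3)" using m by (simp add: field_simps)
  show ?thesis unfolding egg_coeff_def p e a mm using m c by (simp add: field_simps power2_eq_square)
qed

text \<open>Dilation makes \<open>f\<close> continuous up to the boundary. The angle of
  \<open>z\<close> is a chart coordinate, and integrating over it extracts
  \<open>slice_coeff\<close>; the angle of \<open>w\<close> is then averaged by
  \<open>rotation_average\<close>.\<close>

lemma fefferman_moment:
  assumes m: "m \<ge> 1" and f: "holomorphic2_on f (egg m)" and r: "0 \<le> r" "r < 1"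
  shows "(LINT p|fefferman_measure m. cnj (fst p ^ j * snd p ^ k) * f (r *\<^sub>R p))
     = taylor_coeff f j k * r ^ j * r ^ k / of_real (egg_coeff m (hardy_e m) (hardy_A0 m) (hardy_A1 m) 0 j k)"
    and "integrable (fefferman_measure m) (\<lambda>p. f (r *\<^sub>R p))"
proof -
  let ?\<sigma> = "fefferman_measure m"
  interpret \<sigma>: finite_measure ?\<sigma> by (rule finite_measure_fefferman_measure[OF m])
  note fc = holomorphic2_on_imp_continuous_on[OF f]
  have F: "compact {p. rho m p = 0}"
  proof -
    have "closed {p. rho m p = 0}" using frontier_closed[of "egg m"] by (simp add: frontier_egg[OF m])
    moreover have "{p. rho m p = 0} \<subseteq> cegg m" by (auto simp: cegg_def)
    ultimately show ?thesis using compact_cegg[OF m] by (metis compact_Int_closed inf.absorb2)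
  qed
  have rE: "r *\<^sub>R p \<in> egg m" if "rho m p = 0" for p
    using rho_scaleR_le[OF that r m] by (simp add: egg_iff)
  have frc: "continuous_on {p. rho m p = 0} (\<lambda>p. f (r *\<^sub>R p))"
    using rE by (intro continuous_on_compose2[OF fc] continuous_intros) auto
  have bnd: "integrable ?\<sigma> h" if h: "continuous_on {p. rho m p = 0} h" for h :: "C2 \<Rightarrow> complex"
  proof -
    obtain B where "\<forall>x\<in>h ` {p. rho m p = 0}. norm x \<le> B"
      using compact_imp_bounded[OF compact_continuous_image[OF h F]] bounded_iff by blast
    then show ?thesis
      by (intro \<sigma>.integrable_const_bound[of _ B] AE_I2 continuous_on_measurable_fefferman[OF m h])
         (auto simp: space_fefferman_measure[OF m])
  qed
  show "integrable ?\<sigma> (\<lambda>p. f (r *\<^sub>R p))" by (rule bnd[OF frc])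
  define h where "h = (\<lambda>p. cnj (fst p ^ j * snd p ^ k) * f (r *\<^sub>R p))"
  have hc: "continuous_on {p. rho m p = 0} h"
    unfolding h_def by (intro continuous_intros frc)
  note hm = continuous_on_measurable_fefferman[OF m hc]
  define g where "g = (\<lambda>u. indicator egg_param_dom u *\<^sub>R (fefferman_density m (fst u) *\<^sub>R h (egg_param m u)))"
  have gi: "integrable (lborel \<Otimes>\<^sub>M lborel) g"
    unfolding lborel_prod g_def using integral_fefferman_measure(2)[OF m hm] bnd[OF hc] by blast
  define G where "G = (\<lambda>w. LINT t|lborel. g (w, t))"
  have Gi: "integrable lborel G" unfolding G_def using lborel_pair.integrable_fst'[OF gi] .
  have "(LINT w|lborel. G w) = integral\<^sup>L (lborel \<Otimes>\<^sub>M lborel) g"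
    unfolding G_def by (rule lborel_pair.integral_fst'[OF gi])
  also have "\<dots> = (LINT p|?\<sigma>. h p)"
    unfolding lborel_prod g_def integral_fefferman_measure(1)[OF m hm] ..
  finally have Ig: "(LINT p|?\<sigma>. h p) = (LINT w|lborel. G w)" by simp
  \<comment> \<open>The power \<open>(1 - cmod w ^ (2 * m)) ^ j\<close> is
    \<open>R ^ j * R ^ j\<close>: one factor stems from \<open>cnj (fst p) ^ j\<close>, the other
    from the extracted coefficient.\<close>
  define Q where "Q = (\<lambda>w. indicator (ball 0 1) w * (fefferman_density m w * (1 - cmod w ^ (2 * m)) ^ j))"
  have G_eq: "G w = of_real (Q w) * of_real r ^ j * cnj w ^ k * (2 * pi * slice_coeff f j (of_real r * w))" for w
  proof (cases "cmod w < 1")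
    case False
    then have "g (w, t) = 0" for t by (simp add: g_def egg_param_dom_def)
    then show ?thesis using False by (simp add: G_def Q_def)
  next
    case True
    have lt: "cmod w ^ (2 * m) < 1" using True m by (simp add: power_less_one_iff)
    define R where "R = sqrt (1 - cmod w ^ (2 * m))"
    have R2: "R ^ 2 = 1 - cmod w ^ (2 * m)" and R0: "R > 0" using lt by (simp_all add: R_def)
    have "rho m (of_real R, w) = 0" using R0 R2 by (simp add: rho_def)
    from rE[OF this] have e: "(of_real (r * R), of_real r * w) \<in> egg m" by (simp add: scaleR_conv_of_real)
    have gt: "g (w, t) = indicator {0..<2 * pi} t *\<^sub>R (of_real (fefferman_density m w) * (of_real R ^ j * cnj w ^ k * (f (cis t * of_real (r * R), of_real r * w) * cis (- (real j * t)))))" for t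
    proof -
      have cc: "cnj (cis t) ^ j = cis (- (real j * t))" by (simp add: cis_cnj Complex.DeMoivre)
      have hh: "h (egg_param m (w, t)) = of_real R ^ j * cnj w ^ k * (f (cis t * of_real (r * R), of_real r * w) * cis (- (real j * t)))"
        unfolding h_def egg_param_def fst_conv snd_conv R_def[symmetric] complex_cnj_mult power_mult_distrib cc[symmetric]
        by (simp add: scaleR_conv_of_real power_mult_distrib mult_ac)
      show ?thesis unfolding g_def hh fst_conv using True
        by (simp add: indicator_def egg_param_dom_def scaleR_conv_of_real)
    qed
    have fc': "continuous_on UNIV (\<lambda>t. f (cis t * of_real (r * R), of_real r * w) * cis (- (real j * t)))"
      using egg_mono[OF e] by (intro continuous_intros continuous_on_compose2[OF fc]) (auto simp: norm_mult)
    have "G w = (LINT t|lborel. indicator {0..2 * pi} t *\<^sub>R (of_real (fefferman_density m w) * (of_real R ^ j * cnj w ^ k * (f (cis t * of_real (r * R), of_real r * w) * cis (- (real j * t))))))"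
      unfolding G_def gt
    proof (rule integral_cong_AE)
      have *: "(\<lambda>t. indicator A t *\<^sub>R (of_real (fefferman_density m w) * (of_real R ^ j * cnj w ^ k * (f (cis t * of_real (r * R), of_real r * w) * cis (- (real j * t)))))) \<in> borel_measurable lborel"
        if "A \<in> sets borel" for A
        unfolding measurable_lborel2
        by (intro borel_measurable_scaleR borel_measurable_indicator that borel_measurable_continuous_onI continuous_on_mult continuous_on_const fc')
      show "(\<lambda>t. indicator {0..<2 * pi} t *\<^sub>R (of_real (fefferman_density m w) * (of_real R ^ j * cnj w ^ k * (f (cis t * of_real (r * R), of_real r * w) * cis (- (real j * t)))))) \<in> borel_measurable lborel"
        "(\<lambda>t. indicator {0..2 * pi} t *\<^sub>R (of_real (fefferman_density m w) * (of_real R ^ j * cnj w ^ k * (f (cis t * of_real (r * R), of_real r * w) * cis (- (real j * t)))))) \<in> borel_measurable lborel"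
        by (rule *, simp)+
      \<comment> \<open>The chart uses the half-open interval, \<open>circle_measure\<close> the
        closed one; the endpoint is a null set.\<close>
      have "AE t in lborel. t \<noteq> 2 * pi" by (rule AE_lborel_singleton)
      then show "AE t in lborel. indicator {0..<2 * pi} t *\<^sub>R (of_real (fefferman_density m w) * (of_real R ^ j * cnj w ^ k * (f (cis t * of_real (r * R), of_real r * w) * cis (- (real j * t)))))
        = indicator {0..2 * pi} t *\<^sub>R (of_real (fefferman_density m w) * (of_real R ^ j * cnj w ^ k * (f (cis t * of_real (r * R), of_real r * w) * cis (- (real j * t)))))"
      proof eventually_elim
        case (elim t)
        then have "indicator {0..<2 * pi} t = (indicator {0..2 * pi} t :: real)" by (auto simp: indicator_def)
        then show ?case by (simp only:)
      qed
    qed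
    also have "\<dots> = (LINT t|circle_measure. of_real (fefferman_density m w) * (of_real R ^ j * cnj w ^ k * (f (cis t * of_real (r * R), of_real r * w) * cis (- (real j * t)))))"
      unfolding circle_measure_def by (subst integral_restrict_space) simp_all
    also have "\<dots> = of_real (fefferman_density m w) * (of_real R ^ j * cnj w ^ k * (2 * pi * complex_of_real (r * R) ^ j * slice_coeff f j (of_real r * w)))"
      by (simp only: integral_mult_right_zero integral_circle_slice_coeff[OF f m e])
    also have "\<dots> = of_real (Q w) * of_real r ^ j * cnj w ^ k * (2 * pi * slice_coeff f j (of_real r * w))"
    proof -
      have "Q w = fefferman_density m w * (R ^ j * R ^ j)"
        using True unfolding Q_def R2[symmetric] power2_eq_square power_mult_distrib by simp
      then show ?thesis by (simp add: power_mult_distrib mult_ac)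
    qed
    finally show ?thesis .
  qed
  have T: "(\<lambda>(s, w). cis s * w) \<in> measurable (circle_measure \<Otimes>\<^sub>M lborel) (lborel :: complex measure)"
  proof -
    have "(\<lambda>t. t) \<in> circle_measure \<rightarrow>\<^sub>M borel" by (rule measurable_circle_measure) simp
    then have id: "(\<lambda>x. (fst x, snd x)) \<in> circle_measure \<Otimes>\<^sub>M (lborel :: complex measure) \<rightarrow>\<^sub>M borel \<Otimes>\<^sub>M borel"
      by (intro measurable_Pair) (rule measurable_compose[OF measurable_fst], simp, rule measurable_compose[OF measurable_snd], simp)
    have c: "(\<lambda>x::real \<times> complex. cis (fst x) * snd x) \<in> borel_measurable (borel \<Otimes>\<^sub>M borel)"
      unfolding borel_prod by (rule borel_measurable_continuous_onI) (intro continuous_intros)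
    show ?thesis
      using measurable_compose[OF id c] by (simp only: case_prod_unfold fst_conv snd_conv measurable_lborel1)
  qed
  have in2: "(LINT s|circle_measure. G (cis s * w))
      = 2 * pi * (2 * pi * (taylor_coeff f j k * of_real r ^ j * of_real r ^ k)) * of_real (Q w * cmod w ^ (2 * k))" for w
  proof (cases "cmod w < 1")
    case False
    then have "Q (cis s * w) = 0" "Q w = 0" for s by (simp_all add: Q_def norm_mult)
    then show ?thesis by (simp add: G_eq)
  next
    case True
    have Qr: "Q (cis s * w) = Q w" for s by (simp add: Q_def fefferman_density_def norm_mult indicator_def)
    have cc: "cnj (cis s) ^ k = cis (- (real k * s))" for s by (simp add: cis_cnj Complex.DeMoivre)
    have "G (cis s * w) = of_real (Q w) * of_real r ^ j * cnj w ^ k * (2 * pi) * (slice_coeff f j (cis s * (of_real r * w)) * cis (- (real k * s)))" for s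
      unfolding G_eq Qr complex_cnj_mult power_mult_distrib cc by (simp add: mult.left_commute[of "of_real r"] mult_ac)
    then have "(LINT s|circle_measure. G (cis s * w))
       = of_real (Q w) * of_real r ^ j * cnj w ^ k * (2 * pi) * (LINT s|circle_measure. slice_coeff f j (cis s * (of_real r * w)) * cis (- (real k * s)))"
      by (simp only: integral_mult_right_zero)
    also have "(LINT s|circle_measure. slice_coeff f j (cis s * (of_real r * w)) * cis (- (real k * s)))
        = 2 * pi * taylor_coeff f j k * (of_real r * w) ^ k"
    proof (rule integral_slice_coeff[OF f m])
      have "r * cmod w \<le> 1 * cmod w" using r by (intro mult_right_mono) auto
      then show "cmod (of_real r * w) < 1" using True r by (simp add: norm_mult)
    qed
    also have "of_real (Q w) * of_real r ^ j * cnj w ^ k * (2 * pi) * (2 * pi * taylor_coeff f j k * (of_real r * w) ^ k)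
        = 2 * pi * (2 * pi * (taylor_coeff f j k * of_real r ^ j * of_real r ^ k)) * (of_real (Q w) * (w * cnj w) ^ k)"
      by (simp add: power_mult_distrib mult_ac)
    also have "(w * cnj w) ^ k = of_real (cmod w ^ (2 * k))"
      by (simp add: complex_norm_square[symmetric] power_mult)
    finally show ?thesis by simp
  qed
  have "2 * pi * (2 * pi * (taylor_coeff f j k * of_real r ^ j * of_real r ^ k)) * (LINT w|lborel. complex_of_real (Q w * cmod w ^ (2 * k)))
      = (LINT w|lborel. LINT s|circle_measure. G (cis s * w))"
    unfolding in2 by simp
  also have "\<dots> = (2 * pi) *\<^sub>R (LINT w|lborel. G w)"
    using rotation_average(2)[OF sigma_finite_lborel finite_measure_circle_measure T _ Gi] distr_lborel_rotate[of "cis _"]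
    by simp
  finally have "2 * pi * (2 * pi * (taylor_coeff f j k * of_real r ^ j * of_real r ^ k)) * (LINT w|lborel. complex_of_real (Q w * cmod w ^ (2 * k)))
      = (2 * pi) *\<^sub>R (LINT w|lborel. G w)" .
  moreover have "g = 2 * pi * X * I" if "2 * pi * (2 * pi * X) * I = (2 * pi) *\<^sub>R g" for X I g :: complex
  proof -
    have "complex_of_real (2 * pi) * g = of_real (2 * pi) * (of_real (2 * pi) * X * I)"
      using that by (simp only: scaleR_conv_of_real mult.assoc)
    then show ?thesis by (subst (asm) mult_left_cancel) auto
  qed
  ultimately have "(LINT w|lborel. G w) = 2 * pi * (taylor_coeff f j k * of_real r ^ j * of_real r ^ k) * (LINT w|lborel. complex_of_real (Q w * cmod w ^ (2 * k)))"
    by blast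
  also have "(LINT w|lborel. complex_of_real (Q w * cmod w ^ (2 * k))) = of_real (pi * real m powr (2/3) * fact j / (m * pochhammer ((real k + (real m + 2) / 3) / m) (Suc j)))"
    using hardy_moment[OF m, of j k] by (simp only: Q_def mult.assoc)
  also have "2 * pi * (taylor_coeff f j k * of_real r ^ j * of_real r ^ k) * of_real (pi * real m powr (2/3) * fact j / (m * pochhammer ((real k + (real m + 2) / 3) / m) (Suc j)))
     = (taylor_coeff f j k * of_real r ^ j * of_real r ^ k) * of_real (2 * pi * (pi * real m powr (2/3) * fact j / (m * pochhammer ((real k + (real m + 2) / 3) / m) (Suc j))))"
    by (simp del: pochhammer_Suc)
  finally show "(LINT p|?\<sigma>. cnj (fst p ^ j * snd p ^ k) * f (r *\<^sub>R p))
     = taylor_coeff f j k * r ^ j * r ^ k / of_real (egg_coeff m (hardy_e m) (hardy_A0 m) (hardy_A1 m) 0 j k)"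
    unfolding hardy_coeff[OF m] h_def[symmetric] Ig by simp
qed

section \<open>Non-tangential approach\<close>

definition rho_grad :: "nat \<Rightarrow> C2 \<Rightarrow> C2" where
  "rho_grad m \<xi> = (2 *\<^sub>R fst \<xi>, (2 * m * cmod (snd \<xi>) ^ (2 * (m - 1))) *\<^sub>R snd \<xi>)"

lemma has_derivative_rho: "(rho m has_derivative (\<lambda>h. rho_grad m \<xi> \<bullet> h)) (at \<xi>)"
proof -
  define \<psi> where "\<psi> = (\<lambda>r::real\<times>real. fst r + snd r ^ m - 1)"
  have rho: "rho m = (\<lambda>q. \<psi> (radii q))"
    by (simp add: fun_eq_iff \<psi>_def radii_def rho_def flip: power_mult)
  have "(\<psi> has_derivative (\<lambda>h. fst h + (real m * snd (radii \<xi>) ^ (m - 1)) * snd h)) (at (radii \<xi>))"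
    unfolding \<psi>_def by (auto intro!: derivative_eq_intros simp: fun_eq_iff)
  from has_derivative_compose[OF has_derivative_radii this]
  have "(rho m has_derivative (\<lambda>h. 2 * Re (cnj (fst \<xi>) * fst h) + real m * snd (radii \<xi>) ^ (m - 1) * (2 * Re (cnj (snd \<xi>) * snd h)))) (at \<xi>)"
    unfolding rho by simp
  then show ?thesis
    by (rule has_derivative_eq_rhs)
       (simp add: fun_eq_iff rho_grad_def inner_prod_def inner_complex_def radii_def power_mult, simp add: algebra_simps)
qed

lemma outward_normal_eq: "outward_normal m \<xi> = sgn (rho_grad m \<xi>)"
  unfolding outward_normal_def frechet_derivative_at[OF has_derivative_rho, symmetric]
  by (simp add: euclidean_representation)

lemma rho_grad_inner:
  assumes "m \<ge> 1"
  shows "\<xi> \<bullet> rho_grad m \<xi> = 2 * cmod (fst \<xi>) ^ 2 + 2 * m * cmod (snd \<xi>) ^ (2 * m)"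
proof -
  have "cmod (snd \<xi>) ^ (2 * m) = cmod (snd \<xi>) ^ (2 * (m - 1)) * cmod (snd \<xi>) ^ 2"
  proof -
    have e: "2 * m = 2 * (m - 1) + 2" using assms by simp
    show ?thesis by (subst e) (rule power_add)
  qed
  then show ?thesis by (simp add: rho_grad_def inner_prod_def dot_square_norm)
qed

text \<open>Uniform transversality of the radial direction:
  \<open>\<xi> \<bullet> rho_grad m \<xi> \<ge> 2\<close> with a bounded gradient, also at
  \<open>w = 0\<close> where the \<open>w\<close> part of the gradient vanishes. The bound
  \<open>3 / 2\<close> is a rational stand-in for \<open>sqrt 2\<close>.\<close>

lemma rho_grad_bounds:
  assumes m: "m \<ge> 1" and \<xi>: "rho m \<xi> = 0"
  shows "\<xi> \<bullet> rho_grad m \<xi> \<ge> 2" "norm (rho_grad m \<xi>) \<le> 2 + 2 * m" "norm (rho_grad m \<xi>) > 0" "norm \<xi> \<le> 3 / 2"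
proof -
  have e: "cmod (fst \<xi>) ^ 2 + cmod (snd \<xi>) ^ (2 * m) = 1" using \<xi> by (simp add: rho_def)
  have "1 * cmod (snd \<xi>) ^ (2 * m) \<le> m * cmod (snd \<xi>) ^ (2 * m)" using m by (intro mult_right_mono) auto
  then show 1: "\<xi> \<bullet> rho_grad m \<xi> \<ge> 2" using e by (simp add: rho_grad_inner[OF m])
  have "\<xi> \<in> cegg m" using \<xi> by (simp add: cegg_def)
  note c = cegg_cmod_le_1[OF this m]
  have "cmod (snd \<xi>) ^ (2 * (m - 1)) * cmod (snd \<xi>) \<le> 1 * 1" using c by (intro mult_mono power_le_one) auto
  then have "real m * (cmod (snd \<xi>) ^ (2 * (m - 1)) * cmod (snd \<xi>)) \<le> real m * 1" by (intro mult_left_mono) auto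
  moreover have "norm (rho_grad m \<xi>) \<le> norm (fst (rho_grad m \<xi>)) + norm (snd (rho_grad m \<xi>))"
    unfolding norm_prod_def by (rule sqrt_sum_squares_le_sum) simp_all
  moreover have "norm (fst (rho_grad m \<xi>)) = 2 * cmod (fst \<xi>)" "norm (snd (rho_grad m \<xi>)) = 2 * (m * (cmod (snd \<xi>) ^ (2 * (m - 1)) * cmod (snd \<xi>)))"
    by (simp_all add: rho_grad_def)
  ultimately show "norm (rho_grad m \<xi>) \<le> 2 + 2 * m" using c by linarith
  show "norm (rho_grad m \<xi>) > 0" using 1 by auto
  have "norm \<xi> ^ 2 = cmod (fst \<xi>) ^ 2 + cmod (snd \<xi>) ^ 2" by (simp add: norm_prod_def)
  also have "\<dots> \<le> 1 + 1" using c by (intro add_mono power_le_one) auto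
  also have "\<dots> \<le> (3 / 2) ^ 2" by (simp add: power2_eq_square)
  finally show "norm \<xi> \<le> 3 / 2" by (rule power2_le_imp_le) simp
qed

text \<open>The infimum is attained at the orthogonal projection. The resulting expression varies
  continuously with \<open>\<xi>\<close>, which makes \<open>stein_delta\<close> tractable.\<close>

lemma infdist_tangent_plane:
  assumes m: "m \<ge> 1" and \<xi>: "rho m \<xi> = 0"
  shows "infdist p (tangent_plane m \<xi>) = \<bar>(p - \<xi>) \<bullet> outward_normal m \<xi>\<bar>"
proof -
  define \<nu> where "\<nu> = outward_normal m \<xi>"
  have \<nu>1: "norm \<nu> = 1" using rho_grad_bounds(3)[OF m \<xi>] by (auto simp: \<nu>_def outward_normal_eq norm_sgn)
  then have \<nu>2: "\<nu> \<bullet> \<nu> = 1" by (simp add: dot_square_norm)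
  define q where "q = p - ((p - \<xi>) \<bullet> \<nu>) *\<^sub>R \<nu>"
  have q: "q \<in> tangent_plane m \<xi>"
    by (simp add: tangent_plane_def \<nu>_def[symmetric] q_def inner_diff_left \<nu>2)
  show ?thesis unfolding \<nu>_def[symmetric]
  proof (rule antisym)
    have "infdist p (tangent_plane m \<xi>) \<le> dist p q" using q by (rule infdist_le)
    also have "\<dots> = \<bar>(p - \<xi>) \<bullet> \<nu>\<bar>" by (simp add: q_def dist_norm \<nu>1)
    finally show "infdist p (tangent_plane m \<xi>) \<le> \<bar>(p - \<xi>) \<bullet> \<nu>\<bar>" .
    have "\<bar>(p - \<xi>) \<bullet> \<nu>\<bar> \<le> (INF a\<in>tangent_plane m \<xi>. dist p a)"
    proof (rule cINF_greatest)
      fix a assume "a \<in> tangent_plane m \<xi>"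
      then have "(a - \<xi>) \<bullet> \<nu> = 0" by (simp add: tangent_plane_def \<nu>_def)
      then have "(p - \<xi>) \<bullet> \<nu> = (p - a) \<bullet> \<nu>" by (simp add: inner_diff_left)
      then show "\<bar>(p - \<xi>) \<bullet> \<nu>\<bar> \<le> dist p a"
        using Cauchy_Schwarz_ineq2[of "p - a" \<nu>] by (simp add: \<nu>1 dist_norm)
    qed (use q in auto)
    then show "\<bar>(p - \<xi>) \<bullet> \<nu>\<bar> \<le> infdist p (tangent_plane m \<xi>)"
      using q by (subst infdist_notempty) auto
  qed
qed

text \<open>\<open>nt_maximal m \<alpha> f\<close> is lower semicontinuous: each \<open>p\<close> lies in the approach regions of a
  relatively open set of boundary points.\<close>

lemma nt_maximal_measurable:
  assumes m: "m \<ge> 1"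
  shows "nt_maximal m \<alpha> f \<in> borel_measurable (fefferman_measure m)"
proof -
  define F where "F = {p. rho m p = 0}"
  have gc: "continuous_on F (rho_grad m)" unfolding rho_grad_def by (intro continuous_intros)
  have nc: "continuous_on F (outward_normal m)"
    unfolding outward_normal_eq using rho_grad_bounds(3)[OF m]
    by (intro continuous_on_sgn gc) (auto simp: F_def)
  have op: "openin (top_of_set F) {\<xi> \<in> F. p \<in> approach_region m \<alpha> \<xi>}" for p
  proof (cases "p \<in> egg m")
    case False
    then show ?thesis by (simp add: approach_region_def)
  next
    case True
    define d where "d = (\<lambda>\<xi>. min (infdist p (frontier (egg m))) \<bar>(p - \<xi>) \<bullet> outward_normal m \<xi>\<bar>)"
    have dc: "continuous_on F d" unfolding d_def by (intro continuous_intros nc)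
    define g1 where "g1 = (\<lambda>\<xi>. cmod ((fst \<xi> - fst p) * cnj (fst (outward_normal m \<xi>))
            + (snd \<xi> - snd p) * cnj (snd (outward_normal m \<xi>))) - (1 + \<alpha>) * d \<xi>)"
    define g2 where "g2 = (\<lambda>\<xi>. norm (\<xi> - p) ^ 2 - \<alpha> * d \<xi>)"
    have "continuous_on F g1" "continuous_on F g2"
      unfolding g1_def g2_def by (intro continuous_intros nc dc)+
    then have "openin (top_of_set F) (F \<inter> g1 -` {..<0})" "openin (top_of_set F) (F \<inter> g2 -` {..<0})"
      by (auto intro: continuous_openin_preimage_gen)
    then have "openin (top_of_set F) ((F \<inter> g1 -` {..<0}) \<inter> (F \<inter> g2 -` {..<0}))" by (rule openin_Int)
    also have "(F \<inter> g1 -` {..<0}) \<inter> (F \<inter> g2 -` {..<0}) = {\<xi> \<in> F. p \<in> approach_region m \<alpha> \<xi>}"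
      using True by (auto simp: approach_region_def stein_delta_def F_def infdist_tangent_plane[OF m] g1_def g2_def d_def)
    finally show ?thesis .
  qed
  show ?thesis
  proof (rule borel_measurableI_greater)
    fix y
    have eq: "{\<xi> \<in> space (fefferman_measure m). y < nt_maximal m \<alpha> f \<xi>}
        = \<Union> ((\<lambda>p. {\<xi> \<in> F. p \<in> approach_region m \<alpha> \<xi>}) ` {p. y < ennreal (cmod (f p))})"
      by (auto simp: space_fefferman_measure[OF m] F_def nt_maximal_def less_SUP_iff)
    have "openin (top_of_set F) {\<xi> \<in> space (fefferman_measure m). y < nt_maximal m \<alpha> f \<xi>}"
      unfolding eq by (rule openin_Union) (use op in blast)
    then obtain O' where O': "open O'" "{\<xi> \<in> space (fefferman_measure m). y < nt_maximal m \<alpha> f \<xi>} = F \<inter> O'"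
      unfolding openin_open by blast
    show "{\<xi> \<in> space (fefferman_measure m). y < nt_maximal m \<alpha> f \<xi>} \<in> sets (fefferman_measure m)"
      unfolding O'(2) sets_fefferman_measure sets_restrict_space frontier_egg[OF m] F_def[symmetric]
      using O'(1) by (intro imageI borel_open)
  qed
qed

text \<open>A second-order Taylor bound with a uniform constant, by induction: the bound for
  \<open>m\<close> is multiplied by \<open>b\<close>. The range up to 4 fits the later use with
  \<open>b = cmod (w + e) ^ 2\<close>, where \<open>cmod w\<close> and \<open>cmod e\<close> are at
  most 1.\<close>

lemma power_taylor_bound:
  shows "\<exists>C\<ge>0. \<forall>(a::real) (b::real). 0 \<le> a \<longrightarrow> a \<le> 4 \<longrightarrow> 0 \<le> b \<longrightarrow> b \<le> 4 \<longrightarrow> b ^ m \<le> a ^ m + m * a ^ (m - 1) * (b - a) + C * (b - a)^2"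
proof (induction m)
  case 0
  show ?case by (rule exI[of _ 0]) simp
next
  case (Suc m)
  then obtain C where "C \<ge> 0 \<and> (\<forall>(a::real) (b::real). 0 \<le> a \<longrightarrow> a \<le> 4 \<longrightarrow> 0 \<le> b \<longrightarrow> b \<le> 4 \<longrightarrow> b ^ m \<le> a ^ m + m * a ^ (m - 1) * (b - a) + C * (b - a)^2)"
    by (rule exE)
  note C = conjunct1[OF this] conjunct2[OF this, rule_format]
  show ?case
  proof (intro exI[of _ "4 * C + m * 4 ^ (m - 1)"] conjI allI impI)
    show "0 \<le> 4 * C + m * 4 ^ (m - 1)" using C by simp
    fix a b :: real assume ab: "0 \<le> a" "a \<le> 4" "0 \<le> b" "b \<le> 4"
    have am: "real m * a ^ m = real m * a ^ (m - 1) * a" by (cases m) simp_all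
    have "b * b ^ m \<le> b * (a ^ m + m * a ^ (m - 1) * (b - a) + C * (b - a)^2)"
      using ab by (intro mult_left_mono C(2)) auto
    also have "\<dots> = a ^ Suc m + (a ^ m + m * a ^ (m - 1) * a) * (b - a) + b * C * (b - a)^2 + m * a ^ (m - 1) * (b - a)^2"
      by (simp add: algebra_simps power2_eq_square)
    also have "\<dots> \<le> a ^ Suc m + (a ^ m + m * a ^ (m - 1) * a) * (b - a) + 4 * C * (b - a)^2 + m * 4 ^ (m - 1) * (b - a)^2"
    proof -
      have "b * C * (b - a)^2 \<le> 4 * C * (b - a)^2" using ab C(1) by (intro mult_right_mono) auto
      moreover have "a ^ (m - 1) \<le> 4 ^ (m - 1)" using ab by (intro power_mono) auto
      then have "m * a ^ (m - 1) * (b - a)^2 \<le> m * 4 ^ (m - 1) * (b - a)^2" by (intro mult_right_mono) (simp_all add: mult_left_mono)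
      ultimately show ?thesis by linarith
    qed
    also have "\<dots> = a ^ Suc m + Suc m * a ^ (Suc m - 1) * (b - a) + (4 * C + m * 4 ^ (m - 1)) * (b - a)^2"
      unfolding am[symmetric] by (simp add: algebra_simps)
    finally show "b ^ Suc m \<le> a ^ Suc m + Suc m * a ^ (Suc m - 1) * (b - a) + (4 * C + m * 4 ^ (m - 1)) * (b - a)^2"
      by simp
  qed
qed

lemma rho_taylor_bound:
  assumes m: "m \<ge> 1"
  shows "\<exists>K\<ge>0. \<forall>\<xi> p. rho m \<xi> = 0 \<longrightarrow> norm (p - \<xi>) \<le> 1 \<longrightarrow> rho m p \<le> rho_grad m \<xi> \<bullet> (p - \<xi>) + K * norm (p - \<xi>) ^ 2"
proof -
  obtain C where "C \<ge> 0 \<and> (\<forall>(a::real) (b::real). 0 \<le> a \<longrightarrow> a \<le> 4 \<longrightarrow> 0 \<le> b \<longrightarrow> b \<le> 4 \<longrightarrow> b ^ m \<le> a ^ m + m * a ^ (m - 1) * (b - a) + C * (b - a)^2)"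
    using power_taylor_bound[of m] by (rule exE)
  note C = conjunct1[OF this] conjunct2[OF this, rule_format]
  show ?thesis
  \<comment> \<open>\<open>1\<close> and \<open>m\<close> absorb the squares
    \<open>cmod d ^ 2\<close> in \<open>cmod (z + d) ^ 2\<close> and \<open>cmod e ^ 2\<close> in
    \<open>b - a\<close>; \<open>9 * C\<close> comes from
    \<open>\<bar>b - a\<bar> \<le> 3 * cmod e\<close>.\<close>
  proof (intro exI[of _ "1 + real m + 9 * C"] conjI allI impI)
    show "0 \<le> 1 + real m + 9 * C" using C by simp
    fix \<xi> p assume \<xi>: "rho m \<xi> = 0" and p: "norm (p - \<xi>) \<le> 1"
    define z w d e where "z = fst \<xi>" and "w = snd \<xi>" and "d = fst (p - \<xi>)" and "e = snd (p - \<xi>)"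
    define N where "N = norm (p - \<xi>) ^ 2"
    have N: "N = cmod d ^ 2 + cmod e ^ 2" by (simp add: N_def d_def e_def norm_prod_def)
    have "p - \<xi> = (d, e)" unfolding d_def e_def by (rule surjective_pairing)
    then have e1: "cmod e \<le> 1" using p norm_snd_le[of e d] by simp
    have "\<xi> \<in> cegg m" using \<xi> by (simp add: cegg_def)
    note c = cegg_cmod_le_1[OF this m]
    have w1: "cmod w \<le> 1" using c by (simp add: w_def)
    define a b where "a = cmod w ^ 2" and "b = cmod (w + e) ^ 2"
    have a: "0 \<le> a" "a \<le> 1" using w1 by (simp_all add: a_def power_le_one)
    have "cmod (w + e) \<le> 2" using norm_triangle_ineq[of w e] w1 e1 by linarith
    then have b: "0 \<le> b" "b \<le> 4" using power_mono[of "cmod (w + e)" 2 2] by (simp_all add: b_def)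
    have ba: "b - a = 2 * (w \<bullet> e) + cmod e ^ 2"
      by (simp add: a_def b_def power2_norm_eq_inner inner_add_left inner_add_right inner_commute)
    have "\<bar>w \<bullet> e\<bar> \<le> cmod w * cmod e" by (rule Cauchy_Schwarz_ineq2)
    also have "\<dots> \<le> 1 * cmod e" using w1 by (intro mult_right_mono) auto
    finally have we: "\<bar>w \<bullet> e\<bar> \<le> cmod e" by simp
    have "cmod e ^ 2 \<le> cmod e" using e1 by (simp add: power2_eq_square mult_left_le)
    then have "\<bar>b - a\<bar> \<le> 3 * cmod e" using we zero_le_power2[of "cmod e"] unfolding ba by linarith
    then have "\<bar>b - a\<bar> ^ 2 \<le> (3 * cmod e) ^ 2" by (intro power_mono) auto
    then have ba2: "(b - a) ^ 2 \<le> 9 * cmod e ^ 2" by (simp add: power_mult_distrib)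
    have z2: "cmod (z + d) ^ 2 = cmod z ^ 2 + 2 * (z \<bullet> d) + cmod d ^ 2"
      by (simp add: power2_norm_eq_inner inner_add_left inner_add_right inner_commute)
    have am: "real m * a ^ (m - 1) \<le> real m * 1" using a by (intro mult_left_mono power_le_one) auto
    have "b ^ m \<le> a ^ m + m * a ^ (m - 1) * (b - a) + C * (b - a)^2"
      using a b by (intro C(2)) auto
    also have "\<dots> \<le> a ^ m + m * a ^ (m - 1) * (2 * (w \<bullet> e)) + real m * 1 * cmod e ^ 2 + C * (9 * cmod e ^ 2)"
    proof -
      have "real m * a ^ (m - 1) * cmod e ^ 2 \<le> real m * 1 * cmod e ^ 2" using am by (intro mult_right_mono) auto
      moreover have "C * (b - a)^2 \<le> C * (9 * cmod e ^ 2)" using ba2 C(1) by (rule mult_left_mono)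
      ultimately show ?thesis unfolding ba by (simp add: algebra_simps)
    qed
    finally have bm: "b ^ m \<le> a ^ m + m * a ^ (m - 1) * (2 * (w \<bullet> e)) + m * cmod e ^ 2 + 9 * C * cmod e ^ 2" by simp
    have pe: "fst p = z + d" "snd p = w + e" by (simp_all add: z_def d_def w_def e_def)
    have "rho m p = cmod (z + d) ^ 2 + b ^ m - 1" by (simp add: rho_def pe b_def flip: power_mult)
    moreover have "cmod z ^ 2 + a ^ m - 1 = 0" using \<xi> by (simp add: rho_def z_def w_def a_def flip: power_mult)
    moreover have "rho_grad m \<xi> \<bullet> (p - \<xi>) = 2 * (z \<bullet> d) + m * a ^ (m - 1) * (2 * (w \<bullet> e))"
      by (simp add: rho_grad_def inner_prod_def z_def w_def d_def e_def a_def flip: power_mult)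
    moreover have "cmod d ^ 2 + m * cmod e ^ 2 + 9 * C * cmod e ^ 2 \<le> (1 + real m + 9 * C) * N"
    proof -
      have "0 \<le> (real m + 9 * C) * cmod d ^ 2" "0 \<le> cmod e ^ 2" using C by simp_all
      then show ?thesis unfolding N by (simp add: algebra_simps)
    qed
    ultimately show "rho m p \<le> rho_grad m \<xi> \<bullet> (p - \<xi>) + (1 + real m + 9 * C) * norm (p - \<xi>) ^ 2"
      using bm z2 unfolding N_def by linarith
  qed
qed

text \<open>The inner normal direction may be replaced by the radial one: \<open>r *\<^sub>R \<xi>\<close> tends to \<open>\<xi>\<close>
  within the approach region, uniformly in \<open>\<xi>\<close>.\<close>

lemma scaleR_in_approach_region:
  assumes m: "m \<ge> 1" and \<alpha>: "\<alpha> > 0"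
  shows "\<exists>t0>0. t0 < 1 \<and> (\<forall>t \<xi>. 0 < t \<longrightarrow> t < t0 \<longrightarrow> rho m \<xi> = 0 \<longrightarrow> (1 - t) *\<^sub>R \<xi> \<in> approach_region m \<alpha> \<xi>)"
proof -
  obtain K where "K \<ge> 0 \<and> (\<forall>\<xi> p. rho m \<xi> = 0 \<longrightarrow> norm (p - \<xi>) \<le> 1 \<longrightarrow> rho m p \<le> rho_grad m \<xi> \<bullet> (p - \<xi>) + K * norm (p - \<xi>) ^ 2)"
    using rho_taylor_bound[OF m] by (rule exE)
  note K = conjunct1[OF this] conjunct2[OF this, rule_format]
  \<comment> \<open>Chosen so that
    \<open>(1 + \<alpha>) * (1 - \<epsilon>) = 1 + \<alpha> / 2 > 1\<close>: even if
    \<open>stein_delta\<close> falls short of \<open>t * s\<close> by the factor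
    \<open>1 - \<epsilon>\<close>, the first condition of the region holds.\<close>
  define \<epsilon> where "\<epsilon> = \<alpha> / (2 * (1 + \<alpha>))"
  have \<epsilon>: "0 < \<epsilon>" "\<epsilon> < 1" using \<alpha> by (simp_all add: \<epsilon>_def)
  have "(1 + \<alpha>) * \<epsilon> = \<alpha> / 2" using \<alpha> by (simp add: \<epsilon>_def divide_simps)
  then have \<epsilon>\<alpha>: "(1 + \<alpha>) * (1 - \<epsilon>) > 1" using \<alpha> by (simp add: right_diff_distrib)
  \<comment> \<open>The three bounds keep \<open>norm (p - \<xi>)\<close> at most 1, make the
    quadratic Taylor remainder smaller than the linear gain \<open>2 * \<epsilon> * t\<close>, and
    secure the condition on \<open>norm (\<xi> - x) ^ 2\<close>.\<close>
  define t0 where "t0 = min (1 / 3) (min (2 * \<epsilon> / (9 * K + 1)) (\<alpha> * (1 - \<epsilon>) / (3 * (1 + m))))"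
  have t0: "t0 > 0" "t0 < 1" using \<epsilon> \<alpha> K(1) by (auto simp: t0_def)
  have "(1 - t) *\<^sub>R \<xi> \<in> approach_region m \<alpha> \<xi>" if t: "0 < t" "t < t0" and \<xi>: "rho m \<xi> = 0" for t \<xi>
  proof -
    note b = rho_grad_bounds[OF m \<xi>]
    define v where "v = rho_grad m \<xi>"
    define \<nu> where "\<nu> = outward_normal m \<xi>"
    have \<nu>: "\<nu> = v /\<^sub>R norm v" by (simp add: \<nu>_def v_def outward_normal_eq sgn_div_norm)
    have \<nu>1: "norm \<nu> = 1" using b(3) by (simp add: \<nu> v_def)
    define s where "s = \<xi> \<bullet> \<nu>"
    have vs: "norm v * s = \<xi> \<bullet> v" using b(3) by (simp add: s_def \<nu> v_def)
    have v0: "norm v > 0" using b(3) by (simp add: v_def)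
    have s1: "s \<ge> 1 / (1 + m)"
    proof -
      have 2: "2 \<le> norm v * s" using vs b(1) by (simp add: v_def)
      then have "s > 0" using v0 zero_less_mult_pos[of "norm v" s] by linarith
      then have "norm v * s \<le> (2 + 2 * m) * s" using b(2) by (intro mult_right_mono) (simp_all add: v_def)
      then have "2 \<le> (2 + 2 * real m) * s" using 2 by simp
      then show ?thesis by (simp add: field_simps)
    qed
    moreover have "1 / real (1 + m) > 0" by simp
    ultimately have s0: "s > 0" by linarith
    have "s \<le> norm \<xi> * norm \<nu>" unfolding s_def by (rule norm_cauchy_schwarz)
    then have s2: "s \<le> 3 / 2" using b(4) \<nu>1 by simp
    have t1: "t < 1 / 3" "t < 2 * \<epsilon> / (9 * K + 1)" "t < \<alpha> * (1 - \<epsilon>) / (3 * (1 + m))"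
      using t by (auto simp: t0_def)
    define x where "x = (1 - t) *\<^sub>R \<xi>"
    have xin: "x \<in> egg m" unfolding x_def egg_iff using t t1 by (intro rho_scaleR_le[OF \<xi> _ _ m]) auto
    \<comment> \<open>Radius of a ball around \<open>x\<close> inside the egg. Since
      \<open>t * s\<close> is the exact distance from \<open>x\<close> to the tangent plane,
      \<open>d\<close> bounds \<open>stein_delta\<close> from below.\<close>
    define d where "d = t * (1 - \<epsilon>) * s"
    have d0: "d > 0" using t \<epsilon> s0 by (simp add: d_def)
    have dts: "d \<le> t * s"
    proof -
      have "t * s * (1 - \<epsilon>) \<le> t * s * 1" using t \<epsilon> s0 by (intro mult_left_mono) auto
      then show ?thesis by (simp add: d_def mult_ac)
    qed
    have inb: "p \<in> egg m" if p: "dist x p < d" for p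
    proof -
      have pe: "p - \<xi> = (p - x) - t *\<^sub>R \<xi>" by (simp add: x_def algebra_simps)
      have np: "norm (p - x) < d" using p by (simp add: dist_norm norm_minus_commute)
      have "norm (p - \<xi>) \<le> norm (p - x) + t * norm \<xi>" unfolding pe using norm_triangle_ineq4[of "p - x" "t *\<^sub>R \<xi>"] t by simp
      also have "\<dots> \<le> t * s + t * (3 / 2)" using np dts b(4) t by (intro add_mono mult_left_mono) auto
      also have "\<dots> \<le> t * (3 / 2) + t * (3 / 2)" using s2 t by (intro add_mono mult_left_mono) auto
      finally have n3: "norm (p - \<xi>) \<le> 3 * t" by simp
      then have n1: "norm (p - \<xi>) \<le> 1" using t1 by simp
      have "v \<bullet> (p - x) \<le> norm v * norm (p - x)" by (rule norm_cauchy_schwarz)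
      also have "\<dots> \<le> norm v * d" using np v0 by (intro mult_left_mono) auto
      also have "\<dots> = t * (1 - \<epsilon>) * (\<xi> \<bullet> v)" by (simp add: d_def vs[symmetric])
      finally have "v \<bullet> (p - \<xi>) \<le> t * (1 - \<epsilon>) * (\<xi> \<bullet> v) - t * (\<xi> \<bullet> v)"
        unfolding pe by (simp add: inner_diff_right inner_commute)
      also have "\<dots> = - (t * \<epsilon> * (\<xi> \<bullet> v))" by (simp add: algebra_simps)
      also have "\<dots> \<le> - (t * \<epsilon> * 2)" using t \<epsilon> b(1) by (simp add: v_def)
      finally have 1: "v \<bullet> (p - \<xi>) \<le> - (t * \<epsilon> * 2)" .
      have "K * norm (p - \<xi>) ^ 2 \<le> K * (3 * t) ^ 2" using n3 K(1) by (intro mult_left_mono power_mono) auto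
      also have "\<dots> = t * ((9 * K) * t)" by (simp add: power2_eq_square)
      also have "\<dots> < t * (2 * \<epsilon>)"
      proof -
        have "(9 * K) * t \<le> (9 * K + 1) * t" using t by (intro mult_right_mono) auto
        also have "\<dots> < 2 * \<epsilon>" using t1(2) K(1) by (simp add: field_simps)
        finally show ?thesis using t by (intro mult_strict_left_mono) auto
      qed
      finally have "rho m p < 0" using K(2)[OF \<xi> n1] 1 unfolding v_def by (simp add: mult_ac)
      then show ?thesis by (simp add: egg_iff)
    qed
    have fr: "d \<le> infdist x (frontier (egg m))"
    proof -
      have ne: "frontier (egg m) \<noteq> {}" using \<xi> unfolding frontier_egg[OF m] by blast
      have "d \<le> (INF a\<in>frontier (egg m). dist x a)"
      proof (rule cINF_greatest[OF ne], rule ccontr)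
        fix a assume "a \<in> frontier (egg m)" "\<not> d \<le> dist x a"
        then have "rho m a = 0" "rho m a < 0"
          using inb[of a] unfolding frontier_egg[OF m] egg_iff mem_Collect_eq not_le by blast+
        then show False by simp
      qed
      then show ?thesis using ne by (simp add: infdist_notempty)
    qed
    have tp: "infdist x (tangent_plane m \<xi>) = t * s"
    proof -
      have "(x - \<xi>) \<bullet> \<nu> = - (t * s)" by (simp add: x_def s_def algebra_simps inner_diff_left)
      then show ?thesis using t s0 unfolding infdist_tangent_plane[OF m \<xi>] \<nu>_def[symmetric] by simp
    qed
    have \<delta>: "d \<le> stein_delta m \<xi> x" unfolding stein_delta_def tp using fr dts by simp
    \<comment> \<open>For a radial displacement the complex product is real, because
      \<open>\<xi>\<close> paired with the gradient gives \<open>z * cnj z\<close> and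
      \<open>w * cnj w\<close> with real weights; it therefore equals the normal distance
      \<open>t * s\<close>.\<close>
    have c1: "cmod ((fst \<xi> - fst x) * cnj (fst \<nu>) + (snd \<xi> - snd x) * cnj (snd \<nu>)) = t * s"
    proof -
      have cz: "z * cnj z = of_real (cmod z ^ 2)" for z by (rule complex_norm_square[symmetric])
      have "(fst \<xi> - fst x) * cnj (fst \<nu>) + (snd \<xi> - snd x) * cnj (snd \<nu>)
          = of_real (t / norm v) * (2 * (fst \<xi> * cnj (fst \<xi>)) + of_real (2 * m * cmod (snd \<xi>) ^ (2 * (m - 1))) * (snd \<xi> * cnj (snd \<xi>)))"
        by (simp add: x_def \<nu> v_def rho_grad_def scaleR_conv_of_real algebra_simps divide_inverse)
      also have "\<dots> = of_real (t / norm v * (\<xi> \<bullet> v))"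
        unfolding cz by (simp add: v_def rho_grad_def inner_prod_def dot_square_norm algebra_simps)
      also have "t / norm v * (\<xi> \<bullet> v) = t * s" using v0 by (simp add: vs[symmetric])
      finally show ?thesis using t s0 by (simp add: norm_mult)
    qed
    have "1 * (t * s) < (1 + \<alpha>) * (1 - \<epsilon>) * (t * s)" using \<epsilon>\<alpha> t s0 by (intro mult_strict_right_mono) auto
    also have "\<dots> = (1 + \<alpha>) * d" by (simp add: d_def mult_ac)
    also have "\<dots> \<le> (1 + \<alpha>) * stein_delta m \<xi> x" using \<delta> \<alpha> by (intro mult_left_mono) auto
    finally have C1: "t * s < (1 + \<alpha>) * stein_delta m \<xi> x" by simp
    have "norm (\<xi> - x) = t * norm \<xi>" using t by (simp add: x_def algebra_simps)
    then have "norm (\<xi> - x) ^ 2 = t * (t * norm \<xi> ^ 2)" by (simp add: power_mult_distrib power2_eq_square)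
    also have "\<dots> < t * (\<alpha> * (1 - \<epsilon>) * s)"
    proof -
      have "norm \<xi> ^ 2 \<le> (3 / 2) ^ 2" using b(4) by (intro power_mono) auto
      then have "t * norm \<xi> ^ 2 \<le> t * 3" using t by (intro mult_left_mono) (auto simp: power2_eq_square)
      also have "\<dots> < \<alpha> * (1 - \<epsilon>) * (1 / (1 + m))" using t1(3) by (simp add: field_simps)
      also have "\<dots> \<le> \<alpha> * (1 - \<epsilon>) * s" using \<alpha> \<epsilon> s1 by (intro mult_left_mono) auto
      finally show ?thesis using t by (intro mult_strict_left_mono) auto
    qed
    also have "\<dots> = \<alpha> * d" by (simp add: d_def mult_ac)
    also have "\<dots> \<le> \<alpha> * stein_delta m \<xi> x" using \<delta> \<alpha> by (intro mult_left_mono) auto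
    finally have C2: "norm (\<xi> - x) ^ 2 < \<alpha> * stein_delta m \<xi> x" .
    show ?thesis using xin C1 C2 c1 unfolding approach_region_def x_def[symmetric] \<nu>_def[symmetric] by simp
  qed
  then show ?thesis using t0 by blast
qed

section \<open>The Fefferman--Szego kernel\<close>

lemma approach_region_subset: "approach_region m \<alpha> \<xi> \<subseteq> egg m"
  by (auto simp: approach_region_def)

lemma hardy_A_bounds:
  assumes "m \<ge> 1"
  shows "hardy_e m > 0" "hardy_A0 m \<ge> 0" "hardy_A1 m \<ge> 0" "(0::real) \<ge> 0" "hardy_A0 m + hardy_A1 m + 0 > 0"
proof -
  show "hardy_e m > 0" by (intro add_pos_nonneg) auto
  show 0: "hardy_A0 m \<ge> 0" using assms by (intro mult_nonneg_nonneg divide_nonneg_nonneg) auto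
  have 1: "hardy_A1 m > 0" using assms by (intro mult_pos_pos divide_pos_pos) auto
  then show "hardy_A1 m \<ge> 0" by simp
  show "hardy_A0 m + hardy_A1 m + 0 > 0" using 0 1 by linarith
qed simp

lemma continuous_on_boundary_hardy_formula:
  assumes "q \<in> egg m" "m \<ge> 1"
  shows "continuous_on {p. rho m p = 0} (\<lambda>p. hardy_formula m p q)"
  by (rule continuous_on_subset[OF continuous_on_egg_kernel2[OF assms]]) (auto simp: cegg_def)

text \<open>The kernel is bounded on the egg, hence so is its maximal function, and the measure is
  finite.\<close>

lemma hardy_formula_in_hardy:
  assumes m: "m \<ge> 1" and q: "q \<in> egg m"
  shows "(\<lambda>p. hardy_formula m p q) \<in> fefferman_hardy m \<alpha>"
proof -
  interpret \<sigma>: finite_measure "fefferman_measure m" by (rule finite_measure_fefferman_measure[OF m])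
  obtain B where B: "\<forall>p\<in>cegg m. cmod (hardy_formula m p q) \<le> B"
    using egg_kernel2_partial_sums[OF q m hardy_A_bounds(1-4)[OF m]] by blast
  have "nt_maximal m \<alpha> (\<lambda>p. hardy_formula m p q) \<xi> \<le> ennreal B" for \<xi>
    unfolding nt_maximal_def using B approach_region_subset egg_subset_cegg
    by (intro SUP_least ennreal_leI) blast
  then have "(\<integral>\<^sup>+ \<xi>. nt_maximal m \<alpha> (\<lambda>p. hardy_formula m p q) \<xi> ^ 2 \<partial>fefferman_measure m)
      \<le> (\<integral>\<^sup>+ \<xi>. ennreal B ^ 2 \<partial>fefferman_measure m)"
    by (intro nn_integral_mono power_mono) auto
  also have "\<dots> = ennreal B ^ 2 * emeasure (fefferman_measure m) (space (fefferman_measure m))" by simp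
  also have "\<dots> < \<infinity>"
    using \<sigma>.emeasure_finite by (simp add: less_top[symmetric] ennreal_mult_eq_top_iff power2_eq_square)
  finally show ?thesis
    unfolding fefferman_hardy_def using nt_maximal_measurable[OF m] holomorphic2_on_egg_kernel2[OF q m] by simp
qed

lemma hardy_formula_boundary_value:
  assumes m: "m \<ge> 1" and q: "q \<in> egg m"
  shows "has_boundary_value m \<alpha> (\<lambda>p. hardy_formula m p q) (\<lambda>p. hardy_formula m p q)"
  unfolding has_boundary_value_def
proof
  show "(\<lambda>p. hardy_formula m p q) \<in> borel_measurable (fefferman_measure m)"
    by (rule continuous_on_measurable_fefferman[OF m continuous_on_boundary_hardy_formula[OF q m]])
  show "AE \<xi> in fefferman_measure m. ((\<lambda>p. hardy_formula m p q) \<longlongrightarrow> hardy_formula m \<xi> q) (at \<xi> within approach_region m \<alpha> \<xi>)"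
  proof (rule AE_I2)
    fix \<xi> assume "\<xi> \<in> space (fefferman_measure m)"
    then have "\<xi> \<in> cegg m" by (simp add: space_fefferman_measure[OF m] cegg_def)
    then have "((\<lambda>p. hardy_formula m p q) \<longlongrightarrow> hardy_formula m \<xi> q) (at \<xi> within cegg m)"
      using continuous_on_egg_kernel2[OF q m] by (simp add: continuous_on_def)
    then show "((\<lambda>p. hardy_formula m p q) \<longlongrightarrow> hardy_formula m \<xi> q) (at \<xi> within approach_region m \<alpha> \<xi>)"
      by (rule tendsto_within_subset) (use approach_region_subset egg_subset_cegg in blast)
  qed
qed

text \<open>The dilation enters through the factors \<open>r ^ j * r ^ k\<close> of the Taylor
  coefficients, which attach themselves to the point \<open>q\<close> on resummation.\<close>

lemma hardy_reproducing_dilated: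
  assumes m: "m \<ge> 1" and q: "q \<in> egg m" and f: "holomorphic2_on f (egg m)" and r: "0 \<le> r" "r < 1"
  shows "(LINT p|fefferman_measure m. cnj (hardy_formula m p q) * f (r *\<^sub>R p)) = f (r *\<^sub>R q)"
proof (rule integral_kernel_eq_limit(1)[OF q m hardy_A_bounds[OF m]])
  show "space (fefferman_measure m) \<subseteq> cegg m" by (auto simp: space_fefferman_measure[OF m] cegg_def)
  show "(\<lambda>p. p) \<in> measurable (fefferman_measure m) borel"
    by (rule continuous_on_measurable_fefferman[OF m continuous_on_id])
  show "integrable (fefferman_measure m) (\<lambda>p. f (r *\<^sub>R p))" by (rule fefferman_moment(2)[OF m f r])
  show "(LINT p|fefferman_measure m. cnj (fst p ^ j * snd p ^ k) * f (r *\<^sub>R p))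
     = taylor_coeff f j k * r ^ j * r ^ k / of_real (egg_coeff m (hardy_e m) (hardy_A0 m) (hardy_A1 m) 0 j k)" for j k
    by (rule fefferman_moment(1)[OF m f r])
  have "(r *\<^sub>R fst q, r *\<^sub>R snd q) \<in> egg m"
    using egg_mono[of "fst q" "snd q" m "r *\<^sub>R fst q" "r *\<^sub>R snd q"] q r by (simp add: mult_left_le_one_le)
  from taylor_partial_sums_tendsto[OF f m this]
  show "(\<lambda>N. \<Sum>j<N. \<Sum>k<N. taylor_coeff f j k * r ^ j * r ^ k * fst q ^ j * snd q ^ k) \<longlonglongrightarrow> f (r *\<^sub>R q)"
    by (simp add: scaleR_conv_of_real power_mult_distrib mult_ac scaleR_prod_def)
qed

text \<open>The formula for dilations is passed to the limit. Since \<open>r *\<^sub>R \<xi>\<close>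
  lies in the approach region at \<open>\<xi>\<close>, the integrands converge almost everywhere and
  \<open>nt_maximal m \<alpha> f\<close> dominates; being square integrable for a finite measure, it
  is integrable.\<close>

lemma hardy_reproducing:
  assumes m: "m \<ge> 1" and \<alpha>: "\<alpha> > 0" and q: "q \<in> egg m"
    and f: "f \<in> fefferman_hardy m \<alpha>" and b: "has_boundary_value m \<alpha> f b"
  shows "f q = (LINT \<xi>|fefferman_measure m. cnj (hardy_formula m \<xi> q) * b \<xi>)"
proof -
  let ?\<sigma> = "fefferman_measure m"
  interpret \<sigma>: finite_measure ?\<sigma> by (rule finite_measure_fefferman_measure[OF m])
  define N where "N = nt_maximal m \<alpha> f"
  have hol: "holomorphic2_on f (egg m)" and Nm: "N \<in> borel_measurable ?\<sigma>"
    and N2: "(\<integral>\<^sup>+ \<xi>. N \<xi> ^ 2 \<partial>?\<sigma>) < \<infinity>"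
    using f by (simp_all add: fefferman_hardy_def N_def)
  note fc = holomorphic2_on_imp_continuous_on[OF hol]
  have bm: "b \<in> borel_measurable ?\<sigma>" and bl: "AE \<xi> in ?\<sigma>. (f \<longlongrightarrow> b \<xi>) (at \<xi> within approach_region m \<alpha> \<xi>)"
    using b by (simp_all add: has_boundary_value_def)
  have le: "x \<le> 1 + x ^ 2" for x :: ennreal
  proof (cases "x \<le> 1")
    case False
    then have "1 * x \<le> x * x" by (intro mult_right_mono) auto
    also have "\<dots> \<le> 1 + x ^ 2" by (simp add: power2_eq_square)
    finally show ?thesis by simp
  qed (simp add: add_increasing2)
  have "(\<integral>\<^sup>+ \<xi>. N \<xi> \<partial>?\<sigma>) \<le> (\<integral>\<^sup>+ \<xi>. 1 + N \<xi> ^ 2 \<partial>?\<sigma>)" by (intro nn_integral_mono le)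
  also have "\<dots> = (\<integral>\<^sup>+ \<xi>. 1 \<partial>?\<sigma>) + (\<integral>\<^sup>+ \<xi>. N \<xi> ^ 2 \<partial>?\<sigma>)"
    unfolding power2_eq_square by (rule nn_integral_add) (simp, intro borel_measurable_times_ennreal Nm)
  also have "\<dots> < \<infinity>" using N2 \<sigma>.emeasure_finite by (simp add: less_top[symmetric])
  finally have N1: "(\<integral>\<^sup>+ \<xi>. N \<xi> \<partial>?\<sigma>) < \<infinity>" .
  have fin: "AE \<xi> in ?\<sigma>. N \<xi> \<noteq> \<infinity>"
    by (rule nn_integral_PInf_AE[OF Nm]) (use N1 in simp)
  have Ni: "integrable ?\<sigma> (\<lambda>\<xi>. enn2real (N \<xi>))"
  proof (rule integrableI_nonneg)
    show "(\<lambda>\<xi>. enn2real (N \<xi>)) \<in> borel_measurable ?\<sigma>" by (rule borel_measurable_enn2real[OF Nm])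
    have "(\<integral>\<^sup>+ \<xi>. ennreal (enn2real (N \<xi>)) \<partial>?\<sigma>) = (\<integral>\<^sup>+ \<xi>. N \<xi> \<partial>?\<sigma>)"
      by (rule nn_integral_cong_AE) (use fin in eventually_elim, simp add: less_top)
    then show "(\<integral>\<^sup>+ \<xi>. ennreal (enn2real (N \<xi>)) \<partial>?\<sigma>) < \<infinity>" using N1 by simp
  qed simp
  obtain t0 where t0: "t0 > 0" "t0 < 1"
    and reg: "\<And>t \<xi>. 0 < t \<Longrightarrow> t < t0 \<Longrightarrow> rho m \<xi> = 0 \<Longrightarrow> (1 - t) *\<^sub>R \<xi> \<in> approach_region m \<alpha> \<xi>"
    using scaleR_in_approach_region[OF m \<alpha>] by blast
  \<comment> \<open>Scaled by \<open>t0\<close>, so that every \<open>t n\<close> is admissible for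
    the approach regions.\<close>
  define t where "t = (\<lambda>n::nat. t0 * inverse (real (Suc (Suc n))))"
  have tb: "0 < t n" "t n < t0" for n
  proof -
    have "inverse (real (Suc (Suc n))) < 1" by (rule inverse_less_1_iff[THEN iffD2]) simp
    then have "t0 * inverse (real (Suc (Suc n))) < t0 * 1" using t0 by (intro mult_strict_left_mono) auto
    then show "t n < t0" by (simp add: t_def)
    show "0 < t n" using t0 by (simp add: t_def)
  qed
  have t1: "0 \<le> 1 - t n" "1 - t n < 1" for n using tb[of n] t0 by simp_all
  have tl: "t \<longlonglongrightarrow> 0"
    unfolding t_def using tendsto_mult_left[OF LIMSEQ_Suc[OF LIMSEQ_inverse_real_of_nat], of t0] by simp
  have rl: "(\<lambda>n. (1 - t n) *\<^sub>R p) \<longlonglongrightarrow> p" for p :: C2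
    using tendsto_scaleR[OF tendsto_diff[OF tendsto_const[of 1] tl] tendsto_const[of p]] by simp
  obtain B where B: "\<forall>p\<in>cegg m. cmod (hardy_formula m p q) \<le> B"
    using egg_kernel2_partial_sums[OF q m hardy_A_bounds(1-4)[OF m]] by blast
  have km: "(\<lambda>p. hardy_formula m p q) \<in> borel_measurable ?\<sigma>"
    by (rule continuous_on_measurable_fefferman[OF m continuous_on_boundary_hardy_formula[OF q m]])
  have frm: "(\<lambda>p. f ((1 - t n) *\<^sub>R p)) \<in> borel_measurable ?\<sigma>" for n
    using fefferman_moment(2)[OF m hol t1[of n]] by (rule borel_measurable_integrable)
  have "(\<lambda>n. LINT p|?\<sigma>. cnj (hardy_formula m p q) * f ((1 - t n) *\<^sub>R p)) \<longlonglongrightarrow> (LINT p|?\<sigma>. cnj (hardy_formula m p q) * b p)"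
  proof (rule integral_dominated_convergence[where w="\<lambda>p. B * enn2real (N p)"])
    show "(\<lambda>p. cnj (hardy_formula m p q) * b p) \<in> borel_measurable ?\<sigma>"
      by (intro borel_measurable_times bm measurable_compose[OF km borel_measurable_cnj])
    show "(\<lambda>p. cnj (hardy_formula m p q) * f ((1 - t n) *\<^sub>R p)) \<in> borel_measurable ?\<sigma>" for n
      by (intro borel_measurable_times frm measurable_compose[OF km borel_measurable_cnj])
    show "integrable ?\<sigma> (\<lambda>p. B * enn2real (N p))" using Ni by (rule integrable_mult_right)
    show "AE p in ?\<sigma>. norm (cnj (hardy_formula m p q) * f ((1 - t n) *\<^sub>R p)) \<le> B * enn2real (N p)" for n
      using fin AE_space
    proof eventually_elim
      case (elim p)
      then have p: "rho m p = 0" by (simp add: space_fefferman_measure[OF m])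
      then have "p \<in> cegg m" by (simp add: cegg_def)
      then have "cmod (hardy_formula m p q) \<le> B" using B by blast
      moreover have "ennreal (cmod (f ((1 - t n) *\<^sub>R p))) \<le> N p"
        unfolding N_def nt_maximal_def by (rule SUP_upper) (rule reg[OF tb p])
      then have "cmod (f ((1 - t n) *\<^sub>R p)) \<le> enn2real (N p)"
        using elim(1) by (simp add: enn2real_leI less_top le_ennreal_iff ennreal_le_iff2 enn2real_mono)
          (metis enn2real_ennreal enn2real_mono norm_ge_zero less_top)
      ultimately show ?case unfolding norm_mult complex_mod_cnj by (intro mult_mono) (auto intro: order_trans[OF norm_ge_zero])
    qed
    show "AE p in ?\<sigma>. (\<lambda>n. cnj (hardy_formula m p q) * f ((1 - t n) *\<^sub>R p)) \<longlonglongrightarrow> cnj (hardy_formula m p q) * b p"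
      using bl AE_space
    proof eventually_elim
      case (elim p)
      then have p: "rho m p = 0" by (simp add: space_fefferman_measure[OF m])
      \<comment> \<open>The filter \<open>at p within\<close> excludes \<open>p\<close> itself, so
        the approximating points must differ from it.\<close>
      have p0: "p \<noteq> 0" using rho_grad_bounds(1)[OF m p] by auto
      have "(1 - t n) *\<^sub>R p \<noteq> p" for n using p0 tb(1)[of n] by (simp add: algebra_simps)
      then have "filterlim (\<lambda>n. (1 - t n) *\<^sub>R p) (at p within approach_region m \<alpha> p) sequentially"
        unfolding filterlim_at using rl[of p] reg[OF tb p] by auto
      from filterlim_compose[OF elim(1) this] show ?case by (intro tendsto_mult tendsto_const)
    qed
  qed
  then have "(\<lambda>n. f ((1 - t n) *\<^sub>R q)) \<longlonglongrightarrow> (LINT p|?\<sigma>. cnj (hardy_formula m p q) * b p)"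
    unfolding hardy_reproducing_dilated[OF m q hol t1] .
  moreover have "(\<lambda>n. f ((1 - t n) *\<^sub>R q)) \<longlonglongrightarrow> f q"
  proof -
    have "isCont f q" using fc q open_egg by (simp add: continuous_on_eq_continuous_at)
    then show ?thesis using rl[of q] by (rule isCont_tendsto_compose)
  qed
  ultimately show ?thesis by (rule LIMSEQ_unique[symmetric])
qed

lemma is_fefferman_szego_kernel_formula:
  assumes "m \<ge> 1" "\<alpha> > 0"
  shows "is_fefferman_szego_kernel m \<alpha> (hardy_formula m)"
  unfolding is_fefferman_szego_kernel_def
  using hardy_formula_in_hardy[OF assms(1)] hardy_formula_boundary_value[OF assms(1)] hardy_reproducing[OF assms] by blast

text \<open>The chosen kernel and the closed form reproduce each other at \<open>q\<close>. One
  pairing uses the boundary function \<open>k\<close> that comes with the chosen kernel, the other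
  the continuous extension of the closed form.\<close>

lemma fefferman_szego_kernel_eq:
  assumes m: "m \<ge> 1" and \<alpha>: "\<alpha> > 0" and q: "q \<in> egg m"
  shows "fefferman_szego_kernel m \<alpha> q q = cnj (hardy_formula m q q)"
proof -
  let ?S = "fefferman_szego_kernel m \<alpha>"
  have "is_fefferman_szego_kernel m \<alpha> ?S"
    unfolding fefferman_szego_kernel_def
    by (rule someI[of "is_fefferman_szego_kernel m \<alpha>", OF is_fefferman_szego_kernel_formula[OF m \<alpha>]])
  then obtain k where S: "(\<lambda>p. ?S p q) \<in> fefferman_hardy m \<alpha>" "has_boundary_value m \<alpha> (\<lambda>p. ?S p q) k"
    and r: "\<forall>f\<in>fefferman_hardy m \<alpha>. \<forall>b. has_boundary_value m \<alpha> f b \<longrightarrow> f q = (LINT \<xi>|fefferman_measure m. cnj (k \<xi>) * b \<xi>)"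
    using q unfolding is_fefferman_szego_kernel_def by blast
  have "?S q q = (LINT \<xi>|fefferman_measure m. cnj (hardy_formula m \<xi> q) * k \<xi>)"
    by (rule hardy_reproducing[OF m \<alpha> q S])
  also have "\<dots> = cnj (LINT \<xi>|fefferman_measure m. cnj (k \<xi>) * hardy_formula m \<xi> q)"
    unfolding Bochner_Integration.integral_cnj[symmetric] by (simp add: mult.commute)
  also have "(LINT \<xi>|fefferman_measure m. cnj (k \<xi>) * hardy_formula m \<xi> q) = hardy_formula m q q"
    by (rule r[rule_format, OF hardy_formula_in_hardy[OF m q] hardy_formula_boundary_value[OF m q], symmetric])
  finally show ?thesis .
qed

section \<open>The metrics on the slice z = 0\<close>

definition egg_potential :: "nat \<Rightarrow> real \<Rightarrow> real \<Rightarrow> real \<Rightarrow> real \<Rightarrow> real \<times> real \<Rightarrow> real" where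
  "egg_potential m C e n \<gamma> r =
     (let \<tau> = snd r * (1 - fst r) powr (- 1 / m)
      in C - e * ln (1 - fst r) + ln (1 - \<gamma> * \<tau>) - n * ln (1 - \<tau>))"

text \<open>The lower bounds \<open>- 1\<close> in place of 0 make the set open around radii with a
  vanishing coordinate, where the potential has to be differentiated on the slice
  \<open>z = 0\<close>.\<close>

definition radii_dom :: "nat \<Rightarrow> (real \<times> real) set" where
  "radii_dom m = {r. - 1 < fst r \<and> fst r < 1 \<and> - 1 < snd r * (1 - fst r) powr (- 1 / m) \<and> snd r * (1 - fst r) powr (- 1 / m) < 1}"

lemma open_radii_dom: "open (radii_dom m)"
proof -
  have "open ({r::real \<times> real. - 1 < fst r \<and> fst r < 1} \<inter> (\<lambda>r. snd r * (1 - fst r) powr (- 1 / m)) -` {- 1<..<1})"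
  proof (rule continuous_open_preimage)
    show "continuous_on {r::real \<times> real. - 1 < fst r \<and> fst r < 1} (\<lambda>r. snd r * (1 - fst r) powr (- 1 / m))"
      by (intro continuous_intros) auto
    show "open {r::real \<times> real. - 1 < fst r \<and> fst r < 1}"
      by (intro open_Collect_conj open_Collect_less continuous_intros)
  qed simp
  also have "{r::real \<times> real. - 1 < fst r \<and> fst r < 1} \<inter> (\<lambda>r. snd r * (1 - fst r) powr (- 1 / m)) -` {- 1<..<1} = radii_dom m"
    by (auto simp: radii_dom_def)
  finally show ?thesis .
qed

lemma radii_in_radii_dom:
  assumes p: "p \<in> egg m" and m: "m \<ge> 1"
  shows "radii p \<in> radii_dom m" "fst (radii p) \<ge> 0" "snd (radii p) * (1 - fst (radii p)) powr (- 1 / m) \<ge> 0"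
proof -
  define x t where "x = cmod (fst p) ^ 2" and "t = cmod (snd p) ^ 2"
  have r: "radii p = (x, t)" by (simp add: radii_def x_def t_def)
  have 1: "x + t ^ m < 1" using p by (simp add: egg_def x_def t_def flip: power_mult)
  have t0: "t \<ge> 0" and x0: "x \<ge> 0" by (simp_all add: t_def x_def)
  have tm: "t ^ m \<ge> 0" using t0 by simp
  have x1: "1 - x > 0" using 1 tm by linarith
  have "root m (t ^ m) < root m (1 - x)" using 1 m by simp
  moreover have "root m (t ^ m) = t" using m t0 by (simp add: real_root_power_cancel)
  moreover have "root m (1 - x) = (1 - x) powr (1 / m)" using m x1 by (simp add: root_powr_inverse)
  ultimately have "t < (1 - x) powr (1 / m)" by simp
  then have "t * (1 - x) powr (- 1 / m) < (1 - x) powr (1 / m) * (1 - x) powr (- 1 / m)"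
    using x1 by (intro mult_strict_right_mono) auto
  also have "\<dots> = 1" using x1 by (simp flip: powr_add)
  finally have "t * (1 - x) powr (- 1 / m) < 1" .
  moreover have "t * (1 - x) powr (- 1 / m) \<ge> 0" using t0 by simp
  then have "- 1 < t * (1 - x) powr (- 1 / m)" by linarith
  ultimately show "radii p \<in> radii_dom m" using x0 x1 unfolding r radii_dom_def by simp
  show "fst (radii p) \<ge> 0" "snd (radii p) * (1 - fst (radii p)) powr (- 1 / m) \<ge> 0"
    using x0 t0 by (simp_all add: r)
qed

text \<open>\<open>q\<close> is the derivative of
  \<open>ln (1 - \<gamma> * \<tau>) - n * ln (1 - \<tau>)\<close> in \<open>\<tau>\<close>; it is
  multiplied by the partial derivatives of \<open>\<tau>\<close>, and \<open>e / (1 - fst r)\<close>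
  is the direct contribution of \<open>fst r\<close>.\<close>

lemma egg_potential_derivative:
  fixes C e n \<gamma> :: real
  assumes r: "r \<in> radii_dom m" and \<gamma>: "0 \<le> \<gamma>" "\<gamma> < 1"
  defines "\<tau> \<equiv> snd r * (1 - fst r) powr (- 1 / m)"
  defines "q \<equiv> n / (1 - \<tau>) - \<gamma> / (1 - \<gamma> * \<tau>)"
  shows "(egg_potential m C e n \<gamma> has_derivative
     (\<lambda>h. (e / (1 - fst r) + \<tau> / (m * (1 - fst r)) * q) * fst h + ((1 - fst r) powr (- 1 / m) * q) * snd h)) (at r)"
proof -
  have x: "1 - fst r > 0" and \<tau>: "- 1 < \<tau>" "\<tau> < 1" using r by (simp_all add: radii_dom_def \<tau>_def)
  have g: "1 - \<gamma> * \<tau> > 0"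
  proof -
    have "\<gamma> * \<tau> \<le> \<gamma> * 1" using \<gamma> \<tau> by (intro mult_left_mono) auto
    then show ?thesis using \<gamma> by linarith
  qed
  define T where "T = (\<lambda>r::real \<times> real. snd r * (1 - fst r) powr (- 1 / m))"
  have T\<tau>: "T r = \<tau>" by (simp add: T_def \<tau>_def)
  have dx: "((\<lambda>r::real \<times> real. 1 - fst r) has_derivative (\<lambda>h. - fst h)) (at r)"
    by (auto intro!: derivative_eq_intros)
  have "((\<lambda>x. x powr (- 1 / m)) has_real_derivative (- 1 / m) * (1 - fst r) powr (- 1 / m - 1)) (at (1 - fst r))"
    using x by (rule has_real_derivative_powr)
  from has_derivative_compose[OF dx this[unfolded has_field_derivative_def]]
  have dp: "((\<lambda>r::real \<times> real. (1 - fst r) powr (- 1 / m)) has_derivative (\<lambda>h. (- 1 / m) * (1 - fst r) powr (- 1 / m - 1) * (- fst h))) (at r)" .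
  have pe: "(1 - fst r) powr (- 1 / m - 1) = (1 - fst r) powr (- 1 / m) / (1 - fst r)"
    using x by (simp add: powr_diff)
  have dT: "(T has_derivative (\<lambda>h. \<tau> / (m * (1 - fst r)) * fst h + (1 - fst r) powr (- 1 / m) * snd h)) (at r)"
    unfolding T_def
    by (rule has_derivative_eq_rhs[OF has_derivative_mult[OF has_derivative_snd[OF has_derivative_ident] dp]])
       (rule ext, simp only: pe \<tau>_def, simp add: mult_ac)
  have lnd: "(ln has_derivative (*) (1 / y)) (at y)" if "y > 0" for y :: real
    using DERIV_ln_divide[OF that] by (simp add: has_field_derivative_def)
  have d1: "((\<lambda>r::real \<times> real. ln (1 - fst r)) has_derivative (\<lambda>h. 1 / (1 - fst r) * (- fst h))) (at r)"
    by (rule has_derivative_compose[OF dx lnd[OF x]])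
  have d2: "((\<lambda>r. ln (1 - \<gamma> * T r)) has_derivative (\<lambda>h. 1 / (1 - \<gamma> * \<tau>) * (0 - \<gamma> * (\<tau> / (m * (1 - fst r)) * fst h + (1 - fst r) powr (- 1 / m) * snd h)))) (at r)"
  proof -
    have a: "((\<lambda>r. 1 - \<gamma> * T r) has_derivative (\<lambda>h. 0 - \<gamma> * (\<tau> / (m * (1 - fst r)) * fst h + (1 - fst r) powr (- 1 / m) * snd h))) (at r)"
      by (intro has_derivative_diff has_derivative_const has_derivative_mult_right dT)
    have "(ln has_derivative (*) (1 / (1 - \<gamma> * \<tau>))) (at (1 - \<gamma> * T r))"
      unfolding T\<tau> by (rule lnd[OF g])
    from has_derivative_compose[OF a this] show ?thesis .
  qed
  have d3: "((\<lambda>r. ln (1 - T r)) has_derivative (\<lambda>h. 1 / (1 - \<tau>) * (0 - (\<tau> / (m * (1 - fst r)) * fst h + (1 - fst r) powr (- 1 / m) * snd h)))) (at r)"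
  proof -
    have a: "((\<lambda>r. 1 - T r) has_derivative (\<lambda>h. 0 - (\<tau> / (m * (1 - fst r)) * fst h + (1 - fst r) powr (- 1 / m) * snd h))) (at r)"
      by (intro has_derivative_diff has_derivative_const dT)
    have "(ln has_derivative (*) (1 / (1 - \<tau>))) (at (1 - T r))"
      unfolding T\<tau> using \<tau> by (intro lnd) simp
    from has_derivative_compose[OF a this] show ?thesis .
  qed
  have eq: "egg_potential m C e n \<gamma> = (\<lambda>r. C - e * ln (1 - fst r) + ln (1 - \<gamma> * T r) - n * ln (1 - T r))"
    by (simp add: fun_eq_iff egg_potential_def Let_def T_def)
  have D: "(egg_potential m C e n \<gamma> has_derivative (\<lambda>h. 0 - e * (1 / (1 - fst r) * (- fst h))
      + 1 / (1 - \<gamma> * \<tau>) * (0 - \<gamma> * (\<tau> / (m * (1 - fst r)) * fst h + (1 - fst r) powr (- 1 / m) * snd h))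
      - n * (1 / (1 - \<tau>) * (0 - (\<tau> / (m * (1 - fst r)) * fst h + (1 - fst r) powr (- 1 / m) * snd h))))) (at r)"
    unfolding eq
    by (intro has_derivative_diff has_derivative_add has_derivative_const has_derivative_mult_right d1 d2 d3)
  define A where "A = \<tau> / (m * (1 - fst r))"
  define B where "B = (1 - fst r) powr (- 1 / m)"
  define u v where "u = 1 / (1 - \<gamma> * \<tau>)" and "v = 1 / (1 - \<tau>)"
  have q: "q = n * v - \<gamma> * u" by (simp add: q_def u_def v_def)
  show ?thesis
    using D unfolding A_def[symmetric] B_def[symmetric] u_def[symmetric] v_def[symmetric] q
    by (rule has_derivative_eq_rhs) (simp add: fun_eq_iff algebra_simps)
qed

abbreviation "pot1 m e n \<gamma> r \<equiv> e / (1 - fst r) + snd r * (1 - fst r) powr (- 1 / m) / (m * (1 - fst r)) *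
     (n / (1 - snd r * (1 - fst r) powr (- 1 / m)) - \<gamma> / (1 - \<gamma> * (snd r * (1 - fst r) powr (- 1 / m))))"

abbreviation "pot2 m n \<gamma> r \<equiv> (1 - fst r) powr (- 1 / m) *
     (n / (1 - snd r * (1 - fst r) powr (- 1 / m)) - \<gamma> / (1 - \<gamma> * (snd r * (1 - fst r) powr (- 1 / m))))"

text \<open>The factor \<open>\<sigma>\<close> is \<open>- 1\<close> for \<open>log \<rho>\<^sub>m\<close>.\<close>

lemma complex_hessian_egg_potential:
  fixes \<sigma> C e n \<gamma> :: real and w :: complex
  assumes w: "cmod w < 1" and m: "m \<ge> 1" and \<gamma>: "0 \<le> \<gamma>" "\<gamma> < 1"
    and f: "\<forall>p\<in>egg m. f p = of_real (\<sigma> * egg_potential m C e n \<gamma> (radii p))"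
  defines "t \<equiv> cmod w ^ 2"
  shows "complex_hessian f (0, w) $ 1 $ 1 = of_real (\<sigma> * (e + t / m * (n / (1 - t) - \<gamma> / (1 - \<gamma> * t))))"
    and "complex_hessian f (0, w) $ 2 $ 1 = 0"
    and "complex_hessian f (0, w) $ 1 $ 2 = 0"
    and "complex_hessian f (0, w) $ 2 $ 2 = of_real (\<sigma> * (n / (1 - t)^2 - \<gamma> / (1 - \<gamma> * t)^2))"
proof -
  let ?p = "(0, w) :: C2"
  have p: "?p \<in> egg m" using w m by (simp add: egg_def power_less_one_iff)
  have rp: "radii ?p = (0, t)" by (simp add: radii_def t_def)
  have t: "0 \<le> t" "t < 1" using w by (simp_all add: t_def power_less_one_iff)
  have g: "1 - \<gamma> * t > 0"
  proof -
    have "\<gamma> * t \<le> \<gamma> * 1" using \<gamma> t by (intro mult_left_mono) auto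
    then show ?thesis using \<gamma> by linarith
  qed
  have ev: "eventually (\<lambda>q. f q = of_real (\<sigma> * egg_potential m C e n \<gamma> (radii q))) (nhds ?p)"
    using eventually_nhds_in_open[OF open_egg p] by eventually_elim (rule bspec[OF f])
  have ev2: "eventually (\<lambda>r. ((\<lambda>r. \<sigma> * egg_potential m C e n \<gamma> r) has_derivative (\<lambda>h. \<sigma> * pot1 m e n \<gamma> r * fst h + \<sigma> * pot2 m n \<gamma> r * snd h)) (at r)) (nhds (radii ?p))"
    using eventually_nhds_in_open[OF open_radii_dom radii_in_radii_dom(1)[OF p m]]
  proof eventually_elim
    case (elim r)
    from has_derivative_mult_right[OF egg_potential_derivative[OF elim \<gamma>, of C e n], of \<sigma>]
    show ?case by (rule has_derivative_eq_rhs) (simp only: fun_eq_iff ring_distribs mult.assoc, simp)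
  qed
  have nz: "(0::real) < 1 - fst (radii ?p)" "1 - snd (radii ?p) * (1 - fst (radii ?p)) powr (- 1 / m) \<noteq> 0"
    "1 - \<gamma> * (snd (radii ?p) * (1 - fst (radii ?p)) powr (- 1 / m)) \<noteq> 0"
    using t g by (simp_all add: rp)
  \<comment> \<open>Mere existence of \<open>D1\<close> and \<open>D2\<close>, together with the
    value \<open>D2 (0, 1)\<close>, suffices: all other second derivatives enter the Hessian with a
    factor \<open>fst p = 0\<close>.\<close>
  have P: "(\<lambda>r::real \<times> real. (1 - fst r) powr (- 1 / m)) differentiable (at (radii ?p))"
  proof -
    have "((\<lambda>x. x powr (- 1 / m)) has_real_derivative (- 1 / m) * (1 - fst (radii ?p)) powr (- 1 / m - 1)) (at (1 - fst (radii ?p)))"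
      using nz(1) by (rule has_real_derivative_powr)
    moreover have "((\<lambda>r::real \<times> real. 1 - fst r) has_derivative (\<lambda>h. - fst h)) (at (radii ?p))"
      by (auto intro!: derivative_eq_intros)
    ultimately show ?thesis
      unfolding has_field_derivative_def differentiable_def by (intro exI) (rule has_derivative_compose)
  qed
  have F: "fst differentiable (at (radii ?p))" "snd differentiable (at (radii ?p))"
    unfolding differentiable_def by (auto intro!: derivative_eq_intros)
  have "(\<lambda>r. \<sigma> * pot1 m e n \<gamma> r) differentiable (at (radii ?p))"
    using nz m by (intro differentiable_add differentiable_mult differentiable_divide differentiable_diff differentiable_const P F) auto
  then obtain D1 where D1: "((\<lambda>r. \<sigma> * pot1 m e n \<gamma> r) has_derivative D1) (at (radii ?p))"
    unfolding differentiable_def ..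
  have "(\<lambda>r. \<sigma> * pot2 m n \<gamma> r) differentiable (at (radii ?p))"
    using nz by (intro differentiable_add differentiable_mult differentiable_divide differentiable_diff differentiable_const P F) auto
  then obtain D2 where D2: "((\<lambda>r. \<sigma> * pot2 m n \<gamma> r) has_derivative D2) (at (radii ?p))"
    unfolding differentiable_def ..
  have D2t: "D2 (0, 1) = \<sigma> * (n / (1 - t)^2 - \<gamma>^2 / (1 - \<gamma> * t)^2)"
  proof -
    have "((\<lambda>s. (0, s)) has_derivative (\<lambda>s. (0::real, s))) (at t)" by (auto intro!: derivative_eq_intros)
    from has_derivative_compose[OF this D2[unfolded rp]]
    have "((\<lambda>s. \<sigma> * (n / (1 - s) - \<gamma> / (1 - \<gamma> * s))) has_derivative (\<lambda>s. D2 (0, s))) (at t)" by simp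
    moreover have "((\<lambda>s. \<sigma> * (n / (1 - s) - \<gamma> / (1 - \<gamma> * s))) has_real_derivative \<sigma> * (n / (1 - t)^2 - \<gamma>^2 / (1 - \<gamma> * t)^2)) (at t)"
      using t g by (auto intro!: derivative_eq_intros simp: power2_eq_square)
    ultimately have "(\<lambda>s. D2 (0, s)) = (*) (\<sigma> * (n / (1 - t)^2 - \<gamma>^2 / (1 - \<gamma> * t)^2))"
      unfolding has_field_derivative_def by (rule has_derivative_unique)
    from fun_cong[OF this, of 1] show ?thesis by simp
  qed
  note h = wirt_wirt_bar_radial[OF ev2 D1 D2]
  note c = complex_hessian_cong[OF ev]
  show "complex_hessian f ?p $ 1 $ 1 = of_real (\<sigma> * (e + t / m * (n / (1 - t) - \<gamma> / (1 - \<gamma> * t))))"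
    unfolding c unfolding complex_hessian_def vec_lambda_beta h(1) by (simp add: rp)
  show "complex_hessian f ?p $ 2 $ 1 = 0" "complex_hessian f ?p $ 1 $ 2 = 0"
    unfolding c unfolding complex_hessian_def vec_lambda_beta h by simp_all
  \<comment> \<open>Each fraction collapses by \<open>a / u + a / u^2 * (1 - u) = a / u^2\<close>,
    once with \<open>u = 1 - t\<close> and once with \<open>u = 1 - \<gamma> * t\<close>.\<close>
  have "n / (1 - t) - \<gamma> / (1 - \<gamma> * t) + (n / (1 - t)^2 - \<gamma>^2 / (1 - \<gamma> * t)^2) * t = n / (1 - t)^2 - \<gamma> / (1 - \<gamma> * t)^2"
  proof -
    have *: "a / u + a / u^2 * (1 - u) = a / u^2" if "u \<noteq> 0" for a u :: real
      using that by (simp add: field_simps power2_eq_square)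
    have "n / (1 - t) + n / (1 - t)^2 * t = n / (1 - t)^2" using *[of "1 - t" n] t by simp
    moreover have "\<gamma> / (1 - \<gamma> * t) + \<gamma>^2 / (1 - \<gamma> * t)^2 * t = \<gamma> / (1 - \<gamma> * t)^2"
      using *[of "1 - \<gamma> * t" \<gamma>] g by (simp add: power2_eq_square)
    ultimately show ?thesis by (simp add: left_diff_distrib)
  qed
  then have "\<sigma> * (n / (1 - t) - \<gamma> / (1 - \<gamma> * t)) + \<sigma> * (n / (1 - t)^2 - \<gamma>^2 / (1 - \<gamma> * t)^2) * t = \<sigma> * (n / (1 - t)^2 - \<gamma> / (1 - \<gamma> * t)^2)"
    by (simp only: mult.assoc distrib_left[symmetric])
  then show "complex_hessian f ?p $ 2 $ 2 = of_real (\<sigma> * (n / (1 - t)^2 - \<gamma> / (1 - \<gamma> * t)^2))"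
    unfolding c unfolding complex_hessian_def vec_lambda_beta h(4) D2t by (simp add: rp t_def)
qed

section \<open>Comparison of the metrics\<close>

lemma egg_kernel2_diagonal:
  assumes m: "m \<ge> 1" and p: "p \<in> egg m"
  defines "x \<equiv> fst (radii p)"
  defines "\<tau> \<equiv> snd (radii p) * (1 - x) powr (- 1 / m)"
  shows "egg_kernel2 m e A0 A1 A2 p p = of_real ((1 - x) powr (- e) * (A0 / (1 - \<tau>) + A1 / (1 - \<tau>)^2 + 2 * A2 / (1 - \<tau>)^3))"
proof -
  have x: "1 - x > 0" using radii_in_radii_dom(1)[OF p m] by (simp add: radii_dom_def x_def)
  have X: "fst p * cnj (fst p) = of_real x" and Y: "snd p * cnj (snd p) = of_real (snd (radii p))"
    unfolding x_def radii_def fst_conv snd_conv by (rule complex_norm_square[symmetric])+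
  have pw: "(1 - complex_of_real x) powr of_real s = of_real ((1 - x) powr s)" for s
    using powr_of_real[of "1 - x" s] x by simp
  show ?thesis
    unfolding egg_kernel2_def egg_kernel_def Let_def X Y pw \<tau>_def by simp
qed

text \<open>The identity assumed for the constants, at \<open>u = 1 - \<tau>\<close>, gathers the
  fractions into one whose logarithm is \<open>egg_potential\<close>; positivity of all factors
  keeps the complex logarithm real.\<close>

lemma ln_egg_kernel:
  assumes m: "m \<ge> 1" and p: "p \<in> egg m" and c: "c > 0" and \<gamma>: "0 \<le> \<gamma>" "\<gamma> < 1"
    and A: "\<And>u. u > 0 \<Longrightarrow> A0 / u + A1 / u^2 + 2 * A2 / u^3 = c * (1 - \<gamma> * (1 - u)) / u ^ n"
  shows "ln (cnj (egg_kernel2 m e A0 A1 A2 p p)) = of_real (egg_potential m (ln c) e n \<gamma> (radii p))"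
proof -
  define x where "x = fst (radii p)"
  define \<tau> where "\<tau> = snd (radii p) * (1 - x) powr (- 1 / m)"
  have x: "1 - x > 0" and \<tau>: "\<tau> < 1" "- 1 < \<tau>" "0 \<le> \<tau>"
    using radii_in_radii_dom[OF p m] by (simp_all add: radii_dom_def x_def \<tau>_def)
  have g: "1 - \<gamma> * \<tau> > 0"
  proof -
    have "\<gamma> * \<tau> \<le> \<gamma> * 1" using \<gamma> \<tau> by (intro mult_left_mono) auto
    then show ?thesis using \<gamma> by linarith
  qed
  define K where "K = (1 - x) powr (- e) * (c * (1 - \<gamma> * \<tau>) / (1 - \<tau>) ^ n)"
  have K: "K > 0" using x \<tau> g c unfolding K_def by (intro mult_pos_pos divide_pos_pos) auto
  have "egg_kernel2 m e A0 A1 A2 p p = of_real K"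
  proof -
    have "egg_kernel2 m e A0 A1 A2 p p = of_real ((1 - x) powr (- e) * (A0 / (1 - \<tau>) + A1 / (1 - \<tau>)^2 + 2 * A2 / (1 - \<tau>)^3))"
      unfolding x_def \<tau>_def by (rule egg_kernel2_diagonal[OF m p])
    also have "A0 / (1 - \<tau>) + A1 / (1 - \<tau>)^2 + 2 * A2 / (1 - \<tau>)^3 = c * (1 - \<gamma> * \<tau>) / (1 - \<tau>) ^ n"
      using A[of "1 - \<tau>"] \<tau> by simp
    finally show ?thesis unfolding K_def .
  qed
  then have "ln (cnj (egg_kernel2 m e A0 A1 A2 p p)) = of_real (ln K)" using K by (simp add: Ln_of_real)
  also have "ln K = ln c - e * ln (1 - x) + ln (1 - \<gamma> * \<tau>) - n * ln (1 - \<tau>)"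
    using x \<tau> g c unfolding K_def by (simp add: ln_mult ln_div ln_powr ln_realpow)
  also have "\<dots> = egg_potential m (ln c) e n \<gamma> (radii p)"
    by (simp add: egg_potential_def Let_def x_def \<tau>_def)
  finally show ?thesis .
qed

text \<open>Factoring \<open>(1 - x) powr (1 / m)\<close> out of \<open>rho_root\<close> leaves
  \<open>1 - \<tau>\<close>.\<close>

lemma rho_root_potential:
  assumes m: "m \<ge> 1" and p: "p \<in> egg m"
  shows "complex_of_real (ln (rho_root m p)) = of_real (- 1 * egg_potential m 0 (1 / m) 1 0 (radii p))"
proof -
  define x where "x = fst (radii p)"
  define \<tau> where "\<tau> = snd (radii p) * (1 - x) powr (- 1 / m)"
  have x: "1 - x > 0" and \<tau>: "\<tau> < 1"
    using radii_in_radii_dom[OF p m] by (simp_all add: radii_dom_def x_def \<tau>_def)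
  have "(1 - x) powr (1 / m) * (1 - x) powr (- 1 / m) = 1" using x by (simp flip: powr_add)
  then have "rho_root m p = (1 - x) powr (1 / m) * (1 - \<tau>)"
    by (simp add: rho_root_def x_def \<tau>_def radii_def algebra_simps)
  then show ?thesis using x \<tau>
    unfolding egg_potential_def Let_def x_def[symmetric] \<tau>_def[symmetric] by (simp add: ln_mult ln_powr)
qed

section \<open>Hessian and Ricci form on the ball\<close>

text \<open>For the ball the Hessian is computed at every point. The lemma serves the two kernels
  with \<open>n = 2\<close> and \<open>n = 3\<close>, \<open>ln (rho_root 1 q)\<close> with
  \<open>n = - 1\<close>, and the logarithm of the determinant in \<open>ricci_ball\<close>, again
  with \<open>n = 3\<close>.\<close>

lemma complex_hessian_ball:
  fixes C n :: real
  assumes p: "p \<in> egg 1" and f: "\<forall>q\<in>egg 1. f q = of_real (C - n * ln (1 - fst (radii q) - snd (radii q)))"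
  defines "u \<equiv> 1 - cmod (fst p) ^ 2 - cmod (snd p) ^ 2"
  shows "complex_hessian f p $ 1 $ 1 = of_real n * of_real (1 / u + cmod (fst p) ^ 2 / u^2)"
    and "complex_hessian f p $ 2 $ 1 = of_real n * (cnj (snd p) * fst p / of_real (u^2))"
    and "complex_hessian f p $ 1 $ 2 = of_real n * (cnj (fst p) * snd p / of_real (u^2))"
    and "complex_hessian f p $ 2 $ 2 = of_real n * of_real (1 / u + cmod (snd p) ^ 2 / u^2)"
proof -
  define U where "U = {r::real \<times> real. 1 - fst r - snd r > 0}"
  have oU: "open U" unfolding U_def by (intro open_Collect_less continuous_intros)
  have pU: "radii p \<in> U" and u: "u > 0" using p by (auto simp: U_def radii_def egg_def u_def)
  have ev: "eventually (\<lambda>q. f q = of_real (C - n * ln (1 - fst (radii q) - snd (radii q)))) (nhds p)"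
    using eventually_nhds_in_open[OF open_egg p] by eventually_elim (rule bspec[OF f])
  have ev2: "eventually (\<lambda>r. ((\<lambda>r. C - n * ln (1 - fst r - snd r)) has_derivative (\<lambda>h. n / (1 - fst r - snd r) * fst h + n / (1 - fst r - snd r) * snd h)) (at r)) (nhds (radii p))"
    using eventually_nhds_in_open[OF oU pU]
  proof eventually_elim
    case (elim r)
    then have r: "1 - fst r - snd r > 0" by (simp add: U_def)
    have d: "((\<lambda>r. 1 - fst r - snd r) has_derivative (\<lambda>h. - fst h - snd h)) (at r)"
      by (auto intro!: derivative_eq_intros)
    have "(ln has_derivative (*) (1 / (1 - fst r - snd r))) (at (1 - fst r - snd r))"
      using DERIV_ln_divide[OF r] by (simp add: has_field_derivative_def)
    from has_derivative_diff[OF has_derivative_const[of C] has_derivative_mult_right[OF has_derivative_compose[OF d this], of n]]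
    show ?case by (rule has_derivative_eq_rhs) (simp add: fun_eq_iff add_divide_distrib diff_divide_distrib algebra_simps)
  qed
  have D: "((\<lambda>r. n / (1 - fst r - snd r)) has_derivative (\<lambda>h. n / u^2 * (fst h + snd h))) (at (radii p))"
  proof -
    have d: "((\<lambda>r. 1 - fst r - snd r) has_derivative (\<lambda>h. - fst h - snd h)) (at (radii p))"
      by (auto intro!: derivative_eq_intros)
    have e: "1 - fst (radii p) - snd (radii p) = u" by (simp add: radii_def u_def)
    have "((\<lambda>y. n / y) has_real_derivative - (n / u^2)) (at (1 - fst (radii p) - snd (radii p)))"
      unfolding e using u by (auto intro!: derivative_eq_intros simp: power2_eq_square)
    from has_derivative_compose[OF d this[unfolded has_field_derivative_def]]
    show ?thesis by (rule has_derivative_eq_rhs) (simp add: fun_eq_iff add_divide_distrib diff_divide_distrib algebra_simps)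
  qed
  note h = wirt_wirt_bar_radial[OF ev2 D D]
  note c = complex_hessian_cong[OF ev]
  have e: "1 - fst (radii p) - snd (radii p) = u" by (simp add: radii_def u_def)
  show "complex_hessian f p $ 1 $ 1 = of_real n * of_real (1 / u + cmod (fst p) ^ 2 / u^2)"
    unfolding c unfolding complex_hessian_def vec_lambda_beta h(1) e by (simp add: algebra_simps)
  show "complex_hessian f p $ 2 $ 1 = of_real n * (cnj (snd p) * fst p / of_real (u^2))"
    unfolding c unfolding complex_hessian_def vec_lambda_beta h(2) by simp
  show "complex_hessian f p $ 1 $ 2 = of_real n * (cnj (fst p) * snd p / of_real (u^2))"
    unfolding c unfolding complex_hessian_def vec_lambda_beta h(3) by simp
  show "complex_hessian f p $ 2 $ 2 = of_real n * of_real (1 / u + cmod (snd p) ^ 2 / u^2)"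
    unfolding c unfolding complex_hessian_def vec_lambda_beta h(4) e by (simp add: algebra_simps)
qed

lemma matrix_2_eqI:
  fixes A B :: "complex^2^2"
  assumes "A $ 1 $ 1 = B $ 1 $ 1" "A $ 1 $ 2 = B $ 1 $ 2" "A $ 2 $ 1 = B $ 2 $ 1" "A $ 2 $ 2 = B $ 2 $ 2"
  shows "A = B"
  unfolding vec_eq_iff forall_2 using assms by blast

lemma egg_potential_ball:
  assumes p: "p \<in> egg 1"
  shows "egg_potential 1 C n n 0 (radii p) = C - n * ln (1 - fst (radii p) - snd (radii p))"
proof -
  define x t where "x = fst (radii p)" and "t = snd (radii p)"
  have u: "1 - x - t > 0" and t: "t \<ge> 0" using p by (auto simp: radii_def egg_def x_def t_def)
  then have x: "1 - x > 0" by linarith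
  have i: "(1 - x) powr (- 1 / real 1) = 1 / (1 - x)" using x by (simp add: powr_minus divide_inverse)
  have "1 - t * (1 / (1 - x)) = (1 - x - t) / (1 - x)" using x by (simp add: field_simps)
  then have l: "ln (1 - t * (1 / (1 - x))) = ln (1 - x - t) - ln (1 - x)" using u x by (simp add: ln_div)
  show ?thesis unfolding egg_potential_def Let_def x_def[symmetric] t_def[symmetric] i l by (simp add: algebra_simps)
qed

text \<open>The determinant is \<open>n^2 / u^3\<close>, because the numerator
  \<open>u + x + t\<close> equals 1. Its logarithm is again a constant minus a multiple of
  \<open>ln u\<close>, so the Ricci form is a multiple of the metric.\<close>

lemma ricci_ball:
  fixes n C :: real
  assumes n: "n > 0" and f: "\<forall>q\<in>egg 1. f q = of_real (C - n * ln (1 - fst (radii q) - snd (radii q)))" and p: "p \<in> egg 1"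
  shows "ricci (complex_hessian f) p = (- 3 / n) *\<^sub>R complex_hessian f p"
proof -
  have det: "det (complex_hessian f q) = of_real (n^2 / (1 - fst (radii q) - snd (radii q)) ^ 3)" and u: "1 - fst (radii q) - snd (radii q) > 0"
    if q: "q \<in> egg 1" for q
  proof -
    define u where "u = 1 - cmod (fst q) ^ 2 - cmod (snd q) ^ 2"
    have u0: "u > 0" using q by (simp add: u_def egg_def)
    have e: "1 - fst (radii q) - snd (radii q) = u" by (simp add: radii_def u_def)
    then show "1 - fst (radii q) - snd (radii q) > 0" using u0 by simp
    note h = complex_hessian_ball[OF q f, folded u_def]
    define x t where "x = cmod (fst q) ^ 2" and "t = cmod (snd q) ^ 2"
    have xt: "fst q * cnj (fst q) = of_real x" "snd q * cnj (snd q) = of_real t"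
      unfolding x_def t_def by (rule complex_norm_square[symmetric])+
    have "det (complex_hessian f q) = of_real n * of_real (1 / u + x / u^2) * (of_real n * of_real (1 / u + t / u^2))
        - of_real n^2 * ((fst q * cnj (fst q)) * (snd q * cnj (snd q))) / of_real (u^2) ^ 2"
      unfolding det_2 h x_def t_def by (simp add: power2_eq_square)
    also have "\<dots> = of_real (n^2 * ((1 / u + x / u^2) * (1 / u + t / u^2) - x * t / (u^2)^2))"
      unfolding xt by (simp add: power2_eq_square algebra_simps)
    also have "(1 / u + x / u^2) * (1 / u + t / u^2) - x * t / (u^2)^2 = (u + x + t) / u^3"
      using u0 by (simp add: field_simps power2_eq_square power3_eq_cube)
    also have "u + x + t = 1" by (simp add: u_def x_def t_def)
    finally show "det (complex_hessian f q) = of_real (n^2 / (1 - fst (radii q) - snd (radii q)) ^ 3)"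
      unfolding e by simp
  qed
  have L: "\<forall>q\<in>egg 1. ln (det (complex_hessian f q)) = of_real (ln (n^2) - 3 * ln (1 - fst (radii q) - snd (radii q)))"
  proof
    fix q assume q: "q \<in> egg 1"
    have "n^2 / (1 - fst (radii q) - snd (radii q)) ^ 3 > 0" using u[OF q] n by simp
    then have "ln (det (complex_hessian f q)) = of_real (ln (n^2 / (1 - fst (radii q) - snd (radii q)) ^ 3))"
      unfolding det[OF q] by (rule Ln_of_real)
    also have "ln (n^2 / (1 - fst (radii q) - snd (radii q)) ^ 3) = ln (n^2) - 3 * ln (1 - fst (radii q) - snd (radii q))"
      using u[OF q] n by (simp add: ln_div ln_realpow)
    finally show "ln (det (complex_hessian f q)) = of_real (ln (n^2) - 3 * ln (1 - fst (radii q) - snd (radii q)))" .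
  qed
  note h = complex_hessian_ball[OF p f] and h' = complex_hessian_ball[OF p L]
  have k: "(- 3 / n) *\<^sub>R (of_real n * X) = - (of_real 3 * X)" for X :: complex
    using n by (simp add: scaleR_conv_of_real)
  show ?thesis
    unfolding ricci_def
    by (intro matrix_2_eqI) (simp_all only: vector_uminus_component vector_scaleR_component h h' k)
qed

section \<open>The kernels in terms of potentials\<close>

abbreviation hardy_\<gamma> :: "nat \<Rightarrow> real" where "hardy_\<gamma> m \<equiv> (real m - 1) / (real m + 2)"
abbreviation bergman_\<gamma> :: "nat \<Rightarrow> real" where "bergman_\<gamma> m \<equiv> (real m - 1) / (real m + 1)"

lemma gamma_bounds:
  assumes "m \<ge> 1"
  shows "0 \<le> hardy_\<gamma> m" "hardy_\<gamma> m < 1" "0 \<le> bergman_\<gamma> m" "bergman_\<gamma> m < 1"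
  using assms by simp_all

text \<open>Origin of \<open>hardy_\<gamma>\<close>: with \<open>c = A0 + A1\<close>, the sum
  \<open>A0 / u + A1 / u^2\<close> equals \<open>c * (1 - \<gamma> * (1 - u)) / u^2\<close> for
  \<open>\<gamma> = A0 / c\<close>.\<close>

lemma fefferman_szego_potential:
  assumes m: "m \<ge> 1" and \<alpha>: "\<alpha> > 0"
  shows "\<exists>C. \<forall>p\<in>egg m. ln (fefferman_szego_kernel m \<alpha> p p) = of_real (1 * egg_potential m C (hardy_e m) 2 (hardy_\<gamma> m) (radii p))"
proof (intro exI ballI)
  fix p assume p: "p \<in> egg m"
  define c where "c = hardy_A0 m + hardy_A1 m"
  have c: "c > 0" using hardy_A_bounds(5)[OF m] by (simp only: c_def add_0_right)
  have "c = real m powr (1/3) / (2 * pi^2) * ((real m + 2) / (3 * m))" using m by (simp add: c_def field_simps)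
  then have "c * hardy_\<gamma> m = real m powr (1/3) / (2 * pi^2) * ((real m + 2) / (3 * m) * hardy_\<gamma> m)" by (simp only: mult.assoc)
  also have "(real m + 2) / (3 * m) * hardy_\<gamma> m = (real m - 1) / (3 * m)" using m by simp
  finally have c\<gamma>: "c * hardy_\<gamma> m = hardy_A0 m" using m by (simp add: field_simps)
  have "hardy_A0 m / u + hardy_A1 m / u^2 + 2 * 0 / u^3 = c * (1 - hardy_\<gamma> m * (1 - u)) / u ^ 2" if u: "u > 0" for u
  proof -
    have "c * (1 - hardy_\<gamma> m * (1 - u)) = c - (c * hardy_\<gamma> m) * (1 - u)" by (simp only: right_diff_distrib mult_1_right mult.assoc)
    also have "\<dots> = hardy_A0 m * u + hardy_A1 m"
    proof -
      have "a + b - a * (1 - u) = a * u + b" for a b by (simp add: algebra_simps)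
      then show ?thesis unfolding c\<gamma> unfolding c_def .
    qed
    finally have "c * (1 - hardy_\<gamma> m * (1 - u)) = hardy_A0 m * u + hardy_A1 m" .
    moreover have "a / u + b / u^2 + 2 * 0 / u^3 = (a * u + b) / u^2" for a b
      using u by (simp add: power2_eq_square add_divide_distrib)
    ultimately show ?thesis by (simp only:)
  qed
  from ln_egg_kernel[OF m p c gamma_bounds(1,2)[OF m] this, of "hardy_e m"]
  show "ln (fefferman_szego_kernel m \<alpha> p p) = of_real (1 * egg_potential m (ln c) (hardy_e m) 2 (hardy_\<gamma> m) (radii p))"
    unfolding fefferman_szego_kernel_eq[OF m \<alpha> p] by (simp only: mult_1 of_nat_numeral)
qed

text \<open>Origin of \<open>bergman_\<gamma>\<close>: with \<open>c = A1 + 2 * A2\<close>, the sum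
  \<open>A1 / u^2 + 2 * A2 / u^3\<close> equals \<open>c * (1 - \<gamma> * (1 - u)) / u^3\<close>
  for \<open>\<gamma> = A1 / c\<close>.\<close>

lemma bergman_potential:
  assumes m: "m \<ge> 1"
  shows "\<exists>C. \<forall>p\<in>egg m. ln (bergman_kernel (egg m) p p) = of_real (1 * egg_potential m C (2 + 1 / m) 3 (bergman_\<gamma> m) (radii p))"
proof (intro exI ballI)
  fix p assume p: "p \<in> egg m"
  define A1 A2 where "A1 = (real m - 1) / (m * pi^2)" and "A2 = 1 / (m * pi^2)"
  define c where "c = A1 + 2 * A2"
  have c': "c = (real m + 1) / (m * pi^2)" by (simp add: c_def A1_def A2_def add_divide_distrib[symmetric])
  then have c: "c > 0" using m by simp
  have c\<gamma>: "c * bergman_\<gamma> m = A1" by (simp add: c' A1_def)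
  have "0 / u + A1 / u^2 + 2 * A2 / u^3 = c * (1 - bergman_\<gamma> m * (1 - u)) / u ^ 3" if u: "u > 0" for u
  proof -
    have "c * (1 - bergman_\<gamma> m * (1 - u)) = c - (c * bergman_\<gamma> m) * (1 - u)" by (simp only: right_diff_distrib mult_1_right mult.assoc)
    also have "\<dots> = A1 * u + 2 * A2" unfolding c\<gamma> by (simp add: c_def algebra_simps)
    finally have "c * (1 - bergman_\<gamma> m * (1 - u)) = A1 * u + 2 * A2" .
    moreover have "0 / u + a / u^2 + b / u^3 = (a * u + b) / u^3" for a b
      using u by (simp add: power2_eq_square power3_eq_cube add_divide_distrib)
    ultimately show ?thesis by (simp only:)
  qed
  from ln_egg_kernel[OF m p c gamma_bounds(3,4)[OF m] this, of "2 + 1 / m"]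
  show "ln (bergman_kernel (egg m) p p) = of_real (1 * egg_potential m (ln c) (2 + 1 / m) 3 (bergman_\<gamma> m) (radii p))"
    unfolding bergman_kernel_eq[OF m p] A1_def A2_def by (simp only: mult_1 of_nat_numeral)
qed

text \<open>At \<open>m = 1\<close> both \<open>\<gamma>\<close> vanish, and up to constants the
  potentials of the three metrics are \<open>- n * ln u\<close> with \<open>n = 2\<close>,
  \<open>3\<close> and \<open>1\<close>. The factors \<open>2 / 3\<close> and \<open>2\<close> are
  ratios of these numbers; \<open>- 3 / 2\<close> is \<open>- 3 / n\<close> at
  \<open>n = 2\<close>.\<close>

lemma ball_metrics:
  fixes \<alpha> :: real
  assumes \<alpha>: "\<alpha> > 0"
  shows "kahler_einstein_on (egg 1) (fefferman_szego_metric 1 \<alpha>)"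
    and "positive_multiple_on (egg 1) (fefferman_szego_metric 1 \<alpha>) (bergman_metric (egg 1))"
    and "positive_multiple_on (egg 1) (fefferman_szego_metric 1 \<alpha>) (rho_root_metric 1)"
proof -
  obtain C where "\<forall>p\<in>egg 1. ln (fefferman_szego_kernel 1 \<alpha> p p) = of_real (1 * egg_potential 1 C (hardy_e 1) 2 (hardy_\<gamma> 1) (radii p))"
    using fefferman_szego_potential[OF order.refl \<alpha>] by blast
  then have F: "\<forall>p\<in>egg 1. ln (fefferman_szego_kernel 1 \<alpha> p p) = of_real (C - 2 * ln (1 - fst (radii p) - snd (radii p)))"
    using egg_potential_ball[of _ C 2] by simp
  obtain C' where "\<forall>p\<in>egg 1. ln (bergman_kernel (egg 1) p p) = of_real (1 * egg_potential 1 C' (2 + 1 / real 1) 3 (bergman_\<gamma> 1) (radii p))"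
    using bergman_potential[OF order.refl] by blast
  then have B: "\<forall>p\<in>egg 1. ln (bergman_kernel (egg 1) p p) = of_real (C' - 3 * ln (1 - fst (radii p) - snd (radii p)))"
    using egg_potential_ball[of _ C' 3] by simp
  have R: "\<forall>p\<in>egg 1. complex_of_real (ln (rho_root 1 p)) = of_real (0 - (- 1) * ln (1 - fst (radii p) - snd (radii p)))"
    using rho_root_potential[OF order.refl] egg_potential_ball[of _ 0 1] by simp
  have k: "(2 / 3) *\<^sub>R (of_real 3 * X) = of_real 2 * X" "2 *\<^sub>R (- (of_real (- 1) * X)) = of_real 2 * X" for X :: complex
    by (simp_all add: scaleR_conv_of_real)
  show "kahler_einstein_on (egg 1) (fefferman_szego_metric 1 \<alpha>)"
    unfolding kahler_einstein_on_def fefferman_szego_metric_def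
    using ricci_ball[OF _ F] by (intro exI[of _ "- 3 / 2"]) simp
  show "positive_multiple_on (egg 1) (fefferman_szego_metric 1 \<alpha>) (bergman_metric (egg 1))"
    unfolding positive_multiple_on_def
  proof (intro exI[of _ "2 / 3"] conjI ballI)
    fix p assume p: "p \<in> egg 1"
    note h = complex_hessian_ball[OF p F] complex_hessian_ball[OF p B]
    show "fefferman_szego_metric 1 \<alpha> p = (2 / 3) *\<^sub>R bergman_metric (egg 1) p"
      unfolding fefferman_szego_metric_def bergman_metric_def
      by (intro matrix_2_eqI) (simp_all only: vector_scaleR_component h k)
  qed simp
  show "positive_multiple_on (egg 1) (fefferman_szego_metric 1 \<alpha>) (rho_root_metric 1)"
    unfolding positive_multiple_on_def
  proof (intro exI[of _ 2] conjI ballI)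
    fix p assume p: "p \<in> egg 1"
    note h = complex_hessian_ball[OF p F] complex_hessian_ball[OF p R]
    show "fefferman_szego_metric 1 \<alpha> p = 2 *\<^sub>R rho_root_metric 1 p"
      unfolding fefferman_szego_metric_def rho_root_metric_def
      by (intro matrix_2_eqI) (simp_all only: vector_scaleR_component vector_uminus_component h k)
  qed simp
qed

section \<open>Refutation for \<open>m > 1\<close>\<close>

text \<open>Comparing the values at \<open>t = 0\<close> and \<open>t = 1 / 2\<close> eliminates
  \<open>\<kappa>\<close> and leaves
  \<open>\<gamma> * (1 - \<gamma>) * (3 - \<gamma>) = 0\<close>.\<close>

lemma not_multiple_of_rho_root:
  fixes \<gamma> \<kappa> :: real
  assumes \<gamma>: "0 < \<gamma>" "\<gamma> < 1"
    and eq: "\<And>t. 0 \<le> t \<Longrightarrow> t < 1 \<Longrightarrow> 2 / (1 - t)^2 - \<gamma> / (1 - \<gamma> * t)^2 = \<kappa> * (1 / (1 - t)^2 - 0 / (1 - 0 * t)^2)"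
  shows False
proof -
  have "\<kappa> = 2 - \<gamma>" using eq[of 0] by simp
  moreover have "8 - \<gamma> / (1 - \<gamma> / 2)^2 = 4 * \<kappa>" using eq[of "1 / 2"] by (simp add: power2_eq_square)
  ultimately have "\<gamma> / (1 - \<gamma> / 2)^2 = 4 * \<gamma>" by simp
  then have "\<gamma> = 4 * \<gamma> * (1 - \<gamma> / 2)^2" using \<gamma> by (simp add: nonzero_divide_eq_eq)
  then have "\<gamma> * ((1 - \<gamma>) * (3 - \<gamma>)) = 0" by (simp add: power2_eq_square algebra_simps)
  then show False using \<gamma> by simp
qed

text \<open>Multiplication by \<open>(1 - t)^2\<close> and passage to \<open>t = 1\<close> isolate
  the leading singularities and give \<open>\<kappa> = 2 / 3\<close>; the value at
  \<open>t = 0\<close> then forces \<open>3 * \<gamma> = 2 * \<delta>\<close>.\<close>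

lemma not_multiple_of_bergman:
  fixes \<gamma> \<delta> \<kappa> :: real
  assumes \<gamma>: "0 \<le> \<gamma>" "\<gamma> < 1" and \<delta>: "0 \<le> \<delta>" "\<delta> < 1" and ne: "3 * \<gamma> \<noteq> 2 * \<delta>"
    and eq: "\<And>t. 0 \<le> t \<Longrightarrow> t < 1 \<Longrightarrow> 2 / (1 - t)^2 - \<gamma> / (1 - \<gamma> * t)^2 = \<kappa> * (3 / (1 - t)^2 - \<delta> / (1 - \<delta> * t)^2)"
  shows False
proof -
  define F where "F = (\<lambda>t. 2 - \<gamma> * ((1 - t) / (1 - \<gamma> * t))^2 - \<kappa> * (3 - \<delta> * ((1 - t) / (1 - \<delta> * t))^2))"
  have "F t = 0" if t: "0 \<le> t" "t < 1" for t
  proof -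
    have "F t = (1 - t)^2 * (2 / (1 - t)^2 - \<gamma> / (1 - \<gamma> * t)^2 - \<kappa> * (3 / (1 - t)^2 - \<delta> / (1 - \<delta> * t)^2))"
      using t by (simp add: F_def power_divide algebra_simps)
    then show ?thesis using eq[OF t] by simp
  qed
  then have "eventually (\<lambda>t. F t = 0) (at_left 1)"
    using eventually_at_left_real[of 0 1] by (auto elim!: eventually_mono)
  moreover have "(F \<longlongrightarrow> F 1) (at_left 1)"
  proof -
    have "isCont F 1" unfolding F_def using \<gamma> \<delta> by (intro continuous_intros) auto
    then show ?thesis by (simp add: continuous_at filterlim_at_split)
  qed
  ultimately have "F 1 = 0"
    using tendsto_unique[of "at_left (1::real)" F "F 1" 0] tendsto_eventually by (metis trivial_limit_at_left_real)
  then have \<kappa>: "\<kappa> = 2 / 3" by (simp add: F_def)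
  have "2 - \<gamma> = 2 / 3 * (3 - \<delta>)" using eq[of 0] unfolding \<kappa> by simp
  then show False using ne by simp
qed

text \<open>Both derivatives move only the second coordinate. Hence the entry of the Ricci form in
  the \<open>w\<close> direction can be computed from the determinant on the slice, where alone the
  metric is known explicitly.\<close>

lemma wirt_slice:
  "wirt 2 (wirt_bar 2 F) (0, w) = wirt 2 (wirt_bar 2 (\<lambda>q. F (0, snd q))) (0, w)"
  by (simp add: wirt_def wirt_bar_def partial_dir_def cvec_def)

text \<open>The Einstein equation on the slice \<open>z = 0\<close> integrates once; clearing denominators gives a
  polynomial identity, which fails at one of the two points \<open>1 / \<gamma>\<close> and \<open>1\<close>.\<close>

lemma not_kahler_einstein:
  fixes m :: nat and e \<gamma> \<kappa> :: real and g :: "C2 \<Rightarrow> complex^2^2"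
  assumes m: "m \<ge> 1" and e: "e > 0" and \<gamma>: "0 < \<gamma>" "\<gamma> < 1"
    and g11: "\<And>w. cmod w < 1 \<Longrightarrow> g (0, w) $ 1 $ 1 = of_real (1 * (e + cmod w ^ 2 / m * (2 / (1 - cmod w ^ 2) - \<gamma> / (1 - \<gamma> * cmod w ^ 2))))"
    and g12: "\<And>w. cmod w < 1 \<Longrightarrow> g (0, w) $ 1 $ 2 = 0"
    and g22: "\<And>w. cmod w < 1 \<Longrightarrow> g (0, w) $ 2 $ 2 = of_real (1 * (2 / (1 - cmod w ^ 2)^2 - \<gamma> / (1 - \<gamma> * cmod w ^ 2)^2))"
    and ke: "\<And>w. cmod w < 1 \<Longrightarrow> ricci g (0, w) = \<kappa> *\<^sub>R g (0, w)"
  shows False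
proof -
  \<comment> \<open>Numerators in \<open>t = cmod w ^ 2\<close>: the diagonal entries are
    \<open>p1\<close> over \<open>m * (1 - t) * (1 - \<gamma> * t)\<close> and \<open>p2\<close>
    over \<open>(1 - t)^2 * (1 - \<gamma> * t)^2\<close>, so the determinant is \<open>p\<close>
    over \<open>m * (1 - t)^3 * (1 - \<gamma> * t)^3\<close>.\<close>
  define p1 where "p1 = [:e * m:] * ([:1, - 1:] * [:1, - \<gamma>:]) + [:0, 1:] * (smult 2 [:1, - \<gamma>:] - smult \<gamma> [:1, - 1:])"
  define p2 where "p2 = smult 2 ([:1, - \<gamma>:]^2) - smult \<gamma> ([:1, - 1:]^2)"
  define p where "p = p1 * p2"
  have gt: "1 - \<gamma> * t > 0" if "t < 1" for t
  proof (cases "t \<ge> 0")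
    case True
    then have "\<gamma> * t \<le> 1 * t" using \<gamma> by (intro mult_right_mono) auto
    then show ?thesis using that by linarith
  next
    case False
    then have "\<gamma> * t \<le> 0" using \<gamma> by (intro mult_nonneg_nonpos) auto
    then show ?thesis by linarith
  qed
  have le: "1 - t \<le> 1 - \<gamma> * t" if "0 \<le> t" for t
    using mult_right_mono[of \<gamma> 1 t] \<gamma> that by simp
  have p1: "poly p1 t > 0" if t: "0 \<le> t" "t < 1" for t
  proof -
    have "\<gamma> * (1 - t) \<le> 1 * (1 - \<gamma> * t)" using \<gamma> t le[OF t(1)] by (intro mult_mono) auto
    moreover have "0 \<le> 2 * a - b" if "b \<le> 1 * a" "0 < a" for a b :: real using that by linarith
    ultimately have "0 \<le> 2 * (1 - \<gamma> * t) - \<gamma> * (1 - t)" using gt[OF t(2)] by blast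
    then have "0 \<le> t * (2 * (1 - \<gamma> * t) - \<gamma> * (1 - t))" using t by simp
    moreover have "0 < e * m * ((1 - t) * (1 - \<gamma> * t))" using e m t gt[OF t(2)] by simp
    ultimately show ?thesis by (simp add: p1_def algebra_simps)
  qed
  have p2: "poly p2 t > 0" if t: "0 \<le> t" "t < 1" for t
  proof -
    have "(1 - t)^2 \<le> (1 - \<gamma> * t)^2" using t le[OF t(1)] by (intro power_mono) auto
    then have "\<gamma> * (1 - t)^2 \<le> 1 * (1 - \<gamma> * t)^2" using \<gamma> by (intro mult_mono) auto
    moreover have "(1 - \<gamma> * t)^2 > 0" using gt[OF t(2)] by simp
    ultimately have "2 * (1 - \<gamma> * t)^2 - \<gamma> * (1 - t)^2 > 0" by linarith
    then show ?thesis by (simp add: p2_def poly_power algebra_simps)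
  qed
  have pp: "poly p t > 0" if "0 \<le> t" "t < 1" for t using p1 p2 that by (simp add: p_def)
  \<comment> \<open>An open set containing \<open>[0, 1)\<close>, so that derivatives at
    \<open>t = 0\<close> are two-sided.\<close>
  define U where "U = {t. t < 1 \<and> poly p t > 0}"
  have oU: "open U" unfolding U_def by (intro open_Collect_conj open_Collect_less continuous_intros)
  define \<phi> where "\<phi> = (\<lambda>t. ln (poly p t) - ln m - 3 * ln (1 - t) - 3 * ln (1 - \<gamma> * t))"
  define \<phi>1 where "\<phi>1 = (\<lambda>t. poly (pderiv p) t / poly p t + 3 / (1 - t) + 3 * \<gamma> / (1 - \<gamma> * t))"
  have d1: "(\<phi> has_real_derivative \<phi>1 t) (at t)" if "t \<in> U" for t
  proof -
    have t: "t < 1" "poly p t > 0" using that by (auto simp: U_def)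
    note g = gt[OF t(1)]
    have "((\<lambda>t. ln (poly p t)) has_real_derivative poly (pderiv p) t / poly p t) (at t)"
      using DERIV_chain2[OF DERIV_ln_divide[OF t(2)] poly_DERIV] by simp
    moreover have "((\<lambda>t. 3 * ln (1 - t)) has_real_derivative - (3 / (1 - t))) (at t)"
      using t by (auto intro!: derivative_eq_intros)
    moreover have "((\<lambda>t. 3 * ln (1 - \<gamma> * t)) has_real_derivative - (3 * \<gamma> / (1 - \<gamma> * t))) (at t)"
      using g by (auto intro!: derivative_eq_intros)
    ultimately have "(\<phi> has_real_derivative poly (pderiv p) t / poly p t - 0 - - (3 / (1 - t)) - - (3 * \<gamma> / (1 - \<gamma> * t))) (at t)"
      unfolding \<phi>_def by (intro DERIV_diff DERIV_const)
    then show ?thesis by (simp add: \<phi>1_def)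
  qed
  have d2: "(\<phi>1 has_real_derivative deriv \<phi>1 t) (at t)" if "t \<in> U" for t
  proof -
    have t: "t < 1" "poly p t > 0" using that by (auto simp: U_def)
    have "\<phi>1 field_differentiable (at t)"
      unfolding \<phi>1_def using t gt[OF t(1)]
      by (intro field_differentiable_add field_differentiable_divide field_differentiable_diff field_differentiable_mult
          field_differentiable_const field_differentiable_ident) (auto simp: field_differentiable_def intro: poly_DERIV)
    then show ?thesis by (rule field_differentiable_derivI)
  qed
  have U: "cmod w ^ 2 \<in> U" if "cmod w < 1" for w
    using pp[of "cmod w ^ 2"] that by (simp add: U_def power_less_one_iff)
  have det: "ln (det (g (0, w))) = of_real (\<phi> (cmod w ^ 2))" if w: "cmod w < 1" for w
  proof -
    define t where "t = cmod w ^ 2"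
    have t: "0 \<le> t" "t < 1" using w by (simp_all add: t_def power_less_one_iff)
    note g = gt[OF t(2)]
    have a: "e + t / m * (2 / (1 - t) - \<gamma> / (1 - \<gamma> * t)) = poly p1 t / (m * ((1 - t) * (1 - \<gamma> * t)))"
    proof -
      have "2 / (1 - t) - \<gamma> / (1 - \<gamma> * t) = (2 * (1 - \<gamma> * t) - \<gamma> * (1 - t)) / ((1 - t) * (1 - \<gamma> * t))"
        using t g by (simp add: diff_frac_eq)
      moreover have "e = e * m * ((1 - t) * (1 - \<gamma> * t)) / (m * ((1 - t) * (1 - \<gamma> * t)))" using t g m by simp
      moreover have "poly p1 t = e * m * ((1 - t) * (1 - \<gamma> * t)) + t * (2 * (1 - \<gamma> * t) - \<gamma> * (1 - t))"
        by (simp add: p1_def algebra_simps)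
      ultimately show ?thesis by (simp add: add_divide_distrib)
    qed
    have b: "2 / (1 - t)^2 - \<gamma> / (1 - \<gamma> * t)^2 = poly p2 t / ((1 - t)^2 * (1 - \<gamma> * t)^2)"
    proof -
      have "2 / (1 - t)^2 - \<gamma> / (1 - \<gamma> * t)^2 = (2 * (1 - \<gamma> * t)^2 - \<gamma> * (1 - t)^2) / ((1 - t)^2 * (1 - \<gamma> * t)^2)"
        using t g by (simp add: diff_frac_eq)
      moreover have "poly p2 t = 2 * (1 - \<gamma> * t)^2 - \<gamma> * (1 - t)^2"
        by (simp add: p2_def poly_power algebra_simps)
      ultimately show ?thesis by simp
    qed
    define G where "G = poly p t / (m * (1 - t)^3 * (1 - \<gamma> * t)^3)"
    have G0: "G > 0" unfolding G_def using pp[OF t] t g m by simp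
    have "det (g (0, w)) = of_real ((e + t / m * (2 / (1 - t) - \<gamma> / (1 - \<gamma> * t))) * (2 / (1 - t)^2 - \<gamma> / (1 - \<gamma> * t)^2))"
      unfolding det_2 g11[OF w] g12[OF w] g22[OF w] t_def by simp
    also have "(e + t / m * (2 / (1 - t) - \<gamma> / (1 - \<gamma> * t))) * (2 / (1 - t)^2 - \<gamma> / (1 - \<gamma> * t)^2) = G"
      unfolding a b G_def p_def by (simp add: power2_eq_square power3_eq_cube)
    finally have "ln (det (g (0, w))) = of_real (ln G)" using G0 by (simp add: Ln_of_real)
    also have "ln G = \<phi> t" unfolding G_def \<phi>_def using pp[OF t] t g m
      by (simp add: ln_div ln_mult ln_realpow)
    finally show ?thesis by (simp add: t_def)
  qed
  \<comment> \<open>The Einstein equation in the \<open>w\<close> direction: for a function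
    \<open>\<phi>\<close> of \<open>cmod w ^ 2\<close> the Hessian entry is
    \<open>\<phi>' + t * \<phi>''\<close>.\<close>
  have ode: "\<phi>1 t + deriv \<phi>1 t * t + \<kappa> * (2 / (1 - t)^2 - \<gamma> / (1 - \<gamma> * t)^2) = 0" if t: "0 \<le> t" "t < 1" for t
  proof -
    define w where "w = complex_of_real (sqrt t)"
    have w: "cmod w < 1" "cmod w ^ 2 = t" using t by (simp_all add: w_def)
    define F where "F = (\<lambda>q. ln (det (g q)))"
    have "eventually (\<lambda>q::C2. cmod (snd q) < 1) (nhds (0, w))"
      by (rule eventually_nhds_in_open[of "{q. cmod (snd q) < 1}", simplified]) (use w in \<open>auto intro!: open_Collect_less continuous_intros\<close>)
    then have ev: "eventually (\<lambda>q. F (0, snd q) = of_real (\<phi> (snd (radii q)))) (nhds (0, w))"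
      by eventually_elim (simp add: F_def det radii_def)
    have rw: "radii (0, w) = (0, t)" by (simp add: radii_def w)
    have "eventually (\<lambda>r::real \<times> real. snd r \<in> U) (nhds (radii (0, w)))"
    proof -
      have "open (snd -` U :: (real \<times> real) set)" by (intro open_vimage oU continuous_intros)
      moreover have "radii (0, w) \<in> snd -` U" using U[OF w(1)] by (simp add: rw w)
      ultimately show ?thesis using eventually_nhds_in_open by fastforce
    qed
    then have ev2: "eventually (\<lambda>r. ((\<lambda>r. \<phi> (snd r)) has_derivative (\<lambda>h. 0 * fst h + \<phi>1 (snd r) * snd h)) (at r)) (nhds (radii (0, w)))"
    proof eventually_elim
      case (elim r)
      from has_derivative_compose[OF has_derivative_snd[OF has_derivative_ident] d1[OF elim, unfolded has_field_derivative_def]]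
      show ?case by simp
    qed
    have D1: "((\<lambda>r::real \<times> real. 0::real) has_derivative (\<lambda>_. 0)) (at (radii (0, w)))" by simp
    have tU: "snd (radii (0, w)) \<in> U" using U[OF w(1)] by (simp add: rw w)
    have D2: "((\<lambda>r. \<phi>1 (snd r)) has_derivative (\<lambda>h. deriv \<phi>1 (snd (radii (0, w))) * snd h)) (at (radii (0, w)))"
      using has_derivative_compose[OF has_derivative_snd[OF has_derivative_ident] d2[OF tU, unfolded has_field_derivative_def]] .
    note h = wirt_wirt_bar_radial(4)[OF ev2 D1 D2]
    have "complex_hessian (\<lambda>q. F (0, snd q)) (0, w) $ 2 $ 2 = of_real (\<phi>1 t + deriv \<phi>1 t * t)"
      unfolding complex_hessian_cong[OF ev] unfolding complex_hessian_def vec_lambda_beta h by (simp add: rw w)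
    then have "complex_hessian F (0, w) $ 2 $ 2 = of_real (\<phi>1 t + deriv \<phi>1 t * t)"
      by (simp add: complex_hessian_def wirt_slice[of F])
    then have "ricci g (0, w) $ 2 $ 2 = - of_real (\<phi>1 t + deriv \<phi>1 t * t)"
      by (simp add: ricci_def F_def)
    then have "- complex_of_real (\<phi>1 t + deriv \<phi>1 t * t) = of_real (\<kappa> * (2 / (1 - t)^2 - \<gamma> / (1 - \<gamma> * t)^2))"
      unfolding ke[OF w(1)] vector_scaleR_component g22[OF w(1)] w(2) by (simp add: scaleR_conv_of_real)
    then have "- (\<phi>1 t + deriv \<phi>1 t * t) = \<kappa> * (2 / (1 - t)^2 - \<gamma> / (1 - \<gamma> * t)^2)"
      by (simp only: of_real_minus[symmetric] of_real_eq_iff)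
    then show ?thesis by linarith
  qed
  \<comment> \<open>A primitive of the left side of \<open>ode\<close>: \<open>t * \<phi>1 t\<close>
    accounts for the first two terms, and the fractions are the primitives of the metric entry that
    vanish at 0. Hence \<open>\<Psi>\<close> is constant and equal to
    \<open>\<Psi> 0 = 0\<close>.\<close>
  define \<Psi> where "\<Psi> = (\<lambda>t. t * \<phi>1 t + \<kappa> * (2 * t / (1 - t) - \<gamma> * t / (1 - \<gamma> * t)))"
  have \<Psi>d: "(\<Psi> has_real_derivative 0) (at t)" if t: "0 \<le> t" "t < 1" for t
  proof -
    have tU: "t \<in> U" using t pp[OF t] by (simp add: U_def)
    note g = gt[OF t(2)]
    have "((\<lambda>t. 2 * t / (1 - t)) has_real_derivative 2 / (1 - t)^2) (at t)"
      using t by (auto intro!: derivative_eq_intros simp: power2_eq_square)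
    moreover have "((\<lambda>t. \<gamma> * t / (1 - \<gamma> * t)) has_real_derivative \<gamma> / (1 - \<gamma> * t)^2) (at t)"
      using g by (auto intro!: derivative_eq_intros simp: power2_eq_square algebra_simps)
    ultimately have "(\<Psi> has_real_derivative (1 * \<phi>1 t + deriv \<phi>1 t * t) + \<kappa> * (2 / (1 - t)^2 - \<gamma> / (1 - \<gamma> * t)^2)) (at t)"
      unfolding \<Psi>_def by (intro DERIV_add DERIV_cmult DERIV_diff DERIV_mult DERIV_ident d2[OF tU])
    then show ?thesis using ode[OF t] by simp
  qed
  have \<Psi>0: "\<Psi> t = 0" if t: "0 < t" "t < 1" for t
  proof -
    have "\<Psi> t = \<Psi> 0"
    proof (rule DERIV_isconst2[of 0 t])
      show "continuous_on {0..t} \<Psi>"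
        using t by (intro DERIV_atLeastAtMost_imp_continuous_on) (use \<Psi>d in force)
    qed (use t \<Psi>d in auto)
    then show ?thesis by (simp add: \<Psi>_def)
  qed
  \<comment> \<open>The equation \<open>\<Psi> t / t = 0\<close> multiplied by
    \<open>p * (1 - t) * (1 - \<gamma> * t)\<close>; the constants 3 come from
    \<open>\<phi>1\<close>, the terms \<open>2 * \<kappa>\<close> and \<open>- \<kappa>\<close> from
    the metric entry.\<close>
  define R where "R = pderiv p * ([:1, - 1:] * [:1, - \<gamma>:]) + p * (smult (3 + 2 * \<kappa>) [:1, - \<gamma>:] + smult ((3 - \<kappa>) * \<gamma>) [:1, - 1:])"
  have Rt: "poly R t = poly (pderiv p) t * ((1 - t) * (1 - \<gamma> * t))
      + poly p t * ((3 + 2 * \<kappa>) * (1 - \<gamma> * t) + (3 - \<kappa>) * \<gamma> * (1 - t))" for t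
    by (simp add: R_def algebra_simps)
  have "poly R t = 0" if t: "0 < t" "t < 1" for t
  proof -
    note g = gt[OF t(2)]
    have P: "poly p t > 0" using pp t by simp
    have "t * (\<phi>1 t + \<kappa> * (2 / (1 - t) - \<gamma> / (1 - \<gamma> * t))) = 0"
      using \<Psi>0[OF t] by (simp add: \<Psi>_def algebra_simps)
    then have z: "\<phi>1 t + \<kappa> * (2 / (1 - t) - \<gamma> / (1 - \<gamma> * t)) = 0" using t by simp
    define u v P' where "u = 1 - t" and "v = 1 - \<gamma> * t" and "P' = poly (pderiv p) t"
    have uv: "u > 0" "v > 0" using t g by (simp_all add: u_def v_def)
    have "P' / poly p t + 3 / u + 3 * \<gamma> / v + \<kappa> * (2 / u - \<gamma> / v) = 0"
      using z by (simp add: \<phi>1_def u_def v_def P'_def)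
    then have "poly p t * u * v * (P' / poly p t + 3 / u + 3 * \<gamma> / v + \<kappa> * (2 / u - \<gamma> / v)) = 0" by simp
    moreover have "poly p t * u * v * (P' / poly p t + 3 / u + 3 * \<gamma> / v + \<kappa> * (2 / u - \<gamma> / v))
        = P' * (u * v) + poly p t * ((3 + 2 * \<kappa>) * v + (3 - \<kappa>) * \<gamma> * u)"
      using P uv by (simp add: field_simps)
    moreover have "poly R t = P' * (u * v) + poly p t * ((3 + 2 * \<kappa>) * v + (3 - \<kappa>) * \<gamma> * u)"
      by (simp only: Rt u_def v_def P'_def)
    ultimately show ?thesis by simp
  qed
  \<comment> \<open>A polynomial vanishing on an interval is zero, so \<open>R\<close> may be
    evaluated at \<open>1\<close> and at \<open>1 / \<gamma> > 1\<close>, beyond the range of the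
    metric.\<close>
  then have "{0<..<1} \<subseteq> {t. poly R t = 0}" by auto
  then have "infinite {t. poly R t = 0}" by (rule infinite_super) (rule infinite_Ioo[OF zero_less_one])
  then have "R = 0" using poly_roots_finite[of R] by blast
  then have R0: "poly R t = 0" for t by simp
  have q1: "poly p (1 / \<gamma>) \<noteq> 0"
  proof -
    have g: "1 - 1 / \<gamma> \<noteq> 0" using \<gamma> by simp
    have "poly p1 (1 / \<gamma>) = - (1 - 1 / \<gamma>)" using \<gamma> by (simp add: p1_def field_simps)
    moreover have "poly p2 (1 / \<gamma>) = - \<gamma> * (1 - 1 / \<gamma>)^2" using \<gamma> by (simp add: p2_def poly_power)
    ultimately show ?thesis using g \<gamma> by (simp add: p_def)
  qed
  have q2: "poly p 1 \<noteq> 0"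
  proof -
    have "poly p1 1 = 2 * (1 - \<gamma>)" "poly p2 1 = 2 * (1 - \<gamma>)^2" by (simp_all add: p1_def p2_def poly_power algebra_simps)
    then show ?thesis using \<gamma> by (simp add: p_def)
  qed
  \<comment> \<open>At either point the term with \<open>pderiv p\<close> and one of the other two
    summands vanish. As \<open>p\<close> does not, \<open>1 / \<gamma>\<close> forces
    \<open>\<kappa> = 3\<close> while \<open>1\<close> forces
    \<open>\<kappa> = - 3 / 2\<close>.\<close>
  have "poly p (1 / \<gamma>) * ((3 - \<kappa>) * \<gamma> * (1 - 1 / \<gamma>)) = 0"
    using R0[of "1 / \<gamma>"] \<gamma> unfolding Rt by simp
  then have "\<kappa> = 3" using q1 \<gamma> by simp
  moreover have "poly p 1 * ((3 + 2 * \<kappa>) * (1 - \<gamma>)) = 0"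
    using R0[of 1] unfolding Rt by simp
  then have "3 + 2 * \<kappa> = 0" using q2 \<gamma> by simp
  ultimately show False by simp
qed

theorem theorem1p3:
  fixes m :: nat and \<alpha> :: real
  assumes "m \<ge> 1" and "\<alpha> > 0"
  shows "(kahler_einstein_on (egg m) (fefferman_szego_metric m \<alpha>)
            \<longleftrightarrow> positive_multiple_on (egg m) (fefferman_szego_metric m \<alpha>) (bergman_metric (egg m)))
       \<and> (positive_multiple_on (egg m) (fefferman_szego_metric m \<alpha>) (bergman_metric (egg m))
            \<longleftrightarrow> positive_multiple_on (egg m) (fefferman_szego_metric m \<alpha>) (rho_root_metric m))
       \<and> (positive_multiple_on (egg m) (fefferman_szego_metric m \<alpha>) (rho_root_metric m)
            \<longleftrightarrow> m = 1)"
proof (cases "m = 1")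
  case True
  then show ?thesis using ball_metrics[OF assms(2)] by simp
next
  case False
  \<comment> \<open>For \<open>m \<ge> 2\<close> the three statements on the metrics are refuted one
    by one, so the equivalences hold with all sides false.\<close>
  then have m2: "real m \<ge> 2" using assms(1) by linarith
  note m = assms(1) and \<gamma> = gamma_bounds[OF assms(1)]
  have \<gamma>0: "0 < hardy_\<gamma> m" using m2 by simp
  have e0: "hardy_e m > 0" by (rule hardy_A_bounds(1)[OF m])
  obtain C where F: "\<forall>p\<in>egg m. ln (fefferman_szego_kernel m \<alpha> p p) = of_real (1 * egg_potential m C (hardy_e m) 2 (hardy_\<gamma> m) (radii p))"
    using fefferman_szego_potential[OF assms] by blast
  obtain C' where B: "\<forall>p\<in>egg m. ln (bergman_kernel (egg m) p p) = of_real (1 * egg_potential m C' (2 + 1 / m) 3 (bergman_\<gamma> m) (radii p))"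
    using bergman_potential[OF m] by blast
  have R: "\<forall>p\<in>egg m. complex_of_real (ln (rho_root m p)) = of_real (- 1 * egg_potential m 0 (1 / m) 1 0 (radii p))"
    using rho_root_potential[OF m] by blast
  have in_egg: "(0, w) \<in> egg m" if "cmod w < 1" for w
    using that m by (simp add: egg_def power_less_one_iff)
  note hF = complex_hessian_egg_potential[OF _ m \<gamma>(1,2) F, folded fefferman_szego_metric_def]
    and hB = complex_hessian_egg_potential[OF _ m \<gamma>(3,4) B, folded bergman_metric_def]
    and hR = complex_hessian_egg_potential[OF _ m order.refl zero_less_one R]
  have slice: "\<exists>w. cmod w < 1 \<and> cmod w ^ 2 = t" if "0 \<le> t" "t < 1" for t
    using that by (intro exI[of _ "complex_of_real (sqrt t)"]) simp
  have "\<not> kahler_einstein_on (egg m) (fefferman_szego_metric m \<alpha>)"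
  proof
    assume "kahler_einstein_on (egg m) (fefferman_szego_metric m \<alpha>)"
    then obtain c where "\<forall>p\<in>egg m. ricci (fefferman_szego_metric m \<alpha>) p = c *\<^sub>R fefferman_szego_metric m \<alpha> p"
      unfolding kahler_einstein_on_def by blast
    then have "ricci (fefferman_szego_metric m \<alpha>) (0, w) = c *\<^sub>R fefferman_szego_metric m \<alpha> (0, w)" if "cmod w < 1" for w
      using in_egg[OF that] by blast
    from not_kahler_einstein[OF m e0 \<gamma>0 \<gamma>(2) hF(1) hF(3) hF(4) this] show False .
  qed
  moreover have "\<not> positive_multiple_on (egg m) (fefferman_szego_metric m \<alpha>) (bergman_metric (egg m))"
  proof
    assume "positive_multiple_on (egg m) (fefferman_szego_metric m \<alpha>) (bergman_metric (egg m))"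
    then obtain c where c: "\<forall>p\<in>egg m. fefferman_szego_metric m \<alpha> p = c *\<^sub>R bergman_metric (egg m) p"
      unfolding positive_multiple_on_def by blast
    have "2 / (1 - t)^2 - hardy_\<gamma> m / (1 - hardy_\<gamma> m * t)^2 = c * (3 / (1 - t)^2 - bergman_\<gamma> m / (1 - bergman_\<gamma> m * t)^2)"
      if t: "0 \<le> t" "t < 1" for t
    proof -
      obtain w where w: "cmod w < 1" "cmod w ^ 2 = t" using slice[OF t] by blast
      have "fefferman_szego_metric m \<alpha> (0, w) $ 2 $ 2 = c *\<^sub>R (bergman_metric (egg m) (0, w) $ 2 $ 2)"
        using bspec[OF c in_egg[OF w(1)]] by (simp only: vector_scaleR_component)
      then have "complex_of_real (2 / (1 - t)^2 - hardy_\<gamma> m / (1 - hardy_\<gamma> m * t)^2) = of_real (c * (3 / (1 - t)^2 - bergman_\<gamma> m / (1 - bergman_\<gamma> m * t)^2))"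
        unfolding hF(4)[OF w(1)] hB(4)[OF w(1)] w(2) by (simp only: mult_1 scaleR_conv_of_real of_real_mult)
      then show ?thesis by (simp only: of_real_eq_iff)
    qed
    moreover have "3 * hardy_\<gamma> m \<noteq> 2 * bergman_\<gamma> m"
    proof -
      \<comment> \<open>This product is the difference
        \<open>3 * (m - 1) * (m + 1) - 2 * (m - 1) * (m + 2)\<close> of the two sides after clearing
        denominators.\<close>
      have "(real m - 1) * (real m - 1) > 0" using m2 by simp
      then show ?thesis using m2 by (simp add: field_simps)
    qed
    ultimately show False using not_multiple_of_bergman[OF \<gamma>] by blast
  qed
  moreover have "\<not> positive_multiple_on (egg m) (fefferman_szego_metric m \<alpha>) (rho_root_metric m)"
  proof
    assume "positive_multiple_on (egg m) (fefferman_szego_metric m \<alpha>) (rho_root_metric m)"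
    then obtain c where c: "\<forall>p\<in>egg m. fefferman_szego_metric m \<alpha> p = c *\<^sub>R rho_root_metric m p"
      unfolding positive_multiple_on_def by blast
    have "2 / (1 - t)^2 - hardy_\<gamma> m / (1 - hardy_\<gamma> m * t)^2 = c * (1 / (1 - t)^2 - 0 / (1 - 0 * t)^2)"
      if t: "0 \<le> t" "t < 1" for t
    proof -
      obtain w where w: "cmod w < 1" "cmod w ^ 2 = t" using slice[OF t] by blast
      have "fefferman_szego_metric m \<alpha> (0, w) $ 2 $ 2 = c *\<^sub>R (- complex_hessian (\<lambda>q. of_real (ln (rho_root m q))) (0, w) $ 2 $ 2)"
        using bspec[OF c in_egg[OF w(1)]] by (simp only: vector_scaleR_component vector_uminus_component rho_root_metric_def)
      then have "complex_of_real (2 / (1 - t)^2 - hardy_\<gamma> m / (1 - hardy_\<gamma> m * t)^2) = of_real (c * (1 / (1 - t)^2 - 0 / (1 - 0 * t)^2))"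
        unfolding hF(4)[OF w(1)] hR(4)[OF w(1)] w(2) by (simp add: scaleR_conv_of_real)
      then show ?thesis by (simp only: of_real_eq_iff)
    qed
    then show False by (rule not_multiple_of_rho_root[OF \<gamma>0 \<gamma>(2)])
  qed
  ultimately show ?thesis using False by blast
qed

end
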